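(* Let $g\geq 2$. Let $W_1=[s_1s_3s_5]\subset S_6$ be the cell of $s_1s_3s_5$ in $S_6$, and let $W_2=[s_1s_3s_5\cdots s_{2g+1}]\subset S_{2g+2}$ be the cell of $s_1s_3s_5\cdots s_{2g+1}$ in $S_{2g+2}$. Let $V_{\lambda_6}$ be the $H(q,6)$-module associated with $W_1$ and $V_{\lambda_{2g+2}}$ the $H(q,2g+2)$-module associated with $W_2$. Then for every $w\in W_1$ one has $w\,s_7s_9\cdots s_{2g+1}\in W_2$, and the $\mathbb{Z}[q^{\pm1}]$-linear map defined on basis elements by $$C_w\longmapsto C_{w\,s_7s_9\cdots s_{2g+1}},\qquad w\in W_1,$$ is an embedding of $H(q,6)$-modules $V_{\lambda_6}\hookrightarrow V_{\lambda_{2g+2}}|_{H(q,6)}$. (For $g=2$ the word $s_7s_9\cdots s_{2g+1}$ is empty.)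
   Context: Let $q$ be an indeterminate, and let $s_i=(i,i+1)$, $1\le i\le n-1$, be the standard generators of $S_n$, with $S=\{s_1,\dots,s_{n-1}\}$, length function $l$ and Bruhat order $\leqq$. The Hecke algebra $H(q,n)$ is the $\mathbb{Z}[q^{\pm1}]$-algebra generated by $T_{s_1},\dots,T_{s_{n-1}}$ with relations $T_{s_i}T_{s_{i+1}}T_{s_i}=T_{s_{i+1}}T_{s_i}T_{s_{i+1}}$, $T_{s_i}T_{s_j}=T_{s_j}T_{s_i}$ for $|i-j|>1$, and $T_{s_i}^2=1+(q-q^{-1})T_{s_i}$. It has basis $\{T_w\mid w\in S_n\}$, where $T_w=T_{s_{j_1}}\cdots T_{s_{j_p}}$ for any reduced expression $w=s_{j_1}\cdots s_{j_p}$. $H(q,6)$ is viewed as the subalgebra of $H(q,2g+2)$ generated by $T_{s_1},\dots,T_{s_5}$, and $|_{H(q,6)}$ denotes restriction of the module structure to this subalgebra. Kazhdan-Lusztig basis: let $a\mapsto\overline{a}$ be the ring involution of $\mathbb{Z}[q^{\pm1}]$ with $\overline{q}=q^{-1}$, extended to $H(q,n)$ by $\overline{\sum a_wT_w}=\sum\overline{a_w}\,T_{w^{-1}}^{-1}$. For each $w\in S_n$ there is a unique $C_w\in H(q,n)$ with $\overline{C_w}=C_w$ of the form $C_w=\sum_{y\leqq w}(-q)^{l(w)-l(y)}\,\overline{P_{y,w}(q^2)}\,T_y$, where $P_{w,w}=1$ and, for $y<w$, $P_{y,w}$ is a polynomial with integer coefficients of degree at most $\frac12(l(w)-l(y)-1)$.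 The set $\{C_w\mid w\in S_n\}$ is a $\mathbb{Z}[q^{\pm1}]$-basis of $H(q,n)$. Cells: write $y\prec w$ if $y<w$, $l(w)-l(y)$ is odd and $P_{y,w}$ has degree exactly $\frac12(l(w)-l(y)-1)$. Let $\Gamma$ be the graph with vertex set $S_n$ and edges $\{y,w\}$ with $y\prec w$. Put $I_w=\{s_i\in S\mid s_iw<w\}$. Write $x\leqq_\Gamma x'$ if there is a sequence $x=x_0,x_1,\dots,x_k=x'$ such that for each $1\le i\le k$, $\{x_{i-1},x_i\}$ is an edge of $\Gamma$ and $I_{x_{i-1}}\nsubseteq I_{x_i}$. Write $x\sim_\Gamma x'$ if $x\leqq_\Gamma x'$ and $x'\leqq_\Gamma x$; the equivalence class of $w$ is denoted $[w]$ and called a cell. Modules: for $w\in S_n$ let $D_w$ be the $\mathbb{Z}[q^{\pm1}]$-span of $\{C_y\mid y\leqq_\Gamma w\}$ and $D'_w$ the span of $\{C_y\mid y\leqq_\Gamma w,\ y\notin[w]\}$. These are left ideals of $H(q,n)$. The $H(q,n)$-module associated with the cell $[w]$ is $D_w/D'_w$, a free $\mathbb{Z}[q^{\pm1}]$-module with basis the images of $C_x$, $x\in[w]$ (still denoted $C_x$). For the cells of $s_1s_3s_5\in S_6$ and $s_1s_3\cdots s_{2g+1}\in S_{2g+2}$ these modules are denoted $V_{\lambda_6}$ and $V_{\lambda_{2g+2}}$ respectively. *)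

theory Defs
  imports
    "HOL-Library.Poly_Mapping"
    "HOL-Computational_Algebra.Polynomial"
    "HOL-Combinatorics.Permutations"
    "HOL-Algebra.QuotRing"
    "HOL-Algebra.Module"
    "HOL-Algebra.Algebraic_Closure_Type"
begin

section \<open>Left modules over a (not necessarily commutative) ring\<close>

text \<open>The library locale \<^locale>\<open>module\<close> requires a commutative ring of scalars.  We keep its
  record type (whose fields \<^const>\<open>monoid.mult\<close> and \<^const>\<open>monoid.one\<close> play no role in a module)
  and repeat its axioms over an arbitrary ring.\<close>

locale left_module = R?: ring R + M?: abelian_group M
  for R :: "('a, 'r) ring_scheme" (structure) and M :: "('a, 'm, 's) module_scheme" (structure) +
  assumes lsmult_closed:
      "\<lbrakk> a \<in> carrier R; x \<in> carrier M \<rbrakk> \<Longrightarrow> a \<odot>\<^bsub>M\<^esub> x \<in> carrier M"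
    and lsmult_l_distr:
      "\<lbrakk> a \<in> carrier R; b \<in> carrier R; x \<in> carrier M \<rbrakk> \<Longrightarrow>
        (a \<oplus>\<^bsub>R\<^esub> b) \<odot>\<^bsub>M\<^esub> x = a \<odot>\<^bsub>M\<^esub> x \<oplus>\<^bsub>M\<^esub> b \<odot>\<^bsub>M\<^esub> x"
    and lsmult_r_distr:
      "\<lbrakk> a \<in> carrier R; x \<in> carrier M; y \<in> carrier M \<rbrakk> \<Longrightarrow>
        a \<odot>\<^bsub>M\<^esub> (x \<oplus>\<^bsub>M\<^esub> y) = a \<odot>\<^bsub>M\<^esub> x \<oplus>\<^bsub>M\<^esub> a \<odot>\<^bsub>M\<^esub> y"
    and lsmult_assoc:
      "\<lbrakk> a \<in> carrier R; b \<in> carrier R; x \<in> carrier M \<rbrakk> \<Longrightarrow>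
        (a \<otimes>\<^bsub>R\<^esub> b) \<odot>\<^bsub>M\<^esub> x = a \<odot>\<^bsub>M\<^esub> (b \<odot>\<^bsub>M\<^esub> x)"
    and lsmult_one:
      "x \<in> carrier M \<Longrightarrow> \<one>\<^bsub>R\<^esub> \<odot>\<^bsub>M\<^esub> x = x"

definition left_module_hom ::
    "('a, 'r) ring_scheme \<Rightarrow> ('a, 'm, 's) module_scheme \<Rightarrow> ('a, 'k, 't) module_scheme \<Rightarrow> ('m \<Rightarrow> 'k) set"
  where "left_module_hom R M N =
    {f \<in> carrier M \<rightarrow> carrier N.
       (\<forall>x\<in>carrier M. \<forall>y\<in>carrier M. f (x \<oplus>\<^bsub>M\<^esub> y) = f x \<oplus>\<^bsub>N\<^esub> f y) \<and>
       (\<forall>a\<in>carrier R. \<forall>x\<in>carrier M. f (a \<odot>\<^bsub>M\<^esub> x) = a \<odot>\<^bsub>N\<^esub> f x)}"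

definition left_module_embedding ::
    "('a, 'r) ring_scheme \<Rightarrow> ('a, 'm, 's) module_scheme \<Rightarrow> ('a, 'k, 't) module_scheme \<Rightarrow> ('m \<Rightarrow> 'k) \<Rightarrow> bool"
  where "left_module_embedding R M N f \<longleftrightarrow>
    left_module R M \<and> left_module R N \<and> f \<in> left_module_hom R M N \<and> inj_on f (carrier M)"

definition restrict_scalars :: "('b \<Rightarrow> 'a) \<Rightarrow> ('a, 'm) module \<Rightarrow> ('b, 'm) module"
  where "restrict_scalars f M =
    \<lparr> carrier = carrier M, monoid.mult = monoid.mult M, one = one M, zero = zero M, add = add M,
      module.smult = (\<lambda>b x. f b \<odot>\<^bsub>M\<^esub> x) \<rparr>"


section \<open>Laurent polynomials\<close>

text \<open>\<open>\<int>[q\<^sup>\<plusminus>\<^sup>1]\<close> is the group ring of \<open>(\<int>, +)\<close>: finitely supported functions from exponents to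
  coefficients, with the convolution product.\<close>

type_synonym laurent = "int \<Rightarrow>\<^sub>0 int"

definition qv :: laurent where "qv = Poly_Mapping.single 1 1"

definition qv_inv :: laurent where "qv_inv = Poly_Mapping.single (- 1) 1"

definition laurent_bar :: "laurent \<Rightarrow> laurent"
  where "laurent_bar a = Poly_Mapping.map_key uminus a"

abbreviation laurent_ring :: "laurent ring"
  where "laurent_ring \<equiv> ring_of_type_algebra"


section \<open>The symmetric group as a Coxeter group\<close>

text \<open>\<open>S\<^sub>n\<close> consists of the \<^term>\<open>w :: nat \<Rightarrow> nat\<close> with \<^term>\<open>w permutes {1..n}\<close>, so that
  \<open>S\<^sub>m \<subseteq> S\<^sub>n\<close> for \<open>m \<le> n\<close>; the product is composition of functions.\<close>

definition sym :: "nat \<Rightarrow> (nat \<Rightarrow> nat) set"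
  where "sym n = {w. w permutes {1..n}}"

definition simple_refl :: "nat \<Rightarrow> nat \<Rightarrow> nat"
  where "simple_refl i = transpose i (i + 1)"

definition perm_of_word :: "nat list \<Rightarrow> nat \<Rightarrow> nat"
  where "perm_of_word js = foldr (\<lambda>j w. simple_refl j \<circ> w) js id"

definition expression_of :: "nat \<Rightarrow> nat list \<Rightarrow> (nat \<Rightarrow> nat) \<Rightarrow> bool"
  where "expression_of n js w \<longleftrightarrow> set js \<subseteq> {1..<n} \<and> perm_of_word js = w"

definition len :: "nat \<Rightarrow> (nat \<Rightarrow> nat) \<Rightarrow> nat"
  where "len n w = (LEAST k. \<exists>js. expression_of n js w \<and> length js = k)"

definition reduced_expression_of :: "nat \<Rightarrow> nat list \<Rightarrow> (nat \<Rightarrow> nat) \<Rightarrow> bool"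
  where "reduced_expression_of n js w \<longleftrightarrow> expression_of n js w \<and> length js = len n w"

text \<open>The Bruhat order is generated by \<open>y < t y\<close> for reflections (i.e. transpositions) \<open>t\<close> with
  \<open>l(y) < l(t y)\<close>.\<close>

definition bruhat_step :: "nat \<Rightarrow> (nat \<Rightarrow> nat) \<Rightarrow> (nat \<Rightarrow> nat) \<Rightarrow> bool"
  where "bruhat_step n y w \<longleftrightarrow> y \<in> sym n \<and>
    (\<exists>i j. 1 \<le> i \<and> i < j \<and> j \<le> n \<and> w = transpose i j \<circ> y) \<and> len n y < len n w"

definition bruhat_le :: "nat \<Rightarrow> (nat \<Rightarrow> nat) \<Rightarrow> (nat \<Rightarrow> nat) \<Rightarrow> bool"
  where "bruhat_le n y w \<longleftrightarrow> y \<in> sym n \<and> w \<in> sym n \<and> (bruhat_step n)\<^sup>*\<^sup>* y w"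

definition bruhat_less :: "nat \<Rightarrow> (nat \<Rightarrow> nat) \<Rightarrow> (nat \<Rightarrow> nat) \<Rightarrow> bool"
  where "bruhat_less n y w \<longleftrightarrow> bruhat_le n y w \<and> y \<noteq> w"


section \<open>The Hecke algebra, by generators and relations\<close>

text \<open>The free monoid, written additively because \<^typ>\<open>'k \<Rightarrow>\<^sub>0 'a\<close> carries the convolution product
  for additive monoids \<^typ>\<open>'k\<close>.  Hence \<open>free_alg\<close> below is the free associative
  \<open>\<int>[q\<^sup>\<plusminus>\<^sup>1]\<close>-algebra on \<open>T\<^sub>1, \<dots>, T\<^sub>n\<^sub>-\<^sub>1\<close>.\<close>

datatype 'a free_mon = Mon (letters: "'a list")

instantiation free_mon :: (type) monoid_add
begin

definition zero_free_mon :: "'a free_mon" where "0 = Mon []"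

definition plus_free_mon :: "'a free_mon \<Rightarrow> 'a free_mon \<Rightarrow> 'a free_mon"
  where "u + v = Mon (letters u @ letters v)"

instance
  by standard (simp_all add: zero_free_mon_def plus_free_mon_def)

end

type_synonym free_elt = "nat free_mon \<Rightarrow>\<^sub>0 laurent"

definition free_alg :: "nat \<Rightarrow> free_elt ring"
  where "free_alg n = ring_of_type_algebra
    \<lparr>carrier := {f. \<forall>u\<in>Poly_Mapping.keys f. set (letters u) \<subseteq> {1..<n}}\<rparr>"

definition free_gen :: "nat \<Rightarrow> free_elt"
  where "free_gen i = Poly_Mapping.single (Mon [i]) 1"

definition free_scalar :: "laurent \<Rightarrow> free_elt"
  where "free_scalar a = Poly_Mapping.single 0 a"

definition hecke_relators :: "nat \<Rightarrow> free_elt set"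
  where "hecke_relators n =
    {free_gen i * free_gen (i + 1) * free_gen i - free_gen (i + 1) * free_gen i * free_gen (i + 1)
       | i. i \<in> {1..<n} \<and> i + 1 \<in> {1..<n}} \<union>
    {free_gen i * free_gen j - free_gen j * free_gen i
       | i j. i \<in> {1..<n} \<and> j \<in> {1..<n} \<and> \<bar>int i - int j\<bar> > 1} \<union>
    {free_gen i * free_gen i - (1 + free_scalar (qv - qv_inv) * free_gen i)
       | i. i \<in> {1..<n}}"

definition hecke_ideal :: "nat \<Rightarrow> free_elt set"
  where "hecke_ideal n = Idl\<^bsub>free_alg n\<^esub> (hecke_relators n)"

text \<open>Elements of the Hecke algebra are cosets in the free algebra.\<close>

type_synonym hecke_elt = "free_elt set"

definition hecke :: "nat \<Rightarrow> hecke_elt ring"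
  where "hecke n = free_alg n Quot hecke_ideal n"

definition hecke_class :: "nat \<Rightarrow> free_elt \<Rightarrow> hecke_elt"
  where "hecke_class n f = hecke_ideal n +>\<^bsub>free_alg n\<^esub> f"

definition hecke_gen :: "nat \<Rightarrow> nat \<Rightarrow> hecke_elt"
  where "hecke_gen n i = hecke_class n (free_gen i)"

definition hecke_scalar :: "nat \<Rightarrow> laurent \<Rightarrow> hecke_elt"
  where "hecke_scalar n a = hecke_class n (free_scalar a)"

text \<open>For \<open>m \<le> n\<close>, the algebra homomorphism \<open>H(q,m) \<rightarrow> H(q,n)\<close> with \<open>T\<^sub>i \<mapsto> T\<^sub>i\<close>, by which \<open>H(q,m)\<close> is
  viewed as a subalgebra: the class of \<open>f\<close> in \<open>H(q,m)\<close> goes to the class of \<open>f\<close> in \<open>H(q,n)\<close>.\<close>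

definition hecke_incl :: "nat \<Rightarrow> hecke_elt \<Rightarrow> hecke_elt"
  where "hecke_incl n h = the_elem (hecke_class n ` h)"

definition hecke_word :: "nat \<Rightarrow> nat list \<Rightarrow> hecke_elt"
  where "hecke_word n js = foldr (\<lambda>j h. hecke_gen n j \<otimes>\<^bsub>hecke n\<^esub> h) js \<one>\<^bsub>hecke n\<^esub>"

definition hecke_T :: "nat \<Rightarrow> (nat \<Rightarrow> nat) \<Rightarrow> hecke_elt"
  where "hecke_T n w = (THE t. \<exists>js. reduced_expression_of n js w \<and> t = hecke_word n js)"

definition lin_comb :: "nat \<Rightarrow> ('i \<Rightarrow> hecke_elt) \<Rightarrow> ('i \<Rightarrow> laurent) \<Rightarrow> 'i set \<Rightarrow> hecke_elt"
  where "lin_comb n b a Y = (\<Oplus>\<^bsub>hecke n\<^esub>y\<in>Y. hecke_scalar n (a y) \<otimes>\<^bsub>hecke n\<^esub> b y)"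

definition hecke_bar :: "nat \<Rightarrow> hecke_elt \<Rightarrow> hecke_elt"
  where "hecke_bar n h = (THE h'. \<exists>a.
    h = lin_comb n (hecke_T n) a (sym n) \<and>
    h' = lin_comb n (\<lambda>w. inv\<^bsub>hecke n\<^esub> (hecke_T n (inv_into UNIV w))) (\<lambda>w. laurent_bar (a w)) (sym n))"


section \<open>The Kazhdan-Lusztig basis and cells\<close>

text \<open>\<open>is_kl n w P C\<close>: \<open>C\<close> has the two properties characterising \<open>C\<^sub>w\<close>, with \<open>P y\<close> in the role of
  \<open>P\<^sub>y\<^sub>,\<^sub>w\<close>.\<close>

definition is_kl :: "nat \<Rightarrow> (nat \<Rightarrow> nat) \<Rightarrow> ((nat \<Rightarrow> nat) \<Rightarrow> int poly) \<Rightarrow> hecke_elt \<Rightarrow> bool"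
  where "is_kl n w P C \<longleftrightarrow>
    hecke_bar n C = C \<and>
    C = lin_comb n (hecke_T n)
          (\<lambda>y. (- qv) ^ (len n w - len n y) * laurent_bar (poly (map_poly of_int (P y)) (qv ^ 2)))
          {y. bruhat_le n y w} \<and>
    P w = 1 \<and>
    (\<forall>y. bruhat_less n y w \<longrightarrow> 2 * Polynomial.degree (P y) + 1 \<le> len n w - len n y)"

definition kl_basis :: "nat \<Rightarrow> (nat \<Rightarrow> nat) \<Rightarrow> hecke_elt"
  where "kl_basis n w = (THE C. \<exists>P. is_kl n w P C)"

text \<open>Meaningful only if \<open>y \<le> w\<close> in the Bruhat order.\<close>

definition kl_poly :: "nat \<Rightarrow> (nat \<Rightarrow> nat) \<Rightarrow> (nat \<Rightarrow> nat) \<Rightarrow> int poly"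
  where "kl_poly n y w = (THE p. \<exists>P. is_kl n w P (kl_basis n w) \<and> p = P y)"

text \<open>The zero polynomial is excluded because its \<^const>\<open>Polynomial.degree\<close> is \<open>0\<close> by convention.\<close>

definition kl_prec :: "nat \<Rightarrow> (nat \<Rightarrow> nat) \<Rightarrow> (nat \<Rightarrow> nat) \<Rightarrow> bool"
  where "kl_prec n y w \<longleftrightarrow> bruhat_less n y w \<and> odd (len n w - len n y) \<and> kl_poly n y w \<noteq> 0 \<and>
    2 * Polynomial.degree (kl_poly n y w) + 1 = len n w - len n y"

definition kl_edge :: "nat \<Rightarrow> (nat \<Rightarrow> nat) \<Rightarrow> (nat \<Rightarrow> nat) \<Rightarrow> bool"
  where "kl_edge n x y \<longleftrightarrow> kl_prec n x y \<or> kl_prec n y x"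

definition descents :: "nat \<Rightarrow> (nat \<Rightarrow> nat) \<Rightarrow> nat set"
  where "descents n w = {i \<in> {1..<n}. bruhat_less n (simple_refl i \<circ> w) w}"

definition kl_le :: "nat \<Rightarrow> (nat \<Rightarrow> nat) \<Rightarrow> (nat \<Rightarrow> nat) \<Rightarrow> bool"
  where "kl_le n x x' \<longleftrightarrow> x \<in> sym n \<and> x' \<in> sym n \<and>
    (\<lambda>y z. kl_edge n y z \<and> \<not> descents n y \<subseteq> descents n z)\<^sup>*\<^sup>* x x'"

definition cell :: "nat \<Rightarrow> (nat \<Rightarrow> nat) \<Rightarrow> (nat \<Rightarrow> nat) set"
  where "cell n w = {x. kl_le n x w \<and> kl_le n w x}"

definition kl_span :: "nat \<Rightarrow> (nat \<Rightarrow> nat) set \<Rightarrow> hecke_elt set"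
  where "kl_span n Y = {lin_comb n (kl_basis n) a Y | a. True}"

definition cell_D :: "nat \<Rightarrow> (nat \<Rightarrow> nat) \<Rightarrow> hecke_elt set"
  where "cell_D n w = kl_span n {y. kl_le n y w}"

definition cell_D' :: "nat \<Rightarrow> (nat \<Rightarrow> nat) \<Rightarrow> hecke_elt set"
  where "cell_D' n w = kl_span n {y. kl_le n y w \<and> y \<notin> cell n w}"

text \<open>The quotient \<open>D\<^sub>w/D'\<^sub>w\<close> with its additive cosets; scalar multiplication is the multiplication of
  representatives, written as a union over representatives as in \<^const>\<open>rcoset_mult\<close>.\<close>

definition cell_module :: "nat \<Rightarrow> (nat \<Rightarrow> nat) \<Rightarrow> (hecke_elt, hecke_elt set) module"
  where "cell_module n w =
    \<lparr> carrier = (\<lambda>x. cell_D' n w +>\<^bsub>hecke n\<^esub> x) ` cell_D n w,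
      monoid.mult = undefined,
      one = undefined,
      zero = cell_D' n w,
      add = set_add (hecke n),
      module.smult = (\<lambda>h A. \<Union>x\<in>A. cell_D' n w +>\<^bsub>hecke n\<^esub> (h \<otimes>\<^bsub>hecke n\<^esub> x)) \<rparr>"

text \<open>The image of \<open>C\<^sub>x\<close> in \<open>D\<^sub>w/D'\<^sub>w\<close>.\<close>

definition cell_basis :: "nat \<Rightarrow> (nat \<Rightarrow> nat) \<Rightarrow> (nat \<Rightarrow> nat) \<Rightarrow> hecke_elt set"
  where "cell_basis n w x = cell_D' n w +>\<^bsub>hecke n\<^esub> kl_basis n x"

text \<open>\<open>odd_product a b\<close> is \<open>s\<^sub>2\<^sub>a\<^sub>+\<^sub>1 s\<^sub>2\<^sub>a\<^sub>+\<^sub>3 \<cdots> s\<^sub>2\<^sub>b\<^sub>+\<^sub>1\<close>, which is the empty product for \<open>a = b + 1\<close>.\<close>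

definition odd_product :: "nat \<Rightarrow> nat \<Rightarrow> nat \<Rightarrow> nat"
  where "odd_product a b = perm_of_word (map (\<lambda>k. 2 * k + 1) [a..<b + 1])"

end

theory Submission
  imports Defs "HOL-Library.Function_Algebras"
begin

text \<open>
  Write \<open>u = s\<^sub>7 s\<^sub>9 \<cdots> s\<^sub>2\<^sub>g\<^sub>+\<^sub>1\<close>.  For \<open>w \<in> S\<^sub>6\<close> none of the \<open>s\<^sub>k\<close>, \<open>k = 7, 9, \<dots>\<close>, is a descent of an element in
  the support of \<open>C\<^sub>w\<close>, so the recursion for the Kazhdan--Lusztig basis gives
  \<open>C\<^sub>w\<^sub>u = (\<Prod>\<^sub>k (T\<^sub>k - q)) C\<^sub>w\<close>, and left multiplication by \<open>\<Prod>\<^sub>k (T\<^sub>k - q)\<close> commutes with \<open>H(q,6)\<close>.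
  Comparing coefficients, \<open>w \<mapsto> w u\<close> preserves \<open>\<mu>\<close> and hence the preorder of \<open>\<Gamma>\<close>.  The point is that it also
  reflects this preorder, so that exactly the elements of \<open>D'\<close> are mapped to \<open>D'\<close>.

  This is Geck's theorem on induced cells.  If \<open>C\<^sub>v\<close>, \<open>v \<in> Y\<close>, span a left ideal of \<open>H(q,m)\<close>, then the left ideal
  of \<open>H(q,n)\<close> that they generate is spanned by the \<open>T\<^sub>x C\<^sub>v\<close>, where \<open>x\<close> runs through the minimal left coset
  representatives of \<open>S\<^sub>m\<close>.  By the Kazhdan--Lusztig algorithm relative to \<open>S\<^sub>m\<close> it contains bar-invariant elements
  congruent to \<open>T\<^sub>x C\<^sub>v\<close>, hence to \<open>T\<^sub>x\<^sub>v\<close>, modulo \<open>q\<close>; by uniqueness these are the \<open>C\<^sub>x\<^sub>v\<close>, so the ideal is spanned by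
  Kazhdan--Lusztig basis elements.  Therefore \<open>w \<le> x v\<close> in \<open>S\<^sub>n\<close> forces \<open>w = x' v'\<close> with \<open>v' \<le> v\<close> in \<open>S\<^sub>m\<close>.

  All computations are carried out in the regular representation of \<open>H(q,n)\<close> on functions \<open>S\<^sub>n \<rightarrow> \<int>[q\<^sup>\<plusminus>\<^sup>1]\<close>,
  which is faithful: reduced words of the same permutation give the same \<open>T\<^sub>w\<close> (Matsumoto), so the \<open>T\<^sub>w\<close> span
  \<open>H(q,n)\<close>, and applied to \<open>T\<^sub>e\<close> they are linearly independent.
\<close>

text \<open>Comparing coefficients only carries chains from \<open>S_m\<close> over to
  \<open>S_n\<close>. A chain in \<open>S_n\<close> that joins \<open>u w\<close> to
  \<open>u z\<close> may pass through permutations outside \<open>u S_m\<close>, and its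
  intermediate terms have no counterpart in \<open>S_m\<close>. This is why reflecting the preorder
  needs a closed set of products \<open>x v\<close>, and why it ends with the uniqueness of the
  decomposition \<open>u w = x v\<close> for \<open>x\<close> increasing on the block
  \<open>{1..m}\<close>.

  The normalisation of \<open>C_w\<close> puts every coefficient except that of \<open>T_w\<close>
  into \<open>q Z[q]\<close>. A bar-invariant element with all coefficients there is zero, so one
  uniqueness principle serves both the recursion for \<open>C_w\<close> and the algorithm relative
  to \<open>S_m\<close>. Correction terms have integer coefficients because \<open>T_i - q\<close>
  lowers the order in \<open>q\<close> by at most one, so that only constant terms have to be
  removed. The edge weight is the coefficient of \<open>q\<close> in \<open>C_w\<close> at
  \<open>y\<close>, which is minus the highest coefficient allowed in \<open>P_{y,w}\<close>.

  Permutations act on all natural numbers, so that lengths, coefficients and \<open>C_w\<close> of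
  \<open>S_m\<close> reappear unchanged in \<open>S_n\<close>.\<close>

abbreviation pinv :: "('a \<Rightarrow> 'b) \<Rightarrow> 'b \<Rightarrow> 'a"
  where "pinv \<equiv> inv_into UNIV"

section \<open>Laurent polynomials\<close>

lemma laurent_of_int: "(of_int c :: laurent) = Poly_Mapping.single 0 c"
  by (metis single_of_int of_int_eq_id id_apply)

abbreviation lk :: "laurent \<Rightarrow> int \<Rightarrow> int"
  where "lk \<equiv> Poly_Mapping.lookup"

lemma lk_single_mult: "lk (Poly_Mapping.single i c * a) k = c * lk a (k - i)"
proof -
  have "Poly_Mapping.keys a \<subseteq> UNIV" by simp
  then show ?thesis
  \<comment> \<open>Integer coefficients make the Laurent polynomials the free abelian group on the
    exponents, so additivity reduces the claim to a single power of \<open>q\<close>.\<close>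
  proof (induction a arbitrary: k rule: frag_induction)
    case zero
    show ?case by simp
  next
    case (one x)
    show ?case by (auto simp: mult_single lookup_single when_def)
  next
    case (diff a b)
    then show ?case by (simp add: right_diff_distrib lookup_minus)
  qed
qed

lemma lk_qv_mult [simp]: "lk (qv * a) k = lk a (k - 1)"
  by (simp add: qv_def lk_single_mult)

lemma lk_qv_inv_mult [simp]: "lk (qv_inv * a) k = lk a (k + 1)"
  by (simp add: qv_inv_def lk_single_mult)

lemma lk_of_int_mult [simp]: "lk (of_int c * a) k = c * lk a k"
  using lk_single_mult[of 0 c a k] by (simp add: laurent_of_int)

lemma qv_mult_qv_inv [simp]: "qv * qv_inv = 1" "qv_inv * qv = 1"
  by (simp_all add: qv_def qv_inv_def mult_single)

lemma inj_uminus_int: "inj (uminus :: int \<Rightarrow> int)"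
  by (simp add: inj_def)

lemma lk_bar [simp]: "lk (laurent_bar a) k = lk a (- k)"
  by (simp add: laurent_bar_def map_key.rep_eq[OF inj_uminus_int])

lemma bar_add [simp]: "laurent_bar (a + b) = laurent_bar a + laurent_bar b"
  and bar_diff [simp]: "laurent_bar (a - b) = laurent_bar a - laurent_bar b"
  and bar_minus [simp]: "laurent_bar (- a) = - laurent_bar a"
  and bar_zero [simp]: "laurent_bar 0 = 0"
  by (auto intro!: poly_mapping_eqI simp: lookup_add lookup_minus)

lemma bar_single: "laurent_bar (Poly_Mapping.single i c) = Poly_Mapping.single (- i) c"
  by (auto intro!: poly_mapping_eqI simp: lookup_single when_def)

lemma bar_qv [simp]: "laurent_bar qv = qv_inv" "laurent_bar qv_inv = qv"
  by (simp_all add: qv_def qv_inv_def bar_single)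

lemma bar_of_int [simp]: "laurent_bar (of_int c) = of_int c"
  using bar_single[of 0 c] by (simp add: laurent_of_int)

lemma bar_one [simp]: "laurent_bar 1 = 1"
  using bar_of_int[of 1] by simp

lemma bar_mult [simp]: "laurent_bar (a * b) = laurent_bar a * laurent_bar b"
proof -
  have "Poly_Mapping.keys a \<subseteq> UNIV" by simp
  then show ?thesis
  proof (induction a rule: frag_induction)
    case zero
    show ?case by simp
  next
    case (one x)
    show ?case
      by (intro poly_mapping_eqI) (simp add: bar_single lk_single_mult)
  next
    case (diff a b)
    then show ?case by (simp add: left_diff_distrib)
  qed
qed

section \<open>Order in q: the ideal \<open>q Z[q]\<close> of \<open>Z[q]\<close> and its
  bar-invariant elements\<close>

definition qpos :: "laurent set"
  where "qpos = {a. \<forall>k. lk a k \<noteq> 0 \<longrightarrow> 1 \<le> k}"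

definition qnonneg :: "laurent set"
  where "qnonneg = {a. \<forall>k. lk a k \<noteq> 0 \<longrightarrow> 0 \<le> k}"

lemma qpos_subset_qnonneg: "qpos \<subseteq> qnonneg"
  by (force simp: qpos_def qnonneg_def)

lemma qpos_zero [simp]: "0 \<in> qpos" and qnonneg_zero [simp]: "0 \<in> qnonneg"
  by (auto simp: qpos_def qnonneg_def)

lemma qpos_add: "a \<in> qpos \<Longrightarrow> b \<in> qpos \<Longrightarrow> a + b \<in> qpos"
  and qnonneg_add: "a \<in> qnonneg \<Longrightarrow> b \<in> qnonneg \<Longrightarrow> a + b \<in> qnonneg"
  by (auto simp: qpos_def qnonneg_def lookup_add) (metis add_cancel_right_left)+

lemma qpos_minus [simp]: "- a \<in> qpos \<longleftrightarrow> a \<in> qpos"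
  by (auto simp: qpos_def)

lemma qpos_diff: "a \<in> qpos \<Longrightarrow> b \<in> qpos \<Longrightarrow> a - b \<in> qpos"
  using qpos_add[of a "- b"] by simp

lemma qpos_of_int_mult: "a \<in> qpos \<Longrightarrow> of_int c * a \<in> qpos"
  by (auto simp: qpos_def)

lemma qv_inv_mult_qpos: "a \<in> qpos \<Longrightarrow> qv_inv * a \<in> qnonneg"
  by (force simp: qpos_def qnonneg_def)

lemma one_qnonneg [simp]: "1 \<in> qnonneg"
  by (auto simp: qnonneg_def lookup_one when_def)

lemma qnonneg_const_part:
  assumes "a \<in> qnonneg"
  shows "a - of_int (lk a 0) \<in> qpos"
  unfolding qpos_def
proof (safe)
  fix k assume "lk (a - of_int (lk a 0)) k \<noteq> 0"
  then show "1 \<le> k"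
    using assms by (cases "k = 0") (auto simp: qnonneg_def lookup_minus lookup_of_int when_def)
qed

text \<open>Bar reverses exponents, so an exponent in the support would be positive together with
  its negative.\<close>

lemma bar_invariant_qpos:
  assumes "a \<in> qpos" "laurent_bar a = a"
  shows "a = 0"
proof (rule poly_mapping_eqI)
  fix k
  have "lk a k = lk a (- k)" by (metis assms(2) lk_bar)
  moreover have "lk a k \<noteq> 0 \<longrightarrow> 1 \<le> k" "lk a (- k) \<noteq> 0 \<longrightarrow> 1 \<le> - k"
    using assms(1) unfolding qpos_def by blast+
  ultimately show "lk a k = lk 0 k" by force
qed


section \<open>Permutations\<close>

text \<open>The left descent condition \<open>s\<^sub>i w < w\<close>, read off from the positions of the values \<open>i\<close> and \<open>i + 1\<close>.\<close>

definition desc :: "nat \<Rightarrow> (nat \<Rightarrow> nat) \<Rightarrow> bool"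
  where "desc i w \<longleftrightarrow> pinv w (Suc i) < pinv w i"

lemma simple_refl_apply: "simple_refl i = transpose i (Suc i)"
  by (simp add: simple_refl_def)

lemma simple_refl_values [simp]:
  "simple_refl i i = Suc i" "simple_refl i (Suc i) = i"
  by (simp_all add: simple_refl_def)

lemma simple_refl_invol [simp]: "simple_refl i (simple_refl i k) = k"
  by (simp add: simple_refl_def)

lemma simple_refl_comp_invol [simp]: "simple_refl i \<circ> (simple_refl i \<circ> w) = w"
  by (simp add: fun_eq_iff)

lemma simple_refl_comp_eq_iff: "simple_refl i \<circ> v = w \<longleftrightarrow> v = simple_refl i \<circ> w"
  by auto

lemma bij_simple_refl [simp]: "bij (simple_refl i)"
  by (simp add: simple_refl_def)

lemma inv_simple_refl [simp]: "pinv (simple_refl i) = simple_refl i"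
  by (simp add: simple_refl_def)

lemma inv_simple_refl_comp: "bij w \<Longrightarrow> pinv (simple_refl i \<circ> w) = pinv w \<circ> simple_refl i"
  by (simp add: o_inv_distrib)

lemma sym_bij: "w \<in> sym n \<Longrightarrow> bij w"
  by (auto simp: sym_def permutes_bij)

lemma inv_eq_bij: "bij w \<Longrightarrow> pinv w a = pinv w b \<longleftrightarrow> a = b"
  by (metis bij_inv_eq_iff)

lemma sym_comp: "v \<in> sym n \<Longrightarrow> w \<in> sym n \<Longrightarrow> v \<circ> w \<in> sym n"
  by (simp add: sym_def permutes_compose)

lemma id_sym [simp]: "id \<in> sym n"
  by (simp add: sym_def permutes_id)

lemma finite_sym [simp]: "finite (sym n)"
  by (simp add: sym_def finite_permutations)

lemma sym_mono: "m \<le> n \<Longrightarrow> sym m \<subseteq> sym n"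
  by (auto simp: sym_def intro: permutes_subset)

lemma simple_refl_sym: "i \<in> {1..<n} \<Longrightarrow> simple_refl i \<in> sym n"
  by (auto simp: sym_def simple_refl_def intro: permutes_swap_id)

lemma simple_refl_comp_sym [simp]: "i \<in> {1..<n} \<Longrightarrow> simple_refl i \<circ> w \<in> sym n \<longleftrightarrow> w \<in> sym n"
  by (metis simple_refl_comp_invol simple_refl_sym sym_comp)

lemma desc_simple_refl_comp: "bij w \<Longrightarrow> desc i (simple_refl i \<circ> w) \<longleftrightarrow> \<not> desc i w"
  using inv_eq_bij[of w i "Suc i"] by (auto simp: desc_def inv_simple_refl_comp)

lemma bij_simple_refl_comp [simp]: "bij w \<Longrightarrow> bij (simple_refl i \<circ> w)"
  by (simp add: bij_comp)

section \<open>Length as the number of inversions\<close>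

definition inversions :: "(nat \<Rightarrow> nat) \<Rightarrow> (nat \<times> nat) set"
  where "inversions w = {(a, b). a < b \<and> w b < w a}"

text \<open>Does not mention \<open>n\<close>, unlike \<open>len n\<close>, so lengths in
  \<open>S_m\<close> and in \<open>S_n\<close> are literally the same number;
  \<open>len_eq_ell\<close> identifies the two notions.\<close>

definition ell :: "(nat \<Rightarrow> nat) \<Rightarrow> nat"
  where "ell w = card (inversions w)"

lemma finite_inversions:
  assumes "w \<in> sym n"
  shows "finite (inversions w)"
proof (rule finite_subset)
  have w: "w permutes {1..n}" using assms by (simp add: sym_def)
  show "inversions w \<subseteq> {0..n} \<times> {0..n}"
  proof clarify
    fix a b assume "(a, b) \<in> inversions w"
    then have ab: "a < b" "w b < w a" by (auto simp: inversions_def)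
    have "b \<le> n"
    proof (rule ccontr)
      assume "\<not> b \<le> n"
      then have "w b = b" using w by (simp add: permutes_not_in)
      then have "w a \<notin> {1..n}" using ab \<open>\<not> b \<le> n\<close> by auto
      then have "a \<notin> {1..n}" using permutes_in_image[OF w, of a] by blast
      then have "w a = a" using w by (simp add: permutes_not_in)
      then show False using ab \<open>w b = b\<close> by simp
    qed
    then show "a \<in> {0..n} \<and> b \<in> {0..n}" using ab by auto
  qed
qed simp

lemma simple_refl_less_iff:
  assumes "x \<noteq> y"
  shows "simple_refl i y < simple_refl i x \<longleftrightarrow>
    (y < x \<and> \<not> (x = Suc i \<and> y = i)) \<or> (x = i \<and> y = Suc i)"
  using assms by (auto simp: simple_refl_def transpose_def split: if_splits)

text \<open>Left multiplication exchanges the values \<open>i\<close> and \<open>i + 1\<close> and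
  keeps the relative order of every other pair of values, so only the pair of positions of these two
  values changes its status.\<close>

lemma inversions_simple_refl_comp:
  assumes "bij w" "\<not> desc i w"
  shows "inversions (simple_refl i \<circ> w) = insert (pinv w i, pinv w (Suc i)) (inversions w)"
    and "(pinv w i, pinv w (Suc i)) \<notin> inversions w"
proof -
  have lt: "pinv w i < pinv w (Suc i)"
    using assms inv_eq_bij[of w i "Suc i"] by (auto simp: desc_def)
  have w: "w x = y \<longleftrightarrow> x = pinv w y" for x y
    using assms(1) by (metis bij_inv_eq_iff)
  show "(pinv w i, pinv w (Suc i)) \<notin> inversions w"
    using w[of "pinv w i" i] w[of "pinv w (Suc i)" "Suc i"] by (simp add: inversions_def)
  have *: "a < b \<and> simple_refl i (w b) < simple_refl i (w a) \<longleftrightarrow>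
      (a = pinv w i \<and> b = pinv w (Suc i)) \<or> (a < b \<and> w b < w a)" for a b
  proof (cases "a < b")
    case True
    then have ne: "w a \<noteq> w b" using w by (metis less_irrefl)
    have "\<not> (w a = Suc i \<and> w b = i)" using True lt by (auto simp: w)
    then show ?thesis
      using True unfolding simple_refl_less_iff[OF ne] by (auto simp: w)
  qed (use lt in auto)
  show "inversions (simple_refl i \<circ> w) = insert (pinv w i, pinv w (Suc i)) (inversions w)"
    using * by (auto simp: inversions_def)
qed

lemma ell_asc:
  assumes "w \<in> sym n" "\<not> desc i w"
  shows "ell (simple_refl i \<circ> w) = Suc (ell w)"
  using inversions_simple_refl_comp[OF sym_bij[OF assms(1)] assms(2)] finite_inversions[OF assms(1)]
  by (simp add: ell_def)

lemma ell_desc: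
  assumes "w \<in> sym n" "i \<in> {1..<n}" "desc i w"
  shows "ell w = Suc (ell (simple_refl i \<circ> w))"
proof -
  have "ell (simple_refl i \<circ> (simple_refl i \<circ> w)) = Suc (ell (simple_refl i \<circ> w))"
    by (rule ell_asc[of _ n]) (use assms desc_simple_refl_comp[OF sym_bij[OF assms(1)]] in auto)
  then show ?thesis by simp
qed

lemma ell_id [simp]: "ell id = 0"
proof -
  have "inversions id = {}" by (auto simp: inversions_def)
  then show ?thesis by (simp add: ell_def)
qed

text \<open>Induction upwards from \<open>1\<close> gives \<open>k <= w k\<close>, induction
  downwards from \<open>n\<close> gives \<open>w k <= k\<close>.\<close>

lemma increasing_perm_id:
  assumes "w permutes {1..n}" "\<And>i. i \<in> {1..<n} \<Longrightarrow> w i < w (Suc i)"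
  shows "w = id"
proof -
  have ge: "k \<le> w k" if "k \<in> {1..n}" for k
    using that
  proof (induction k)
    case (Suc k)
    show ?case
    proof (cases "k = 0")
      case True
      then show ?thesis using Suc.prems permutes_in_image[OF assms(1), of 1] by auto
    next
      case False
      then have "k \<le> w k" "w k < w (Suc k)" using Suc assms(2)[of k] by auto
      then show ?thesis by simp
    qed
  qed simp
  have le: "w (n - j) \<le> n - j" if "j < n" for j
    using that
  proof (induction j)
    case 0
    then show ?case using permutes_in_image[OF assms(1), of n] by auto
  next
    case (Suc j)
    then have "w (n - j) \<le> n - j" "w (n - Suc j) < w (Suc (n - Suc j))"
      using assms(2)[of "n - Suc j"] by auto
    moreover have "Suc (n - Suc j) = n - j" using Suc.prems by simp
    ultimately show ?case by simp
  qed
  show ?thesis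
  proof
    fix k show "w k = id k"
    proof (cases "k \<in> {1..n}")
      case True
      then show ?thesis using ge[of k] le[of "n - k"] by auto
    next
      case False
      then show ?thesis using assms(1) by (simp add: permutes_not_in)
    qed
  qed
qed

text \<open>Without descents the inverse of \<open>w\<close> is increasing on \<open>{1..n}\<close>,
  hence the identity.\<close>

lemma exists_desc:
  assumes "w \<in> sym n" "w \<noteq> id"
  shows "\<exists>i\<in>{1..<n}. desc i w"
proof (rule ccontr)
  assume *: "\<not> ?thesis"
  have "pinv w permutes {1..n}" using assms(1) by (simp add: sym_def permutes_inv)
  moreover have "pinv w i < pinv w (Suc i)" if "i \<in> {1..<n}" for i
    using * that inv_eq_bij[OF sym_bij[OF assms(1)], of i "Suc i"] by (force simp: desc_def)
  ultimately have "pinv w = id" by (rule increasing_perm_id)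
  then have "w = id" using sym_bij[OF assms(1)] by (metis inv_inv_eq inv_id)
  then show False using assms(2) by simp
qed


subsection \<open>Reduced words\<close>

lemma perm_of_word_simps [simp]:
  "perm_of_word [] = id" "perm_of_word (j # js) = simple_refl j \<circ> perm_of_word js"
  by (simp_all add: perm_of_word_def)

lemma perm_of_word_append: "perm_of_word (js @ ks) = perm_of_word js \<circ> perm_of_word ks"
  by (induction js) (auto simp: comp_assoc)

lemma bij_perm_of_word: "bij (perm_of_word js)"
proof (induction js)
  case Nil
  show ?case unfolding perm_of_word_simps by (rule bij_id)
next
  case (Cons j js)
  then show ?case unfolding perm_of_word_simps by (rule bij_simple_refl_comp)
qed

lemma perm_of_word_rev: "perm_of_word (rev js) = pinv (perm_of_word js)"
proof (induction js)
  case Nil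
  show ?case unfolding rev.simps perm_of_word_simps by simp
next
  case (Cons j js)
  then show ?case
    unfolding rev.simps perm_of_word_append perm_of_word_simps inv_simple_refl_comp[OF bij_perm_of_word]
    by simp
qed

lemma perm_of_word_sym: "set js \<subseteq> {1..<n} \<Longrightarrow> perm_of_word js \<in> sym n"
  by (induction js) auto

lemma ell_simple_refl_le:
  assumes "w \<in> sym n" "i \<in> {1..<n}"
  shows "ell (simple_refl i \<circ> w) \<le> Suc (ell w)"
proof (cases "desc i w")
  case True
  then show ?thesis using ell_desc[OF assms] by simp
next
  case False
  then show ?thesis using ell_asc[OF assms(1)] by simp
qed

lemma ell_perm_of_word_le: "set js \<subseteq> {1..<n} \<Longrightarrow> ell (perm_of_word js) \<le> length js"
proof (induction js)
  case (Cons j js)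
  then have "ell (perm_of_word (j # js)) \<le> Suc (ell (perm_of_word js))"
    unfolding perm_of_word_simps by (intro ell_simple_refl_le perm_of_word_sym) auto
  moreover have "ell (perm_of_word js) \<le> length js" using Cons by auto
  ultimately show ?case unfolding list.size(4) by linarith
qed simp

lemma exists_word:
  "w \<in> sym n \<Longrightarrow> \<exists>js. expression_of n js w \<and> length js = ell w"
proof (induction "ell w" arbitrary: w rule: less_induct)
  case less
  show ?case
  proof (cases "w = id")
    case True
    then show ?thesis by (intro exI[of _ "[]"]) (simp add: expression_of_def)
  next
    case False
    then obtain i where i: "i \<in> {1..<n}" "desc i w" using exists_desc less.prems by blast
    have l: "ell w = Suc (ell (simple_refl i \<circ> w))" using ell_desc less.prems i by blast
    then obtain js where "expression_of n js (simple_refl i \<circ> w)" "length js = ell (simple_refl i \<circ> w)"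
      using less.hyps[of "simple_refl i \<circ> w"] less.prems i by auto
    then have "expression_of n (i # js) w \<and> length (i # js) = ell w"
      using i l by (auto simp: expression_of_def)
    then show ?thesis by blast
  qed
qed

text \<open>Removing one descent after another yields a word with \<open>ell w\<close> letters, and
  no word is shorter because a letter adds at most one inversion.\<close>

lemma len_eq_ell: "w \<in> sym n \<Longrightarrow> len n w = ell w"
  unfolding len_def using exists_word[of w n] ell_perm_of_word_le
  by (intro Least_equality) (auto simp: expression_of_def, metis One_nat_def)

definition reduced :: "nat list \<Rightarrow> bool"
  where "reduced js \<longleftrightarrow> ell (perm_of_word js) = length js"

lemma reduced_Nil [simp]: "reduced []"
  by (simp add: reduced_def)

lemma reduced_Cons:
  assumes "set (j # js) \<subseteq> {1..<n}"
  shows "reduced (j # js) \<longleftrightarrow> reduced js \<and> \<not> desc j (perm_of_word js)"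
proof -
  have s: "perm_of_word js \<in> sym n" using assms by (simp add: perm_of_word_sym)
  show ?thesis
    using ell_asc[OF s, of j] ell_desc[OF s, of j] ell_perm_of_word_le[of js n] assms
    by (cases "desc j (perm_of_word js)") (auto simp: reduced_def)
qed

lemma reduced_expression_iff:
  "reduced_expression_of n js w \<longleftrightarrow> expression_of n js w \<and> reduced js"
  by (auto simp: reduced_expression_of_def expression_of_def reduced_def len_eq_ell perm_of_word_sym)

lemma exists_reduced: "w \<in> sym n \<Longrightarrow> \<exists>js. expression_of n js w \<and> reduced js"
  using exists_word by (fastforce simp: expression_of_def reduced_def)

text \<open>Inversions of \<open>w\<close> and of its inverse correspond by \<open>(a, b)\<close> to
  \<open>(w b, w a)\<close>. Needed because the bar involution is defined through \<open>T\<close>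
  at the inverse permutation.\<close>

lemma reduced_rev:
  assumes "set js \<subseteq> {1..<n}" "reduced js"
  shows "reduced (rev js)"
proof -
  let ?w = "perm_of_word js"
  have w: "?w \<in> sym n" using assms(1) by (rule perm_of_word_sym)
  have "bij_betw (\<lambda>(a, b). (?w b, ?w a)) (inversions ?w) (inversions (pinv ?w))"
  proof (rule bij_betw_byWitness[where f' = "\<lambda>(a, b). (pinv ?w b, pinv ?w a)"])
    have wi: "pinv ?w (?w x) = x" "?w (pinv ?w x) = x" for x
      using sym_bij[OF w] by (simp_all add: bij_is_inj bij_is_surj inv_f_f surj_f_inv_f)
    show "\<forall>p\<in>inversions ?w. (case case p of (a, b) \<Rightarrow> (?w b, ?w a) of (a, b) \<Rightarrow> (pinv ?w b, pinv ?w a)) = p"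
      "\<forall>p\<in>inversions (pinv ?w). (case case p of (a, b) \<Rightarrow> (pinv ?w b, pinv ?w a) of (a, b) \<Rightarrow> (?w b, ?w a)) = p"
      "(\<lambda>(a, b). (?w b, ?w a)) ` inversions ?w \<subseteq> inversions (pinv ?w)"
      "(\<lambda>(a, b). (pinv ?w b, pinv ?w a)) ` inversions (pinv ?w) \<subseteq> inversions ?w"
      by (auto simp: wi inversions_def)
  qed
  then show ?thesis
    using assms(2) by (simp add: reduced_def perm_of_word_rev ell_def bij_betw_same_card)
qed

lemma bij_inv_simple_refl_comp_apply:
  "bij w \<Longrightarrow> pinv (simple_refl i \<circ> w) k = pinv w (simple_refl i k)"
  by (simp add: inv_simple_refl_comp)

lemma descents_comm:
  assumes "bij w" "1 < \<bar>int i - int j\<bar>"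
  shows "desc j (simple_refl i \<circ> w) \<longleftrightarrow> desc j w"
proof -
  have "simple_refl i (Suc j) = Suc j" "simple_refl i j = j"
    using assms(2) by (auto simp: simple_refl_def transpose_def)
  then show ?thesis using assms(1) by (simp add: desc_def bij_inv_simple_refl_comp_apply)
qed

lemma simple_refl_comm:
  assumes "1 < \<bar>int i - int j\<bar>"
  shows "simple_refl i \<circ> (simple_refl j \<circ> w) = simple_refl j \<circ> (simple_refl i \<circ> w)"
  using assms by (auto simp: fun_eq_iff simple_refl_def transpose_def)

lemma simple_refl_braid:
  "simple_refl i \<circ> (simple_refl (Suc i) \<circ> (simple_refl i \<circ> w)) =
   simple_refl (Suc i) \<circ> (simple_refl i \<circ> (simple_refl (Suc i) \<circ> w))"
  by (auto simp: fun_eq_iff simple_refl_def transpose_def)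

lemma simple_refl_Suc [simp]: "simple_refl (Suc i) i = i" "simple_refl i (Suc (Suc i)) = Suc (Suc i)"
  by (simp_all add: simple_refl_def transpose_def)

text \<open>Two left descents \<open>i\<close>, \<open>j\<close> of \<open>w\<close> let one split off the longest element of the parabolic
  subgroup they generate, which has a reduced word starting with either of them.\<close>

theorem matsumoto:
  fixes \<phi> :: "nat \<Rightarrow> 'a \<Rightarrow> 'a"
  assumes closed: "\<And>i x. i \<in> {1..<n} \<Longrightarrow> x \<in> D \<Longrightarrow> \<phi> i x \<in> D"
    and braid: "\<And>i x. i \<in> {1..<n} \<Longrightarrow> Suc i \<in> {1..<n} \<Longrightarrow> x \<in> D \<Longrightarrow>
      \<phi> i (\<phi> (Suc i) (\<phi> i x)) = \<phi> (Suc i) (\<phi> i (\<phi> (Suc i) x))"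
    and comm: "\<And>i j x. i \<in> {1..<n} \<Longrightarrow> j \<in> {1..<n} \<Longrightarrow> 1 < \<bar>int i - int j\<bar> \<Longrightarrow> x \<in> D \<Longrightarrow>
      \<phi> i (\<phi> j x) = \<phi> j (\<phi> i x)"
    and x0: "x0 \<in> D"
    and "set js \<subseteq> {1..<n}" "set ks \<subseteq> {1..<n}" "reduced js" "reduced ks"
    and "perm_of_word js = perm_of_word ks"
  shows "foldr \<phi> js x0 = foldr \<phi> ks x0"
proof -
  \<comment> \<open>Keeps the relations applicable to every partial product, as they are assumed on
    \<open>D\<close> only.\<close>
  have D: "foldr \<phi> vs x0 \<in> D" if "set vs \<subseteq> {1..<n}" for vs
    using that by (induction vs) (auto intro: x0 closed)
  show ?thesis
    using assms(5-)
  proof (induction "length js" arbitrary: js ks rule: less_induct)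
    case less
    have len: "length ks = length js" using less.prems by (simp add: reduced_def)
    show ?case
    proof (cases js)
      case Nil
      then show ?thesis using len by simp
    next
      case js: (Cons i js')
      then obtain j ks' where ks: "ks = j # ks'" using len by (cases ks) auto
      define w where "w = perm_of_word js"
      have w: "w \<in> sym n" "bij w" "w = simple_refl i \<circ> perm_of_word js'" "w = simple_refl j \<circ> perm_of_word ks'"
        using less.prems perm_of_word_sym[of "i # js'" n] bij_perm_of_word[of "i # js'"]
        by (simp_all add: w_def js ks)
      have js': "set js' \<subseteq> {1..<n}" "i \<in> {1..<n}" "reduced js'" "\<not> desc i (perm_of_word js')"
        using less.prems reduced_Cons[of i js' n] by (auto simp: js)
      have wjs: "perm_of_word js' = simple_refl i \<circ> w" unfolding w(3) by simp
      have ks': "set ks' \<subseteq> {1..<n}" "j \<in> {1..<n}" "reduced ks'" "\<not> desc j (perm_of_word ks')"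
        using less.prems reduced_Cons[of j ks' n] by (auto simp: ks)
      have wks: "perm_of_word ks' = simple_refl j \<circ> w" unfolding w(4) by simp
      have desc: "desc i w" "desc j w"
        using js'(4) ks'(4) desc_simple_refl_comp[OF w(2)] by (simp_all add: wjs wks)
      have IHjs: "foldr \<phi> js' x0 = foldr \<phi> vs x0"
        if "set vs \<subseteq> {1..<n}" "reduced vs" "perm_of_word vs = simple_refl i \<circ> w" for vs
        by (rule less.hyps) (use that js' wjs in \<open>auto simp: js\<close>)
      have IHks: "foldr \<phi> ks' x0 = foldr \<phi> vs x0"
        if "set vs \<subseteq> {1..<n}" "reduced vs" "perm_of_word vs = simple_refl j \<circ> w" for vs
        by (rule less.hyps) (use that ks' wks len in \<open>auto simp: js ks\<close>)
      have adjacent: "\<phi> a (\<phi> b (\<phi> a (foldr \<phi> vs x0))) = \<phi> b (\<phi> a (\<phi> b (foldr \<phi> vs x0)))"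
        if "a = Suc b \<or> b = Suc a" "a \<in> {1..<n}" "b \<in> {1..<n}" "set vs \<subseteq> {1..<n}" for a b vs
        using that(1)
      proof
        assume "a = Suc b"
        then show ?thesis using braid[of b, OF _ _ D[OF that(4)]] that(2,3) by simp
      next
        assume "b = Suc a"
        then show ?thesis using braid[of a, OF _ _ D[OF that(4)]] that(2,3) by simp
      qed
      consider "i = j" | "1 < \<bar>int i - int j\<bar>" | "i = Suc j \<or> j = Suc i" by linarith
      then show ?thesis
      proof cases
        case 1
        have "foldr \<phi> js' x0 = foldr \<phi> ks' x0"
          by (rule IHjs) (use 1 ks' wks in simp_all)
        then show ?thesis using 1 by (simp add: js ks)
      next
        case 2
        then have ji: "1 < \<bar>int j - int i\<bar>" by simp
        \<comment> \<open>What remains of \<open>w\<close> after splitting off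
          \<open>s_i s_j\<close>. Then \<open>js'\<close> and \<open>j # vs\<close> are reduced
          words of the same shorter permutation, and so are \<open>ks'\<close> and
          \<open>i # vs\<close>.\<close>
        define v where "v = simple_refl j \<circ> (simple_refl i \<circ> w)"
        have "v \<in> sym n" using w(1) js'(2) ks'(2) by (simp add: v_def)
        then obtain vs where vs: "set vs \<subseteq> {1..<n}" "reduced vs" "perm_of_word vs = v"
          using exists_reduced by (auto simp: expression_of_def)
        have v2: "v = simple_refl i \<circ> (simple_refl j \<circ> w)" unfolding v_def by (rule simple_refl_comm[OF ji])
        have nd: "\<not> desc j v"
          using desc w(2) descents_comm[OF w(2) 2] by (simp add: v_def desc_simple_refl_comp)
        have nd2: "\<not> desc i v"
          using desc w(2) descents_comm[OF w(2) ji] by (simp add: v2 desc_simple_refl_comp)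
        have 1: "foldr \<phi> js' x0 = foldr \<phi> (j # vs) x0"
          by (rule IHjs) (use vs nd ks'(2) reduced_Cons[of j vs n] in \<open>auto simp: v_def\<close>)
        have 2: "foldr \<phi> ks' x0 = foldr \<phi> (i # vs) x0"
          by (rule IHks) (use vs nd2 js'(2) reduced_Cons[of i vs n] in \<open>auto simp: v2\<close>)
        show ?thesis using 1 2 comm[OF js'(2) ks'(2) _ D[OF vs(1)]] \<open>1 < \<bar>int i - int j\<bar>\<close>
          by (simp add: js ks)
      next
        case 3
        \<comment> \<open>What remains of \<open>w\<close> after splitting off the longest element
          \<open>s_i s_j s_i = s_j s_i s_j\<close>; its word \<open>vs\<close> is the common tail on
          which the braid relation is applied at the end.\<close>
        define v where "v = simple_refl i \<circ> (simple_refl j \<circ> (simple_refl i \<circ> w))"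
        have v2: "v = simple_refl j \<circ> (simple_refl i \<circ> (simple_refl j \<circ> w))"
          using 3 simple_refl_braid[of i w] simple_refl_braid[of j w] by (elim disjE) (simp_all add: v_def)
        have "v \<in> sym n" using w(1) js'(2) ks'(2) by (simp add: v_def)
        then obtain vs where vs: "set vs \<subseteq> {1..<n}" "reduced vs" "perm_of_word vs = v"
          using exists_reduced by (auto simp: expression_of_def)
        have nd: "\<not> desc i v" "\<not> desc j v" "\<not> desc j (simple_refl i \<circ> v)" "\<not> desc i (simple_refl j \<circ> v)"
          using desc 3 w(2)
          by (auto simp: v_def desc_def bij_inv_simple_refl_comp_apply)
        have 1: "foldr \<phi> js' x0 = foldr \<phi> (j # i # vs) x0"
          by (rule IHjs)
            (use vs nd ks'(2) js'(2) reduced_Cons[of i vs n] reduced_Cons[of j "i # vs" n] in \<open>auto simp: v_def\<close>)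
        have 2: "foldr \<phi> ks' x0 = foldr \<phi> (i # j # vs) x0"
          by (rule IHks)
            (use vs nd ks'(2) js'(2) reduced_Cons[of j vs n] reduced_Cons[of i "j # vs" n] in \<open>auto simp: v2\<close>)
        show ?thesis using 1 2 adjacent[OF 3 js'(2) ks'(2) vs(1)] by (simp add: js ks)
      qed
    qed
  qed
qed

subsection \<open>The Bruhat order\<close>

text \<open>Induction on \<open>j - i\<close> through the conjugation
  \<open>(i j) = s_i (i+1 j) s_i\<close>. The inner transposition raises the length by induction;
  the two outer factors change it by one each, and they can lower it together only if the first one
  raised it.\<close>

lemma ell_transpose_less:
  assumes "w \<in> sym n" "1 \<le> i" "i < j" "j \<le> n" "pinv w i < pinv w j"
  shows "ell w < ell (transpose i j \<circ> w)"
  using assms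
proof (induction "j - i" arbitrary: i w rule: less_induct)
  case less
  have bij: "bij w" using less.prems sym_bij by blast
  show ?case
  proof (cases "j = Suc i")
    case True
    have "\<not> desc i w" using less.prems True by (simp add: desc_def)
    then show ?thesis using ell_asc less.prems True by (simp add: simple_refl_apply[symmetric])
  next
    case False
    define k where "k = Suc i"
    let ?s = "simple_refl i"
    have k: "i < k" "k < j" using False less.prems by (auto simp: k_def)
    have i: "i \<in> {1..<n}" using less.prems by auto
    define v where "v = transpose k j \<circ> (?s \<circ> w)"
    have sw: "?s \<circ> w \<in> sym n" using less.prems i by simp
    have "transpose k j \<in> sym n" using k less.prems by (auto simp: sym_def intro: permutes_swap_id)
    then have v: "v \<in> sym n" using sw unfolding v_def by (rule sym_comp)
    have "transpose i j y = ?s (transpose k j (?s y))" for y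
    proof -
      consider "y = i" | "y = j" "y \<noteq> i" | "y = k" "y \<noteq> i" "y \<noteq> j" | "y \<noteq> i" "y \<noteq> j" "y \<noteq> k" by blast
      then show ?thesis using k by cases (simp_all add: simple_refl_def transpose_def k_def)
    qed
    then have tw: "transpose i j \<circ> w = ?s \<circ> v"
      by (simp add: v_def fun_eq_iff)
    have inv_v: "pinv v x = pinv w (?s (transpose k j x))" for x
      unfolding v_def using bij by (subst o_inv_distrib) (auto simp: inv_simple_refl_comp)
    have iv: "pinv v i = pinv w k" "pinv v k = pinv w j"
      using k less.prems by (auto simp: inv_v k_def transpose_def simple_refl_def)
    have "?s j = j" using k by (simp add: simple_refl_def k_def)
    then have "pinv (?s \<circ> w) k < pinv (?s \<circ> w) j"
      using less.prems by (simp add: bij_inv_simple_refl_comp_apply[OF bij] k_def)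
    then have IH: "ell (?s \<circ> w) < ell v"
      unfolding v_def using less.hyps[of k "?s \<circ> w"] k less.prems sw by auto
    have ne: "pinv w i \<noteq> pinv w k" "pinv w j \<noteq> pinv w k"
      using inv_eq_bij[OF bij] k by auto
    show ?thesis
    proof (cases "desc i w")
      case True
      then have "\<not> desc i v" using iv ne less.prems by (auto simp: desc_def k_def)
      then have "ell (?s \<circ> v) = Suc (ell v)" using ell_asc v by blast
      then show ?thesis using IH ell_desc[OF less.prems(1) i True] by (simp add: tw)
    next
      case False
      then have "ell (?s \<circ> w) = Suc (ell w)" using ell_asc less.prems by blast
      moreover have "ell v \<le> Suc (ell (?s \<circ> v))"
        using ell_asc[OF v, of i] ell_desc[OF v i] by (cases "desc i v") auto
      ultimately show ?thesis using IH by (simp add: tw)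
    qed
  qed
qed

lemma ell_transpose_less_iff:
  assumes "w \<in> sym n" "1 \<le> i" "i < j" "j \<le> n"
  shows "ell w < ell (transpose i j \<circ> w) \<longleftrightarrow> pinv w i < pinv w j"
proof
  assume less: "ell w < ell (transpose i j \<circ> w)"
  show "pinv w i < pinv w j"
  proof (rule ccontr)
    assume "\<not> pinv w i < pinv w j"
    then have "pinv w j < pinv w i" using inv_eq_bij[OF sym_bij[OF assms(1)]] assms(3)
      by (metis less_irrefl linorder_neqE_nat)
    moreover have t: "transpose i j \<circ> w \<in> sym n"
      by (rule sym_comp[OF _ assms(1)]) (use assms in \<open>auto simp: sym_def intro: permutes_swap_id\<close>)
    moreover have "pinv (transpose i j \<circ> w) = pinv w \<circ> transpose i j"
      using sym_bij[OF assms(1)] by (simp add: o_inv_distrib)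
    ultimately have "ell (transpose i j \<circ> w) < ell (transpose i j \<circ> (transpose i j \<circ> w))"
      by (intro ell_transpose_less[OF t assms(2-4)]) simp
    also have "transpose i j \<circ> (transpose i j \<circ> w) = w" by (simp add: fun_eq_iff)
    finally show False using less less_asym by blast
  qed
qed (use ell_transpose_less assms in blast)

text \<open>Trades the comparison of lengths for a comparison of two positions, which is easy to
  follow under multiplication by a simple reflection.\<close>

lemma bruhat_step_iff:
  "bruhat_step n y w \<longleftrightarrow> y \<in> sym n \<and>
    (\<exists>i j. 1 \<le> i \<and> i < j \<and> j \<le> n \<and> pinv y i < pinv y j \<and> w = transpose i j \<circ> y)"
proof -
  have "len n y < len n (transpose i j \<circ> y) \<longleftrightarrow> pinv y i < pinv y j"
    if "y \<in> sym n" "1 \<le> i" "i < j" "j \<le> n" for i j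
  proof -
    have "transpose i j \<circ> y \<in> sym n"
      by (rule sym_comp[OF _ that(1)]) (use that in \<open>auto simp: sym_def intro: permutes_swap_id\<close>)
    then show ?thesis using ell_transpose_less_iff[OF that] that by (simp add: len_eq_ell)
  qed
  then show ?thesis unfolding bruhat_step_def by blast
qed

lemma bruhat_step_ell:
  "bruhat_step n y w \<Longrightarrow> y \<in> sym n \<and> w \<in> sym n \<and> ell y < ell w"
proof -
  assume s: "bruhat_step n y w"
  then obtain i j where ij: "y \<in> sym n" "1 \<le> i" "i < j" "j \<le> n" "w = transpose i j \<circ> y" "len n y < len n w"
    by (auto simp: bruhat_step_def)
  have "w \<in> sym n" unfolding ij(5)
    by (rule sym_comp[OF _ ij(1)]) (use ij in \<open>auto simp: sym_def intro: permutes_swap_id\<close>)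
  then show ?thesis using ij by (simp add: len_eq_ell)
qed

lemma bruhat_less_ell: "bruhat_less n y w \<Longrightarrow> ell y < ell w"
proof -
  assume "bruhat_less n y w"
  then have *: "(bruhat_step n)\<^sup>*\<^sup>* y w" "y \<noteq> w" by (auto simp: bruhat_less_def bruhat_le_def)
  from *(1) have "y = w \<or> ell y < ell w"
  proof (induction rule: rtranclp_induct)
    case (step v w)
    then show ?case using bruhat_step_ell[OF step(2)] by auto
  qed simp
  with *(2) show ?thesis by simp
qed

lemma bruhat_le_refl [simp]: "w \<in> sym n \<Longrightarrow> bruhat_le n w w"
  by (simp add: bruhat_le_def)

lemma bruhat_le_trans: "bruhat_le n x y \<Longrightarrow> bruhat_le n y z \<Longrightarrow> bruhat_le n x z"
  by (auto simp: bruhat_le_def)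

lemma bruhat_step_le: "bruhat_step n x y \<Longrightarrow> bruhat_le n x y"
  using bruhat_step_ell by (auto simp: bruhat_le_def)

lemma bruhat_le_asc:
  assumes "w \<in> sym n" "i \<in> {1..<n}" "\<not> desc i w"
  shows "bruhat_le n w (simple_refl i \<circ> w)"
proof (rule bruhat_step_le)
  have "pinv w i < pinv w (Suc i)"
    using assms(3) inv_eq_bij[OF sym_bij[OF assms(1)], of i "Suc i"] by (auto simp: desc_def)
  then have "1 \<le> i \<and> i < Suc i \<and> Suc i \<le> n \<and> pinv w i < pinv w (Suc i) \<and>
      simple_refl i \<circ> w = transpose i (Suc i) \<circ> w"
    using assms by (auto simp: simple_refl_apply)
  then show "bruhat_step n w (simple_refl i \<circ> w)"
    unfolding bruhat_step_iff using assms(1) by blast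
qed

text \<open>Conjugation by \<open>s_k\<close> turns the transposition of \<open>i < j\<close> into
  that of \<open>s_k i\<close> and \<open>s_k j\<close>, still in this order unless the
  transposition is \<open>s_k\<close> itself.\<close>

lemma bruhat_step_simple_refl:
  assumes "bruhat_step n y w" "k \<in> {1..<n}"
  shows "w = simple_refl k \<circ> y \<or> bruhat_step n (simple_refl k \<circ> y) (simple_refl k \<circ> w)"
proof -
  obtain i j where ij: "y \<in> sym n" "1 \<le> i" "i < j" "j \<le> n" "pinv y i < pinv y j" "w = transpose i j \<circ> y"
    using assms(1) by (auto simp: bruhat_step_iff)
  show ?thesis
  proof (cases "i = k \<and> j = Suc k")
    case True
    then show ?thesis by (simp add: ij(6) simple_refl_apply)
  next
    case False
    let ?s = "simple_refl k"
    have "?s i < ?s j" using False ij(3) by (auto simp: simple_refl_def transpose_def)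
    moreover have "1 \<le> ?s i" "?s j \<le> n"
      using assms(2) ij by (auto simp: simple_refl_def transpose_def)
    moreover have "?s \<circ> w = transpose (?s i) (?s j) \<circ> (?s \<circ> y)"
      using transpose_comp_eq[of ?s "?s i" "?s j"] unfolding ij(6) comp_assoc[symmetric] by simp
    moreover have "pinv (?s \<circ> y) (?s i) < pinv (?s \<circ> y) (?s j)"
      using ij(5) sym_bij[OF ij(1)] by (simp add: bij_inv_simple_refl_comp_apply)
    ultimately show ?thesis
      unfolding bruhat_step_iff using ij(1) assms(2) by (intro disjI2) (auto simp del: One_nat_def)
  qed
qed

text \<open>A form of the lifting property. A Bruhat chain from \<open>y\<close> to \<open>w\<close>
  is multiplied by \<open>s_k\<close> step by step; this breaks down only at a step given by
  \<open>s_k\<close>, and there \<open>s_k y\<close> is itself a member of the chain.\<close>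

lemma bruhat_le_simple_refl:
  assumes "bruhat_le n y w" "k \<in> {1..<n}" "\<not> desc k w"
  shows "bruhat_le n (simple_refl k \<circ> y) (simple_refl k \<circ> w)"
proof -
  have "(bruhat_step n)\<^sup>*\<^sup>* y w" "w \<in> sym n" using assms(1) by (auto simp: bruhat_le_def)
  then have "bruhat_le n (simple_refl k \<circ> y) w \<or> bruhat_le n (simple_refl k \<circ> y) (simple_refl k \<circ> w)"
  proof (induction rule: converse_rtranclp_induct)
    case base
    then show ?case using assms(2) by (intro disjI2 bruhat_le_refl) (simp only: simple_refl_comp_sym)
  next
    case (step y z)
    have zw: "bruhat_le n z w" using step bruhat_step_ell by (auto simp: bruhat_le_def)
    show ?case using bruhat_step_simple_refl[OF step(1) assms(2)]
    proof
      assume "z = simple_refl k \<circ> y"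
      then show ?thesis using zw by (intro disjI1) (simp only:)
    next
      assume "bruhat_step n (simple_refl k \<circ> y) (simple_refl k \<circ> z)"
      then show ?thesis using step bruhat_step_le bruhat_le_trans by blast
    qed
  qed
  then show ?thesis
    using bruhat_le_asc[OF _ assms(2,3)] bruhat_le_trans \<open>w \<in> sym n\<close> by blast
qed

lemma descents_eq: "w \<in> sym n \<Longrightarrow> descents n w = {i \<in> {1..<n}. desc i w}"
proof -
  assume w: "w \<in> sym n"
  have "bruhat_less n (simple_refl i \<circ> w) w \<longleftrightarrow> desc i w" if i: "i \<in> {1..<n}" for i
  proof
    assume "desc i w"
    then have "\<not> desc i (simple_refl i \<circ> w)" using w sym_bij desc_simple_refl_comp by blast
    then have "bruhat_le n (simple_refl i \<circ> w) w"
      using bruhat_le_asc[of "simple_refl i \<circ> w" n i] i w by simp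
    moreover have "simple_refl i \<circ> w \<noteq> w"
      using \<open>desc i w\<close> \<open>\<not> desc i (simple_refl i \<circ> w)\<close> by metis
    ultimately show "bruhat_less n (simple_refl i \<circ> w) w" by (simp add: bruhat_less_def)
  next
    assume "bruhat_less n (simple_refl i \<circ> w) w"
    then have "ell (simple_refl i \<circ> w) < ell w" by (rule bruhat_less_ell)
    then show "desc i w" using ell_asc[OF w] by fastforce
  qed
  then show ?thesis by (auto simp: descents_def)
qed

section \<open>The regular representation\<close>

type_synonym hfun = "(nat \<Rightarrow> nat) \<Rightarrow> laurent"

definition zeta :: laurent where "zeta = qv - qv_inv"

definition scl :: "laurent \<Rightarrow> hfun \<Rightarrow> hfun"
  where "scl a x = (\<lambda>w. a * x w)"

text \<open>Left multiplication by \<open>T\<^sub>i\<close> on formal combinations \<open>\<Sum>\<^sub>w x(w) T\<^sub>w\<close>.\<close>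

definition Lop :: "nat \<Rightarrow> hfun \<Rightarrow> hfun"
  where "Lop i x = (\<lambda>w. x (simple_refl i \<circ> w) + (if desc i w then zeta * x w else 0))"

text \<open>The inverse of \<open>T_i\<close> is \<open>T_i - (q - q^-1)\<close>, by the quadratic
  relation.\<close>

definition Linv :: "nat \<Rightarrow> hfun \<Rightarrow> hfun"
  where "Linv i x = Lop i x - scl zeta x"

definition Tb :: "(nat \<Rightarrow> nat) \<Rightarrow> hfun"
  where "Tb w = (\<lambda>v. if v = w then 1 else 0)"

text \<open>Combinations over \<open>S_n\<close>, extended by zero, so that those over
  \<open>S_m\<close> are among them. The operators are defined on all functions, but the relations
  are verified where the argument is a permutation, since \<open>desc\<close> reads an inverse
  function.\<close>

definition Fn :: "nat \<Rightarrow> hfun set"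
  where "Fn n = {x. \<forall>w. w \<notin> sym n \<longrightarrow> x w = 0}"

lemma scl_apply [simp]: "scl a x w = a * x w"
  by (simp add: scl_def)

lemma scl_simps:
  "scl a (x + y) = scl a x + scl a y" "scl a (x - y) = scl a x - scl a y"
  "scl (a + b) x = scl a x + scl b x" "scl (a - b) x = scl a x - scl b x"
  "scl a (scl b x) = scl (a * b) x" "scl (- a) x = - scl a x" "scl a (- x) = - scl a x"
  by (auto simp: fun_eq_iff algebra_simps fun_Compl_def)

lemma scl_trivial [simp]: "scl 1 x = x" "scl 0 x = 0" "scl a 0 = 0"
  by (auto simp: fun_eq_iff)

lemma sum_fun_apply: "(sum f A :: hfun) w = (\<Sum>a\<in>A. f a w)"
  by (induction A rule: infinite_finite_induct) auto

lemma scl_sum: "scl a (sum f A) = (\<Sum>x\<in>A. scl a (f x))"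
  by (simp add: fun_eq_iff sum_fun_apply sum_distrib_left)

lemma minus_hfun_apply [simp]: "(x - y :: hfun) w = x w - y w" "(- x :: hfun) w = - x w"
  by (simp_all add: fun_diff_def fun_Compl_def)

lemma Lop_add: "Lop i (x + y) = Lop i x + Lop i y"
  and Lop_diff: "Lop i (x - y) = Lop i x - Lop i y"
  and Lop_scl: "Lop i (scl a x) = scl a (Lop i x)"
  and Lop_zero [simp]: "Lop i 0 = 0"
  by (auto simp: Lop_def fun_eq_iff algebra_simps)

lemma Lop_sum: "Lop i (sum f A) = (\<Sum>x\<in>A. Lop i (f x))"
  by (auto simp: fun_eq_iff Lop_def sum_fun_apply sum_distrib_left sum.distrib)

lemma Linv_scl: "Linv i (scl a x) = scl a (Linv i x)"
  by (auto simp: Linv_def Lop_scl scl_simps mult.commute)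

lemma Linv_sum: "Linv i (sum f A) = (\<Sum>x\<in>A. Linv i (f x))"
  by (simp add: Linv_def Lop_sum scl_sum sum_subtractf)

lemma Fn_zero [simp]: "0 \<in> Fn n"
  and Fn_add: "x \<in> Fn n \<Longrightarrow> y \<in> Fn n \<Longrightarrow> x + y \<in> Fn n"
  and Fn_diff: "x \<in> Fn n \<Longrightarrow> y \<in> Fn n \<Longrightarrow> x - y \<in> Fn n"
  and Fn_scl: "x \<in> Fn n \<Longrightarrow> scl a x \<in> Fn n"
  and Fn_Tb: "w \<in> sym n \<Longrightarrow> Tb w \<in> Fn n"
  and FnD: "x \<in> Fn n \<Longrightarrow> w \<notin> sym n \<Longrightarrow> x w = 0"
  by (auto simp: Fn_def Tb_def)

lemma Fn_sum: "(\<And>a. a \<in> A \<Longrightarrow> f a \<in> Fn n) \<Longrightarrow> sum f A \<in> Fn n"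
  by (induction A rule: infinite_finite_induct) (auto intro: Fn_add)

lemma Fn_Lop: "x \<in> Fn n \<Longrightarrow> i \<in> {1..<n} \<Longrightarrow> Lop i x \<in> Fn n"
  unfolding Fn_def Lop_def using simple_refl_comp_sym[of i n] by auto

lemma Fn_Linv: "x \<in> Fn n \<Longrightarrow> i \<in> {1..<n} \<Longrightarrow> Linv i x \<in> Fn n"
  unfolding Linv_def by (intro Fn_diff Fn_scl Fn_Lop)

lemma Fn_mono: "m \<le> n \<Longrightarrow> Fn m \<subseteq> Fn n"
  using sym_mono[of m n] by (auto simp: Fn_def)

lemma Fn_eqI:
  assumes "x \<in> Fn n" "y \<in> Fn n" "\<And>w. w \<in> sym n \<Longrightarrow> x w = y w"
  shows "x = y"
proof
  fix w show "x w = y w"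
    using assms(3)[of w] FnD[OF assms(1), of w] FnD[OF assms(2), of w] by (cases "w \<in> sym n") auto
qed

lemma Lop_quadratic:
  assumes "x \<in> Fn n" "i \<in> {1..<n}"
  shows "Lop i (Lop i x) = x + scl zeta (Lop i x)"
proof (rule Fn_eqI)
  fix w assume "w \<in> sym n"
  then have "desc i (simple_refl i \<circ> w) \<longleftrightarrow> \<not> desc i w"
    using desc_simple_refl_comp sym_bij by blast
  then show "Lop i (Lop i x) w = (x + scl zeta (Lop i x)) w"
    by (auto simp: Lop_def algebra_simps)
qed (use assms in \<open>auto intro!: Fn_add Fn_scl Fn_Lop\<close>)

lemma Lop_comm:
  assumes "x \<in> Fn n" "i \<in> {1..<n}" "j \<in> {1..<n}" "1 < \<bar>int i - int j\<bar>"
  shows "Lop i (Lop j x) = Lop j (Lop i x)"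
proof (rule Fn_eqI)
  fix w assume "w \<in> sym n"
  then have "bij w" by (rule sym_bij)
  have ji: "1 < \<bar>int j - int i\<bar>" using assms by simp
  show "Lop i (Lop j x) w = Lop j (Lop i x) w"
    using simple_refl_comm[OF assms(4), of w] descents_comm[OF \<open>bij w\<close> assms(4)]
      descents_comm[OF \<open>bij w\<close> ji]
    by (simp add: Lop_def algebra_simps)
qed (use assms in \<open>auto intro!: Fn_Lop\<close>)

lemma Lop_braid:
  assumes "x \<in> Fn n" "i \<in> {1..<n}" "Suc i \<in> {1..<n}"
  shows "Lop i (Lop (Suc i) (Lop i x)) = Lop (Suc i) (Lop i (Lop (Suc i) x))"
proof (rule Fn_eqI)
  fix w assume "w \<in> sym n"
  then have b: "bij w" by (rule sym_bij)
  let ?s = "simple_refl i" and ?t = "simple_refl (Suc i)"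
  let ?a = "pinv w i" and ?b = "pinv w (Suc i)" and ?c = "pinv w (Suc (Suc i))"
  \<comment> \<open>The order of the positions \<open>?a\<close>, \<open>?b\<close>,
    \<open>?c\<close> of the values \<open>i\<close>, \<open>i + 1\<close>, \<open>i + 2\<close>
    decides every descent that occurs, so the identity can be checked separately for each of these
    orders.\<close>
  have d: "desc i w \<longleftrightarrow> ?b < ?a" "desc (Suc i) w \<longleftrightarrow> ?c < ?b"
    "desc i (?s \<circ> w) \<longleftrightarrow> ?a < ?b" "desc (Suc i) (?s \<circ> w) \<longleftrightarrow> ?c < ?a"
    "desc i (?t \<circ> w) \<longleftrightarrow> ?c < ?a" "desc (Suc i) (?t \<circ> w) \<longleftrightarrow> ?b < ?c"
    "desc i (?t \<circ> (?s \<circ> w)) \<longleftrightarrow> ?c < ?b" "desc (Suc i) (?s \<circ> (?t \<circ> w)) \<longleftrightarrow> ?b < ?a"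
    using b by (simp_all add: desc_def bij_inv_simple_refl_comp_apply)
  have ne: "?a \<noteq> ?b" "?b \<noteq> ?c" "?a \<noteq> ?c" using inv_eq_bij[OF b] by auto
  show "Lop i (Lop (Suc i) (Lop i x)) w = Lop (Suc i) (Lop i (Lop (Suc i) x)) w"
    using ne unfolding Lop_def d simple_refl_comp_invol simple_refl_braid
    by (cases "?a < ?b"; cases "?b < ?c"; cases "?a < ?c") (auto simp: algebra_simps)
qed (use assms in \<open>auto intro!: Fn_Lop\<close>)

lemma Lop_Linv:
  assumes "x \<in> Fn n" "i \<in> {1..<n}"
  shows "Lop i (Linv i x) = x" "Linv i (Lop i x) = x"
  using Lop_quadratic[OF assms] by (simp_all add: Linv_def Lop_diff Lop_scl)

lemma Linv_quadratic:
  assumes "x \<in> Fn n" "i \<in> {1..<n}"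
  shows "Linv i (Linv i x) = x - scl zeta (Linv i x)"
  using Lop_Linv(1)[OF assms] by (simp add: Linv_def)

text \<open>The relation for the inverse operators is the inverse of the relation for
  \<open>Lop\<close>: the right-hand side is mapped back to \<open>x\<close>, and \<open>x\<close>
  is rewritten in terms of it.\<close>

lemma Linv_comm:
  assumes "x \<in> Fn n" "i \<in> {1..<n}" "j \<in> {1..<n}" "1 < \<bar>int i - int j\<bar>"
  shows "Linv i (Linv j x) = Linv j (Linv i x)"
proof -
  define y where "y = Linv j (Linv i x)"
  have y: "y \<in> Fn n" using assms unfolding y_def by (intro Fn_Linv)
  have "Lop j (Lop i y) = Lop i (Lop j y)" using Lop_comm[OF y assms(2-4)] by simp
  also have "\<dots> = x" using assms by (simp add: y_def Lop_Linv[where n = n] Fn_Linv[where n = n])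
  finally have x: "x = Lop j (Lop i y)" by simp
  show ?thesis
    unfolding y_def[symmetric]
    by (subst x) (use assms y in \<open>simp add: Lop_Linv[where n = n] Fn_Lop[where n = n]\<close>)
qed

lemma Linv_braid:
  assumes "x \<in> Fn n" "i \<in> {1..<n}" "Suc i \<in> {1..<n}"
  shows "Linv i (Linv (Suc i) (Linv i x)) = Linv (Suc i) (Linv i (Linv (Suc i) x))"
proof -
  define z where "z = Linv (Suc i) (Linv i (Linv (Suc i) x))"
  have z: "z \<in> Fn n" using assms unfolding z_def by (intro Fn_Linv)
  have "Lop i (Lop (Suc i) (Lop i z)) = Lop (Suc i) (Lop i (Lop (Suc i) z))"
    by (rule Lop_braid[OF z assms(2,3)])
  also have "\<dots> = x"
    using assms by (simp add: z_def Lop_Linv[where n = n] Fn_Linv[where n = n])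
  finally have x: "x = Lop i (Lop (Suc i) (Lop i z))" by simp
  show ?thesis
    unfolding z_def[symmetric] by (subst x) (use assms z in \<open>simp add: Lop_Linv[where n = n] Fn_Lop[where n = n]\<close>)
qed

lemma Lop_Tb:
  assumes "bij w"
  shows "Lop i (Tb w) = Tb (simple_refl i \<circ> w) + (if desc i w then scl zeta (Tb w) else 0)"
  by (auto simp: Lop_def Tb_def fun_eq_iff[where 'b = laurent] simple_refl_comp_eq_iff)

lemma hfun_expand:
  assumes "x \<in> Fn n"
  shows "x = (\<Sum>w\<in>sym n. scl (x w) (Tb w))"
proof
  fix v
  have "(\<Sum>w\<in>sym n. x w * Tb w v) = (\<Sum>w\<in>sym n. if v = w then x v else 0)"
    by (intro sum.cong) (auto simp: Tb_def)
  then show "x v = (\<Sum>w\<in>sym n. scl (x w) (Tb w)) v"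
    using FnD[OF assms, of v] by (auto simp: sum_fun_apply)
qed


subsection \<open>The bar involution\<close>

text \<open>\<open>Bb n w\<close> holds the coordinates of the bar conjugate of \<open>T\<^sub>w\<close>.\<close>

definition Bb :: "nat \<Rightarrow> (nat \<Rightarrow> nat) \<Rightarrow> hfun"
  where "Bb n w = foldr Linv (SOME js. expression_of n js w \<and> reduced js) (Tb id)"

text \<open>Semilinear extension of bar from the \<open>T_w\<close>; \<open>hecke_bar_eq\<close>
  identifies it with \<open>hecke_bar\<close> in coordinates.\<close>

definition beta :: "nat \<Rightarrow> hfun \<Rightarrow> hfun"
  where "beta n x = (\<Sum>w\<in>sym n. scl (laurent_bar (x w)) (Bb n w))"

lemma foldr_Linv_eq:
  assumes "set js \<subseteq> {1..<n}" "set ks \<subseteq> {1..<n}" "reduced js" "reduced ks"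
    "perm_of_word js = perm_of_word ks"
  shows "foldr Linv js (Tb id) = foldr Linv ks (Tb id)"
proof (rule matsumoto[where D = "Fn n" and n = n])
  show "Tb id \<in> Fn n" by (intro Fn_Tb) simp
qed (use assms Fn_Linv Linv_braid Linv_comm in \<open>auto simp del: One_nat_def\<close>)

lemma Bb_word:
  assumes "expression_of n js w" "reduced js"
  shows "Bb n w = foldr Linv js (Tb id)"
proof -
  define ks where "ks = (SOME js. expression_of n js w \<and> reduced js)"
  have "expression_of n ks w \<and> reduced ks"
    unfolding ks_def by (rule someI[of _ js]) (use assms in blast)
  then show ?thesis
    unfolding Bb_def ks_def[symmetric] using assms by (intro foldr_Linv_eq) (auto simp: expression_of_def)
qed

lemma expression_of_mono: "m \<le> n \<Longrightarrow> expression_of m js w \<Longrightarrow> expression_of n js w"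
  by (force simp: expression_of_def)

lemma Bb_mono:
  assumes "m \<le> n" "w \<in> sym m"
  shows "Bb m w = Bb n w"
proof -
  obtain js where "expression_of m js w" "reduced js" using exists_reduced[OF assms(2)] by blast
  then show ?thesis using Bb_word expression_of_mono[OF assms(1)] by metis
qed

lemma Bb_id: "Bb n id = Tb id"
  using Bb_word[of n "[]" id] by (simp add: expression_of_def)

lemma Bb_asc:
  assumes "w \<in> sym n" "i \<in> {1..<n}" "\<not> desc i w"
  shows "Bb n (simple_refl i \<circ> w) = Linv i (Bb n w)"
proof -
  obtain js where js: "expression_of n js w" "reduced js" using exists_reduced[OF assms(1)] by blast
  then have "expression_of n (i # js) (simple_refl i \<circ> w)" "reduced (i # js)"
    using assms reduced_Cons[of i js n] by (auto simp: expression_of_def)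
  then show ?thesis using js Bb_word by simp
qed

lemma sym_desc_induct [consumes 1, case_names id asc]:
  assumes "w \<in> sym n" "P id"
    and "\<And>i v. i \<in> {1..<n} \<Longrightarrow> v \<in> sym n \<Longrightarrow> \<not> desc i v \<Longrightarrow> P v \<Longrightarrow> P (simple_refl i \<circ> v)"
  shows "P w"
  using assms(1)
proof (induction "ell w" arbitrary: w rule: less_induct)
  case less
  show ?case
  proof (cases "w = id")
    case True
    then show ?thesis using assms(2) by simp
  next
    case False
    then obtain i where i: "i \<in> {1..<n}" "desc i w" using exists_desc less.prems by blast
    define v where "v = simple_refl i \<circ> w"
    have v: "v \<in> sym n" "\<not> desc i v" "ell v < ell w"
      using i less.prems ell_desc[of w n i] by (auto simp: v_def desc_simple_refl_comp sym_bij)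
    have "P (simple_refl i \<circ> v)" using assms(3)[OF i(1) v(1,2)] less.hyps[OF v(3,1)] by simp
    then show ?thesis by (simp add: v_def)
  qed
qed

lemma Fn_Bb: "w \<in> sym n \<Longrightarrow> Bb n w \<in> Fn n"
proof (induction rule: sym_desc_induct)
  case id
  show ?case unfolding Bb_id by (intro Fn_Tb) simp
next
  case (asc i v)
  then show ?case unfolding Bb_asc[OF asc(2,1,3)] by (intro Fn_Linv)
qed

lemma Linv_Bb:
  assumes "w \<in> sym n" "i \<in> {1..<n}"
  shows "Linv i (Bb n w) = Bb n (simple_refl i \<circ> w) - (if desc i w then scl zeta (Bb n w) else 0)"
proof (cases "desc i w")
  case True
  define v where "v = simple_refl i \<circ> w"
  have v: "v \<in> sym n" "\<not> desc i v" "w = simple_refl i \<circ> v"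
    using assms True by (auto simp: v_def desc_simple_refl_comp sym_bij)
  have "Bb n w = Linv i (Bb n v)" unfolding v(3) using v assms by (intro Bb_asc)
  then show ?thesis using True Linv_quadratic[OF Fn_Bb[OF v(1)] assms(2)] v(3) by (simp add: v_def[symmetric])
next
  case False
  then show ?thesis using Bb_asc[OF assms False] by simp
qed

lemma beta_add: "beta n (x + y) = beta n x + beta n y"
  and beta_diff: "beta n (x - y) = beta n x - beta n y"
  and beta_scl: "beta n (scl a x) = scl (laurent_bar a) (beta n x)"
  and beta_zero [simp]: "beta n 0 = 0"
  by (simp_all add: beta_def scl_simps sum.distrib sum_subtractf scl_sum)

lemma beta_sum: "beta n (sum f A) = (\<Sum>a\<in>A. beta n (f a))"
  by (induction A rule: infinite_finite_induct)
    (simp_all only: sum.infinite sum.empty sum.insert beta_add beta_zero not_False_eq_True)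

lemma Fn_beta: "beta n x \<in> Fn n"
  unfolding beta_def by (intro Fn_sum Fn_scl Fn_Bb)

lemma beta_Tb: "w \<in> sym n \<Longrightarrow> beta n (Tb w) = Bb n w"
proof -
  assume "w \<in> sym n"
  moreover have "beta n (Tb w) = (\<Sum>v\<in>sym n. if w = v then Bb n w else 0)"
    unfolding beta_def by (intro sum.cong) (auto simp: Tb_def)
  ultimately show ?thesis by simp
qed

lemma sum_sym_simple_refl:
  assumes "i \<in> {1..<n}"
  shows "(\<Sum>w\<in>sym n. f (simple_refl i \<circ> w)) = (\<Sum>w\<in>sym n. f w)"
  by (rule sum.reindex_bij_witness[of _ "\<lambda>w. simple_refl i \<circ> w" "\<lambda>w. simple_refl i \<circ> w"])
    (use assms in \<open>simp_all only: simple_refl_comp_invol simple_refl_comp_sym\<close>)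

text \<open>Bar negates \<open>zeta\<close> and turns \<open>T_i\<close> into its inverse. A
  consequence is that \<open>T_i - q\<close> is bar-invariant: its image is
  \<open>T_i - zeta - q^-1\<close>, which is \<open>T_i - q\<close> again.\<close>

lemma beta_Lop:
  assumes "i \<in> {1..<n}"
  shows "beta n (Lop i x) = Linv i (beta n x)"
proof -
  have bz: "laurent_bar zeta = - zeta" by (simp add: zeta_def)
  have "beta n (Lop i x) = (\<Sum>w\<in>sym n. scl (laurent_bar (x (simple_refl i \<circ> w))) (Bb n w)) +
      (\<Sum>w\<in>sym n. if desc i w then scl (- (zeta * laurent_bar (x w))) (Bb n w) else 0)"
    unfolding beta_def sum.distrib[symmetric] by (intro sum.cong) (auto simp: Lop_def scl_simps bz)
  also have "(\<Sum>w\<in>sym n. scl (laurent_bar (x (simple_refl i \<circ> w))) (Bb n w)) =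
      (\<Sum>w\<in>sym n. scl (laurent_bar (x w)) (Bb n (simple_refl i \<circ> w)))"
    using sum_sym_simple_refl[OF assms, of "\<lambda>w. scl (laurent_bar (x w)) (Bb n (simple_refl i \<circ> w))"]
    by (simp only: simple_refl_comp_invol)
  also have "\<dots> + (\<Sum>w\<in>sym n. if desc i w then scl (- (zeta * laurent_bar (x w))) (Bb n w) else 0) =
      (\<Sum>w\<in>sym n. scl (laurent_bar (x w)) (Linv i (Bb n w)))"
    unfolding sum.distrib[symmetric] using assms
    by (intro sum.cong) (auto simp: Linv_Bb[OF _ assms] scl_simps mult.commute)
  also have "\<dots> = Linv i (beta n x)" by (simp add: beta_def Linv_sum Linv_scl)
  finally show ?thesis .
qed

lemma beta_mono:
  assumes "m \<le> n" "x \<in> Fn m"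
  shows "beta m x = beta n x"
proof -
  have "beta m x = (\<Sum>w\<in>sym m. scl (laurent_bar (x w)) (Bb n w))"
    unfolding beta_def using Bb_mono[OF assms(1)] by (intro sum.cong) auto
  also have "\<dots> = beta n x"
    unfolding beta_def using sym_mono[OF assms(1)] FnD[OF assms(2)]
    by (intro sum.mono_neutral_left) auto
  finally show ?thesis .
qed

lemma Linv_apply: "Linv i x v = x (simple_refl i \<circ> v) - (if desc i v then 0 else zeta * x v)"
  by (simp add: Linv_def Lop_def)

text \<open>The inverse of \<open>T_i\<close> raises the length of a basis element by at most one,
  and the length of \<open>s_i w\<close> is reached only from the leading term at
  \<open>w\<close>.\<close>

lemma Bb_unitriangular:
  "w \<in> sym n \<Longrightarrow> Bb n w w = 1 \<and> (\<forall>v. v \<noteq> w \<longrightarrow> Bb n w v \<noteq> 0 \<longrightarrow> ell v < ell w)"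
proof (induction rule: sym_desc_induct)
  case id
  show ?case unfolding Bb_id Tb_def by (auto simp only: if_True if_False split: if_splits)
next
  case (asc i w)
  let ?s = "simple_refl i"
  have ell: "ell (?s \<circ> w) = Suc (ell w)" using ell_asc asc by blast
  have d: "desc i (?s \<circ> w)" using asc desc_simple_refl_comp sym_bij by blast
  show ?case unfolding Bb_asc[OF asc(2,1,3)]
  proof (intro conjI allI impI)
    show "Linv i (Bb n w) (?s \<circ> w) = 1"
      unfolding Linv_apply simple_refl_comp_invol using asc d by simp
  next
    fix v assume v: "v \<noteq> ?s \<circ> w" "Linv i (Bb n w) v \<noteq> 0"
    then have "Bb n w (?s \<circ> v) \<noteq> 0 \<or> Bb n w v \<noteq> 0"
      unfolding Linv_apply by (auto split: if_splits)
    then show "ell v < ell (?s \<circ> w)"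
    proof
      assume nz: "Bb n w (?s \<circ> v) \<noteq> 0"
      have "?s \<circ> v \<noteq> w" using v(1) by auto
      then have 1: "ell (?s \<circ> v) < ell w" using nz asc by blast
      have sv: "?s \<circ> v \<in> sym n" using nz FnD[OF Fn_Bb[OF asc(2)]] by blast
      have "ell (?s \<circ> (?s \<circ> v)) \<le> Suc (ell (?s \<circ> v))" by (rule ell_simple_refl_le[OF sv asc(1)])
      then have "ell v \<le> Suc (ell (?s \<circ> v))" by (simp only: simple_refl_comp_invol)
      then show ?thesis using 1 ell by simp
    next
      assume "Bb n w v \<noteq> 0"
      then have "v = w \<or> ell v < ell w" using asc by blast
      then show ?thesis using ell by auto
    qed
  qed
qed

text \<open>At an element \<open>v\<close> of maximal length in the support only \<open>v\<close>
  itself contributes to \<open>beta n x\<close>, by unitriangularity. Hence \<open>x v\<close> is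
  bar-invariant and lies in \<open>q Z[q]\<close>, which forces it to vanish.\<close>

lemma beta_invariant_qpos_zero:
  assumes "x \<in> Fn n" "beta n x = x" "\<And>w. x w \<in> qpos"
  shows "x = 0"
proof (rule ccontr)
  assume "x \<noteq> 0"
  define S where "S = {w. x w \<noteq> 0}"
  have S: "S \<subseteq> sym n" using FnD[OF assms(1)] by (auto simp: S_def)
  then have fin: "finite S" using finite_subset finite_sym by blast
  have "S \<noteq> {}" using \<open>x \<noteq> 0\<close> by (auto simp: S_def fun_eq_iff)
  have "Max (ell ` S) \<in> ell ` S" using fin \<open>S \<noteq> {}\<close> by (intro Max_in) auto
  then obtain v where v: "v \<in> S" "ell v = Max (ell ` S)" by auto
  have max: "ell w \<le> ell v" if "w \<in> S" for w using that fin v by simp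
  have "x v = (\<Sum>w\<in>sym n. laurent_bar (x w) * Bb n w v)"
    using assms(2) by (metis (no_types, lifting) beta_def scl_apply sum.cong sum_fun_apply)
  also have "\<dots> = (\<Sum>w\<in>sym n. if w = v then laurent_bar (x v) else 0)"
  proof (intro sum.cong refl)
    fix w assume w: "w \<in> sym n"
    show "laurent_bar (x w) * Bb n w v = (if w = v then laurent_bar (x v) else 0)"
    proof (cases "w = v")
      case False
      then show ?thesis using Bb_unitriangular[OF w] max[of w] by (cases "x w = 0") (force simp: S_def)+
    qed (use Bb_unitriangular[OF w] in simp)
  qed
  also have "\<dots> = laurent_bar (x v)" using v S by auto
  finally have "x v = 0" using bar_invariant_qpos assms(3) by metis
  then show False using v by (simp add: S_def)
qed

section \<open>The Kazhdan--Lusztig basis\<close>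

text \<open>The exponents of \<open>(-q)\<^sup>D P(q\<^sup>-\<^sup>2)\<close> for an integer polynomial \<open>P\<close> of degree at most \<open>D / 2\<close>.\<close>

definition kl_exponents :: "int \<Rightarrow> laurent \<Rightarrow> bool"
  where "kl_exponents D a \<longleftrightarrow> (\<forall>k. lk a k \<noteq> 0 \<longrightarrow> 0 \<le> k \<and> k \<le> D \<and> even (k - D))"

text \<open>The characterisation of \<open>C_w\<close> without the polynomials: a term of degree
  \<open>i\<close> in \<open>P\<close> gives the exponent \<open>D - 2 i\<close>, where
  \<open>D\<close> is the difference of lengths, and the bound \<open>2 deg P + 1 <= D\<close> says
  that no exponent falls below \<open>1\<close>. This accounts for the vanishing constant
  term.\<close>

definition is_C :: "nat \<Rightarrow> (nat \<Rightarrow> nat) \<Rightarrow> hfun \<Rightarrow> bool"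
  where "is_C n w x \<longleftrightarrow> x \<in> Fn n \<and> beta n x = x \<and> x w = 1 \<and>
    (\<forall>y. x y \<noteq> 0 \<longrightarrow> bruhat_le n y w) \<and>
    (\<forall>y. y \<noteq> w \<longrightarrow> kl_exponents (int (ell w) - int (ell y)) (x y) \<and> lk (x y) 0 = 0)"

lemma kl_exponents_add: "kl_exponents D a \<Longrightarrow> kl_exponents D b \<Longrightarrow> kl_exponents D (a + b)"
  unfolding kl_exponents_def lookup_add by (metis add.right_neutral)

lemma kl_exponents_zero [simp]: "kl_exponents D 0"
  by (simp add: kl_exponents_def)

lemma kl_exponents_minus: "kl_exponents D a \<Longrightarrow> kl_exponents D (- a)"
  by (simp add: kl_exponents_def)

lemma kl_exponents_diff: "kl_exponents D a \<Longrightarrow> kl_exponents D b \<Longrightarrow> kl_exponents D (a - b)"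
  using kl_exponents_add[of D a "- b"] kl_exponents_minus by simp

lemma kl_exponents_sum: "(\<And>x. x \<in> A \<Longrightarrow> kl_exponents D (f x)) \<Longrightarrow> kl_exponents D (sum f A)"
  by (induction A rule: infinite_finite_induct) (auto intro: kl_exponents_add)

lemma kl_exponents_of_int_mult: "kl_exponents D a \<Longrightarrow> kl_exponents D (of_int c * a)"
  by (simp add: kl_exponents_def)

lemma kl_exponents_shift:
  assumes "kl_exponents D a" "D \<le> E" "even (E - D)"
  shows "kl_exponents E a"
  unfolding kl_exponents_def
proof safe
  fix k assume "lk a k \<noteq> 0"
  then have k: "0 \<le> k" "k \<le> D" "even (k - D)" using assms(1) by (auto simp: kl_exponents_def)
  show "0 \<le> k" "k \<le> E" using k assms(2) by auto
  have "k - E = (k - D) - (E - D)" by simp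
  then show "even (k - E)" using k(3) assms(3) by presburger
qed

lemma qpos_kl_exponents: "kl_exponents D a \<Longrightarrow> lk a 0 = 0 \<Longrightarrow> a \<in> qpos"
proof -
  assume a: "kl_exponents D a" "lk a 0 = 0"
  have "1 \<le> k" if "lk a k \<noteq> 0" for k
  proof -
    have "k \<noteq> 0" "0 \<le> k" using that a by (auto simp: kl_exponents_def)
    then show ?thesis by simp
  qed
  then show ?thesis by (simp add: qpos_def)
qed

lemma is_C_D:
  assumes "is_C n w x"
  shows "x \<in> Fn n" "beta n x = x" "x w = 1" "w \<in> sym n"
    "\<And>y. x y \<noteq> 0 \<Longrightarrow> bruhat_le n y w"
    "\<And>y. x y \<noteq> 0 \<Longrightarrow> y \<noteq> w \<Longrightarrow> ell y < ell w"
    "\<And>y. y \<noteq> w \<Longrightarrow> kl_exponents (int (ell w) - int (ell y)) (x y)"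
    "\<And>y. y \<noteq> w \<Longrightarrow> lk (x y) 0 = 0"
    "\<And>y. y \<noteq> w \<Longrightarrow> x y \<in> qpos"
proof -
  show "x \<in> Fn n" "beta n x = x" "x w = 1"
    and le: "\<And>y. x y \<noteq> 0 \<Longrightarrow> bruhat_le n y w"
    and "\<And>y. y \<noteq> w \<Longrightarrow> kl_exponents (int (ell w) - int (ell y)) (x y)"
    and "\<And>y. y \<noteq> w \<Longrightarrow> lk (x y) 0 = 0"
    using assms by (auto simp: is_C_def)
  then show "\<And>y. y \<noteq> w \<Longrightarrow> x y \<in> qpos" using qpos_kl_exponents by blast
  show "w \<in> sym n" using le[of w] \<open>x w = 1\<close> by (simp add: bruhat_le_def)
  show "\<And>y. x y \<noteq> 0 \<Longrightarrow> y \<noteq> w \<Longrightarrow> ell y < ell w"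
    using le bruhat_less_ell unfolding bruhat_less_def by blast
qed

text \<open>Two bar-invariant elements that agree modulo \<open>q\<close> coincide, by applying
  \<open>beta_invariant_qpos_zero\<close> to their difference.\<close>

lemma eq_by_qpos:
  assumes "x \<in> Fn n" "y \<in> Fn n" "beta n x = x" "beta n y = y" "\<And>w. x w - y w \<in> qpos"
  shows "x = y"
proof -
  have "x - y = 0"
    by (rule beta_invariant_qpos_zero[of _ n]) (use assms in \<open>auto simp: beta_diff intro: Fn_diff\<close>)
  then show ?thesis by simp
qed

lemma is_C_unique:
  assumes "is_C n w x" "is_C n w y"
  shows "x = y"
proof (rule eq_by_qpos[of _ n])
  fix v show "x v - y v \<in> qpos"
    using is_C_D[OF assms(1)] is_C_D[OF assms(2)] by (cases "v = w") (auto intro: qpos_diff)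
qed (use is_C_D[OF assms(1)] is_C_D[OF assms(2)] in auto)

text \<open>All exponents at \<open>y\<close> have the parity of the difference of lengths, so an
  occurrence of \<open>q\<close> makes this difference odd; the coefficient at \<open>v\<close> is
  \<open>1\<close> and contains no \<open>q\<close>.\<close>

lemma lk_kl_nonzero_parity:
  assumes "is_C n v x" "lk (x y) 1 \<noteq> 0"
  shows "y \<noteq> v" "x y \<noteq> 0" "ell y < ell v" "y \<in> sym n" "odd (int (ell v) - int (ell y))"
proof -
  show *: "y \<noteq> v" using assms is_C_D(3)[OF assms(1)] by (auto simp: lookup_one when_def)
  show nz: "x y \<noteq> 0" using assms(2) by auto
  show "ell y < ell v" using is_C_D(6)[OF assms(1) nz *] .
  show "y \<in> sym n" using FnD[OF is_C_D(1)[OF assms(1)]] nz by blast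
  have "even (1 - (int (ell v) - int (ell y)))"
    using is_C_D(7)[OF assms(1) *] assms(2) unfolding kl_exponents_def by blast
  then show "odd (int (ell v) - int (ell y))" by presburger
qed

text \<open>For \<open>x = C_v\<close> the coefficient of \<open>q\<close> at \<open>y\<close> is
  \<open>- mu(y, v)\<close>; it is nonzero precisely when \<open>y\<close> precedes \<open>v\<close>
  in the relation that defines the graph.\<close>

definition mu_set :: "nat \<Rightarrow> nat \<Rightarrow> hfun \<Rightarrow> (nat \<Rightarrow> nat) set"
  where "mu_set n i x = {y \<in> sym n. desc i y \<and> lk (x y) 1 \<noteq> 0}"

text \<open>\<open>T_i - q\<close> is the basis element of \<open>s_i\<close>. The sum is added, not
  subtracted, because \<open>lk (c v y) 1\<close> is minus the usual \<open>mu\<close>.\<close>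

definition kl_step :: "nat \<Rightarrow> nat \<Rightarrow> (nat \<Rightarrow> nat) \<Rightarrow> ((nat \<Rightarrow> nat) \<Rightarrow> hfun) \<Rightarrow> hfun"
  where "kl_step n i v c = Lop i (c v) - scl qv (c v) +
    (\<Sum>y\<in>mu_set n i (c v). scl (of_int (lk (c v y) 1)) (c y))"

lemma finite_mu_set [simp]: "finite (mu_set n i x)"
  by (simp add: mu_set_def)

lemma lk_sum: "lk (sum f A) k = (\<Sum>x\<in>A. lk (f x) k)"
  by (simp add: lookup_sum)

text \<open>\<open>(T_i - q) C_v\<close> is bar-invariant. Its only defect is that
  \<open>q^-1\<close> may turn a term \<open>q\<close> of a coefficient into a constant, which
  happens at \<open>u\<close> with descent \<open>i\<close>; the added integer multiples of the
  \<open>C_u\<close> remove these constants and keep bar invariance.\<close>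

lemma is_C_kl_step:
  assumes v: "is_C n v (c v)" "i \<in> {1..<n}" "\<not> desc i v"
    and c: "\<And>y. y \<in> mu_set n i (c v) \<Longrightarrow> is_C n y (c y)"
  shows "is_C n (simple_refl i \<circ> v) (kl_step n i v c)"
proof -
  let ?s = "simple_refl i"
  define w where "w = ?s \<circ> v"
  define M where "M = mu_set n i (c v)"
  define S where "S = (\<Sum>y\<in>M. scl (of_int (lk (c v y) 1)) (c y))"
  note V = is_C_D[OF v(1)]
  note Y = is_C_D[OF c, folded M_def]
  have vw: "?s \<circ> w = v" by (simp add: w_def)
  have dw: "desc i w" using v V(4) desc_simple_refl_comp sym_bij by (auto simp: w_def)
  have ellw: "ell w = Suc (ell v)" unfolding w_def using ell_asc V(4) v(3) by blast
  have w: "w \<in> sym n" using V(4) v(2) unfolding w_def by (simp only: simple_refl_comp_sym)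
  have M: "y \<noteq> v" "c v y \<noteq> 0" "ell y < ell v" "y \<in> sym n" "odd (int (ell v) - int (ell y))"
      "desc i y" if "y \<in> M" for y
    using lk_kl_nonzero_parity[OF v(1), of y] that by (auto simp: M_def mu_set_def)
  have finM: "finite M" by (simp add: M_def)
  have S: "S u = (\<Sum>y\<in>M. of_int (lk (c v y) 1) * c y u)" for u
    by (simp add: S_def sum_fun_apply)
  \<comment> \<open>At a descent the term \<open>zeta\<close> of \<open>T_i\<close> combines with
    \<open>- q\<close> to \<open>- q^-1\<close>.\<close>
  have step: "kl_step n i v c u = c v (?s \<circ> u) + (if desc i u then - (qv_inv * c v u) else - (qv * c v u)) + S u" for u
    by (auto simp: kl_step_def M_def[symmetric] S_def[symmetric] Lop_def zeta_def algebra_simps)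
  have lev: "bruhat_le n v w" unfolding w_def using bruhat_le_asc V(4) v by blast
  have ell_s: "ell (?s \<circ> u) = ell u - 1 \<and> 0 < ell u" if "desc i u" "u \<in> sym n" for u
    using ell_desc[OF that(2) v(2) that(1)] by simp
  show ?thesis
    unfolding w_def[symmetric] is_C_def
  proof (intro conjI allI impI)
    show "kl_step n i v c \<in> Fn n"
      unfolding kl_step_def M_def[symmetric] using V(1) Y(1) v(2)
      by (intro Fn_add Fn_diff Fn_scl Fn_sum Fn_Lop)
    show "beta n (kl_step n i v c) = kl_step n i v c"
    proof -
      have "beta n (\<Sum>y\<in>M. scl (of_int (lk (c v y) 1)) (c y)) = (\<Sum>y\<in>M. scl (of_int (lk (c v y) 1)) (c y))"
        unfolding beta_sum beta_scl bar_of_int using Y(2) by (intro sum.cong) auto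
      then show ?thesis
        unfolding kl_step_def M_def[symmetric] beta_add beta_diff beta_Lop[OF v(2)] beta_scl V(2) bar_qv
        by (simp add: Linv_def zeta_def scl_simps)
    qed
    \<comment> \<open>Length excludes \<open>w\<close> from the support of \<open>C_v\<close> and of
      every correction, so the coefficient \<open>1\<close> comes from \<open>T_i T_v\<close>
      alone.\<close>
    have "c y w = 0" if "y \<in> M" for y
      using Y(6)[OF that, of w] M(3)[OF that] ellw by (cases "c y w = 0") force+
    then have "S w = 0" unfolding S by (intro sum.neutral) auto
    moreover have "c v w = 0" using V(6)[of w] ellw by (cases "c v w = 0") force+
    ultimately show "kl_step n i v c w = 1" unfolding step vw using dw V(3) by simp
  next
    fix u assume nz: "kl_step n i v c u \<noteq> 0"
    have "c v (?s \<circ> u) \<noteq> 0 \<or> c v u \<noteq> 0 \<or> S u \<noteq> 0"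
    proof (rule ccontr)
      assume "\<not> ?thesis"
      then show False using nz unfolding step by (simp split: if_splits)
    qed
    then consider "c v (?s \<circ> u) \<noteq> 0" | "c v u \<noteq> 0" | y where "y \<in> M" "c y u \<noteq> 0"
      unfolding S by (metis (mono_tags, lifting) mult_zero_right sum.neutral)
    then show "bruhat_le n u w"
    proof cases
      case 1
      then have "bruhat_le n (?s \<circ> (?s \<circ> u)) (?s \<circ> v)"
        using V(5) bruhat_le_simple_refl v(2,3) by blast
      then show ?thesis by (simp only: simple_refl_comp_invol w_def)
    next
      case 2
      then show ?thesis using V(5) lev bruhat_le_trans by blast
    next
      case 3
      then have "bruhat_le n u y" "bruhat_le n y v" using Y(5) V(5) M(2) by auto
      then show ?thesis using lev bruhat_le_trans by blast
    qed
  next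
    fix u assume uw: "u \<noteq> w"
    define D where "D = int (ell w) - int (ell u)"
    have su: "?s \<circ> u \<noteq> v" using uw by (auto simp: w_def)
    have "kl_exponents D (kl_step n i v c u) \<and> lk (kl_step n i v c u) 0 = 0"
    proof (cases "u \<in> sym n")
      case False
      have "kl_step n i v c \<in> Fn n"
        unfolding kl_step_def M_def[symmetric] using V(1) Y(1) v(2)
        by (intro Fn_add Fn_diff Fn_scl Fn_sum Fn_Lop)
      then show ?thesis using FnD False by fastforce
    next
      case u: True
      have Sterm: "kl_exponents D (of_int (lk (c v y) 1) * c y u)" if "y \<in> M" "y \<noteq> u" for y
      proof (rule kl_exponents_of_int_mult, rule kl_exponents_shift)
        show "kl_exponents (int (ell y) - int (ell u)) (c y u)" using Y(7)[OF that(1)] that(2) by simp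
        show "int (ell y) - int (ell u) \<le> D" using M(3)[OF that(1)] ellw by (simp add: D_def)
        show "even (D - (int (ell y) - int (ell u)))" using M(5)[OF that(1)] ellw unfolding D_def by simp
      qed
      have Sconst: "lk (of_int (lk (c v y) 1) * c y u) 0 = (if y = u then lk (c v y) 1 else 0)" if "y \<in> M" for y
        using Y(8)[OF that, of u] Y(3)[OF that] by auto
      show ?thesis
      proof (cases "desc i u")
        case True
        then have uv: "u \<noteq> v" using v(3) by auto
        have e: "ell (?s \<circ> u) = ell u - 1" "0 < ell u" using ell_s True u by auto
        have a: "kl_exponents D (c v (?s \<circ> u))" "lk (c v (?s \<circ> u)) 0 = 0"
          using V(7,8)[OF su] e ellw by (auto simp: D_def of_nat_diff algebra_simps)
        \<comment> \<open>Since \<open>c v u\<close> has no constant term, division by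
          \<open>q\<close> leaves nonnegative exponents; the parity matches because \<open>w\<close>
          is longer than \<open>v\<close> by one.\<close>
        have b: "kl_exponents D (qv_inv * c v u)"
          unfolding kl_exponents_def
        proof (intro allI impI)
          fix k assume "lk (qv_inv * c v u) k \<noteq> 0"
          then have "lk (c v u) (k + 1) \<noteq> 0" by simp
          moreover have "lk (c v u) 0 = 0" using V(8)[OF uv] .
          ultimately have k: "k + 1 \<noteq> 0" "0 \<le> k + 1" "k + 1 \<le> D - 1" "even (k + 1 - (D - 1))"
            using V(7)[OF uv] ellw by (auto simp: kl_exponents_def D_def)
          then show "0 \<le> k \<and> k \<le> D \<and> even (k - D)" by presburger
        qed
        have s: "kl_exponents D (S u)"
          unfolding S
        proof (rule kl_exponents_sum)
          fix y assume y: "y \<in> M"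
          show "kl_exponents D (of_int (lk (c v y) 1) * c y u)"
          proof (cases "y = u")
            case True
            have "odd (int (ell v) - int (ell u))" "ell u < ell v" using M(3,5)[OF y] True by auto
            then have "kl_exponents D 1" using ellw by (auto simp: kl_exponents_def D_def lookup_one when_def)
            then show ?thesis using Y(3)[OF y] True by (intro kl_exponents_of_int_mult) simp
          qed (use Sterm[OF y] in auto)
        qed
        \<comment> \<open>The result is exactly the constant term of \<open>qv_inv * c v u\<close>,
          which is subtracted in \<open>kl_step\<close>.\<close>
        have "lk (S u) 0 = (\<Sum>y\<in>M. if y = u then lk (c v y) 1 else 0)"
          unfolding S lk_sum using Sconst by (intro sum.cong) auto
        also have "\<dots> = (if u \<in> M then lk (c v u) 1 else 0)" using finM by simp
        also have "\<dots> = lk (c v u) 1" using u True by (auto simp: M_def mu_set_def)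
        finally have sc: "lk (S u) 0 = lk (c v u) 1" .
        have eq: "kl_step n i v c u = c v (?s \<circ> u) - qv_inv * c v u + S u" unfolding step using True by simp
        show ?thesis unfolding eq
          using a sc by (intro conjI kl_exponents_add kl_exponents_diff a b s) (simp add: lookup_add lookup_minus)
      next
        case False
        have e: "ell (?s \<circ> u) = Suc (ell u)" using ell_asc u False by blast
        have a: "kl_exponents D (c v (?s \<circ> u))" "lk (c v (?s \<circ> u)) 0 = 0"
        proof -
          show "kl_exponents D (c v (?s \<circ> u))"
            by (rule kl_exponents_shift[OF V(7)[OF su]]) (use e ellw in \<open>auto simp: D_def\<close>)
        qed (use V(8)[OF su] in simp)
        have b: "kl_exponents D (qv * c v u)"
        \<comment> \<open>At \<open>u = v\<close> the coefficient of \<open>C_v\<close> is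
          \<open>1\<close>, to which the exponent bounds of \<open>is_C\<close> do not apply; here
          \<open>D = 1\<close> and the term is \<open>qv\<close> itself.\<close>
        proof (cases "u = v")
          case True
          then show ?thesis
            using V(3) ellw by (auto simp: kl_exponents_def D_def qv_def lookup_single when_def)
        next
          case False
          show ?thesis unfolding kl_exponents_def
          proof (intro allI impI)
            fix k assume "lk (qv * c v u) k \<noteq> 0"
            then have "lk (c v u) (k - 1) \<noteq> 0" by simp
            then have k: "0 \<le> k - 1" "k - 1 \<le> D - 1" "even (k - 1 - (D - 1))"
              using V(7)[OF False] ellw by (auto simp: kl_exponents_def D_def)
            then show "0 \<le> k \<and> k \<le> D \<and> even (k - D)" by presburger
          qed
        qed
        have b0: "lk (qv * c v u) 0 = 0"
        proof (cases "u = v")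
          case True
          then show ?thesis using V(3) by (simp add: qv_def lookup_single)
        next
          case False
          then show ?thesis using V(7)[OF False] by (auto simp: kl_exponents_def)
        qed
        have nM: "y \<noteq> u" if "y \<in> M" for y using M(6)[OF that] False by auto
        have s: "kl_exponents D (S u)"
          unfolding S by (intro kl_exponents_sum Sterm nM)
        have sc: "lk (S u) 0 = 0"
          unfolding S lk_sum using Sconst nM by (intro sum.neutral) auto
        have eq: "kl_step n i v c u = c v (?s \<circ> u) - qv * c v u + S u" unfolding step using False by simp
        show ?thesis unfolding eq
          using a sc b0 by (intro conjI kl_exponents_add kl_exponents_diff a b s) (simp add: lookup_add lookup_minus)
      qed
    qed
    then show "kl_exponents (int (ell w) - int (ell u)) (kl_step n i v c u)" "lk (kl_step n i v c u) 0 = 0"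
      by (auto simp: D_def)
  qed
qed

section \<open>Existence of the basis and its multiplication rules\<close>

definition KL :: "nat \<Rightarrow> (nat \<Rightarrow> nat) \<Rightarrow> hfun"
  where "KL n w = (THE x. is_C n w x)"

lemma KL_eqI: "is_C n w x \<Longrightarrow> KL n w = x"
  unfolding KL_def using is_C_unique by blast

lemma is_C_id: "is_C n id (Tb id)"
  unfolding is_C_def using Fn_Tb[OF id_sym, of n] beta_Tb[OF id_sym, of n] Bb_id[of n]
  by (auto simp del: id_apply simp: Tb_def)

text \<open>Every \<open>w\<close> except the identity is \<open>s_i v\<close> with \<open>v\<close>
  shorter, and the corrections in \<open>kl_step\<close> are shorter than \<open>v\<close>, so the
  recursion is well-founded.\<close>

lemma is_C_KL: "w \<in> sym n \<Longrightarrow> is_C n w (KL n w)"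
proof (induction "ell w" arbitrary: w rule: less_induct)
  case less
  show ?case
  proof (cases "w = id")
    case True
    then show ?thesis using is_C_id KL_eqI by metis
  next
    case False
    then obtain i where i: "i \<in> {1..<n}" "desc i w" using exists_desc less.prems by blast
    define v where "v = simple_refl i \<circ> w"
    have v: "v \<in> sym n" "\<not> desc i v" "ell v < ell w"
      using i less.prems ell_desc[of w n i] by (auto simp: v_def desc_simple_refl_comp sym_bij)
    have V: "is_C n v (KL n v)" using less.hyps v by blast
    have "is_C n y (KL n y)" if "y \<in> mu_set n i (KL n v)" for y
    proof (rule less.hyps)
      have "lk (KL n v y) 1 \<noteq> 0" using that by (simp add: mu_set_def)
      then show "ell y < ell w" "y \<in> sym n" using lk_kl_nonzero_parity[OF V] v by force+
    qed
    then have "is_C n (simple_refl i \<circ> v) (kl_step n i v (KL n))"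
      using is_C_kl_step[where c = "KL n", OF V i(1) v(2)] by blast
    then have "is_C n w (kl_step n i v (KL n))" by (simp add: v_def)
    then show ?thesis using KL_eqI by metis
  qed
qed

lemmas KL_D = is_C_D[OF is_C_KL]

lemma KL_asc:
  assumes "w \<in> sym n" "i \<in> {1..<n}" "\<not> desc i w"
  shows "KL n (simple_refl i \<circ> w) = kl_step n i w (KL n)"
  by (rule KL_eqI, rule is_C_kl_step) (use assms is_C_KL in \<open>auto simp: mu_set_def\<close>)

lemma Lop_KL_asc:
  assumes "w \<in> sym n" "i \<in> {1..<n}" "\<not> desc i w"
  shows "Lop i (KL n w) = scl qv (KL n w) + KL n (simple_refl i \<circ> w) -
    (\<Sum>y\<in>mu_set n i (KL n w). scl (of_int (lk (KL n w y) 1)) (KL n y))"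
  unfolding KL_asc[OF assms] by (simp add: kl_step_def)

text \<open>Writing \<open>w = s_i v\<close>, the part \<open>(T_i - q) C_v\<close> is an
  eigenvector because \<open>(T_i + q^-1) (T_i - q) = 0\<close>, and the corrections
  \<open>C_y\<close> have descent \<open>i\<close> and smaller length, so induction applies to
  them.\<close>

lemma Lop_KL_desc:
  assumes "w \<in> sym n" "i \<in> {1..<n}" "desc i w"
  shows "Lop i (KL n w) = scl (- qv_inv) (KL n w)"
  using assms
proof (induction "ell w" arbitrary: w rule: less_induct)
  case less
  define v where "v = simple_refl i \<circ> w"
  have v: "v \<in> sym n" "\<not> desc i v" "ell v < ell w" "w = simple_refl i \<circ> v"
    using less.prems ell_desc[of w n i] by (auto simp: v_def desc_simple_refl_comp sym_bij)
  have "Lop i (KL n y) = scl (- qv_inv) (KL n y)" if "y \<in> mu_set n i (KL n v)" for y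
  proof (rule less.hyps)
    have "lk (KL n v y) 1 \<noteq> 0" using that by (simp add: mu_set_def)
    then show "ell y < ell w" "y \<in> sym n" using lk_kl_nonzero_parity[OF is_C_KL[OF v(1)]] v by force+
    show "desc i y" using that by (simp add: mu_set_def)
  qed (use less.prems in auto)
  then have sum: "(\<Sum>y\<in>mu_set n i (KL n v). scl a (Lop i (KL n y))) =
      (\<Sum>y\<in>mu_set n i (KL n v). scl a (scl (- qv_inv) (KL n y)))" for a
    by (intro sum.cong) auto
  have "Lop i (\<Sum>y\<in>mu_set n i (KL n v). scl (of_int (lk (KL n v y) 1)) (KL n y)) =
      scl (- qv_inv) (\<Sum>y\<in>mu_set n i (KL n v). scl (of_int (lk (KL n v y) 1)) (KL n y))"
    unfolding Lop_sum scl_sum Lop_scl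
    by (intro sum.cong) (auto simp: \<open>\<And>y. y \<in> mu_set n i (KL n v) \<Longrightarrow> _ y\<close> scl_simps mult.commute)
  moreover have "Lop i (Lop i (KL n v) - scl qv (KL n v)) = scl (- qv_inv) (Lop i (KL n v) - scl qv (KL n v))"
    unfolding Lop_diff Lop_scl Lop_quadratic[OF KL_D(1)[OF v(1)] less.prems(2)]
    by (auto simp: fun_eq_iff zeta_def algebra_simps simp flip: mult.assoc)
  ultimately show ?case
    unfolding v(4) KL_asc[OF v(1) less.prems(2) v(2)] kl_step_def Lop_add by (simp only: scl_simps)
qed

section \<open>Passage from \<open>S_m\<close> to \<open>S_n\<close>, and linear
  independence\<close>

lemma bruhat_le_mono:
  assumes "m \<le> n" "bruhat_le m y w"
  shows "bruhat_le n y w"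
proof -
  have "bruhat_step n y w" if step: "bruhat_step m y w" for y w
  proof -
    obtain i j where "y \<in> sym m" "1 \<le> i" "i < j" "j \<le> m" "pinv y i < pinv y j" "w = transpose i j \<circ> y"
      using step by (auto simp: bruhat_step_iff)
    moreover have "j \<le> n" using \<open>j \<le> m\<close> assms(1) by simp
    ultimately show ?thesis using sym_mono[OF assms(1)] unfolding bruhat_step_iff
      by (intro conjI exI[of _ i] exI[of _ j]) auto
  qed
  then have "(bruhat_step m)\<^sup>*\<^sup>* y w \<Longrightarrow> (bruhat_step n)\<^sup>*\<^sup>* y w"    for y w using rtranclp_mono[of "bruhat_step m" "bruhat_step n"] by blast
  then show ?thesis using assms sym_mono[OF assms(1)] by (auto simp: bruhat_le_def)
qed

text \<open>The element of \<open>S_m\<close> satisfies the characterisation in \<open>S_n\<close>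
  as well: bar, support and Bruhat order are compatible, and \<open>ell\<close> is the same.\<close>

lemma KL_mono:
  assumes "m \<le> n" "w \<in> sym m"
  shows "KL n w = KL m w"
proof (rule KL_eqI)
  show "is_C n w (KL m w)"
    using is_C_KL[OF assms(2)] beta_mono[OF assms(1)] Fn_mono[OF assms(1)] bruhat_le_mono[OF assms(1)]
    unfolding is_C_def by auto
qed

text \<open>At an element of maximal length among those with nonzero coefficient only its own
  \<open>C\<close> contributes, with coefficient \<open>1\<close>.\<close>

lemma KL_independent:
  assumes "B \<subseteq> sym n" "(\<Sum>w\<in>B. scl (d w) (KL n w)) = 0" "w \<in> B"
  shows "d w = 0"
proof (rule ccontr)
  assume nz: "d w \<noteq> 0"
  define S where "S = {w \<in> B. d w \<noteq> 0}"
  have fin: "finite B" using finite_subset[OF assms(1) finite_sym] .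
  then have "finite S" by (simp add: S_def)
  note fin = fin this
  have "S \<noteq> {}" using nz assms(3) by (auto simp: S_def)
  then have "Max (ell ` S) \<in> ell ` S" using fin by (intro Max_in) auto
  then obtain v where v: "v \<in> S" "ell v = Max (ell ` S)" by auto
  have max: "ell u \<le> ell v" if "u \<in> S" for u using that fin v by simp
  have "0 = (\<Sum>u\<in>B. d u * KL n u v)" using assms(2) by (metis (no_types, lifting) scl_apply sum.cong sum_fun_apply zero_fun_apply)
  also have "\<dots> = (\<Sum>u\<in>B. if u = v then d v else 0)"
  proof (intro sum.cong refl)
    fix u assume u: "u \<in> B"
    then have us: "u \<in> sym n" using assms(1) by auto
    show "d u * KL n u v = (if u = v then d v else 0)"
    proof (cases "u = v")
      case True
      then show ?thesis using KL_D(3)[OF us] by simp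
    next
      case False
      then have "d u = 0 \<or> KL n u v = 0"
        using KL_D(6)[OF us, of v] max[of u] u by (fastforce simp: S_def)
      then show ?thesis using False by auto
    qed
  qed
  also have "\<dots> = d v" using v fin by (auto simp: S_def)
  finally show False using v by (simp add: S_def)
qed

text \<open>All correction terms in the recursion for \<open>C\<close> vanish here.\<close>

lemma KL_product_step:
  assumes "w \<in> sym n" "k \<in> {1..<n}" "\<And>y. KL n w y \<noteq> 0 \<Longrightarrow> \<not> desc k y"
  shows "KL n (simple_refl k \<circ> w) = Lop k (KL n w) - scl qv (KL n w)"
proof -
  have "\<not> desc k w" using assms(3)[of w] KL_D(3)[OF assms(1)] by simp
  moreover have "mu_set n k (KL n w) = {}" using assms(3) by (auto simp: mu_set_def) (metis lookup_zero)
  ultimately show ?thesis using KL_asc[OF assms(1,2)] by (simp add: kl_step_def)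
qed

section \<open>The left preorder\<close>

text \<open>One step of the cell preorder, read off from coefficients of \<open>q\<close>;
  \<open>kl_le_iff\<close> identifies its closure with \<open>kl_le\<close>.\<close>

definition left_edge :: "nat \<Rightarrow> (nat \<Rightarrow> nat) \<Rightarrow> (nat \<Rightarrow> nat) \<Rightarrow> bool"
  where "left_edge n y w \<longleftrightarrow> y \<in> sym n \<and> w \<in> sym n \<and> (lk (KL n w y) 1 \<noteq> 0 \<or> lk (KL n y w) 1 \<noteq> 0) \<and>
    (\<exists>i\<in>{1..<n}. desc i y \<and> \<not> desc i w)"

abbreviation left_le :: "nat \<Rightarrow> (nat \<Rightarrow> nat) \<Rightarrow> (nat \<Rightarrow> nat) \<Rightarrow> bool"
  where "left_le n \<equiv> (left_edge n)\<^sup>*\<^sup>*"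

text \<open>Comparison of the coefficients at \<open>s_i w\<close> in
  \<open>T_i C_y = - q^-1 C_y\<close>. For the polynomials this is the familiar equality of those at
  \<open>w\<close> and at \<open>s_i w\<close>.\<close>

lemma KL_desc_coeff:
  assumes "y \<in> sym n" "w \<in> sym n" "i \<in> {1..<n}" "desc i y" "\<not> desc i w"
  shows "KL n y w = - (qv * KL n y (simple_refl i \<circ> w))"
proof -
  have d: "desc i (simple_refl i \<circ> w)" using assms desc_simple_refl_comp sym_bij by blast
  have "Lop i (KL n y) (simple_refl i \<circ> w) = - qv_inv * KL n y (simple_refl i \<circ> w)"
    unfolding Lop_KL_desc[OF assms(1,3,4)] by simp
  then have "KL n y w + zeta * KL n y (simple_refl i \<circ> w) = - qv_inv * KL n y (simple_refl i \<circ> w)"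
    unfolding Lop_def simple_refl_comp_invol using d by simp
  then have "KL n y w + qv * KL n y (simple_refl i \<circ> w) = 0" by (simp add: zeta_def algebra_simps)
  then show ?thesis by (simp add: eq_neg_iff_add_eq_0)
qed

text \<open>The coefficient of \<open>C\<close> at \<open>s_i w\<close> in position \<open>w\<close>
  is \<open>- q\<close>, obtained from the leading coefficient \<open>1\<close>.\<close>

lemma left_edge_asc:
  assumes "w \<in> sym n" "i \<in> {1..<n}" "\<not> desc i w"
  shows "left_edge n (simple_refl i \<circ> w) w"
proof -
  let ?y = "simple_refl i \<circ> w"
  have y: "?y \<in> sym n" "desc i ?y"
    using assms desc_simple_refl_comp sym_bij by auto
  have "KL n ?y w = - qv"
    using KL_desc_coeff[OF y(1) assms(1,2) y(2) assms(3)] KL_D(3)[OF y(1)] by simp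
  then have "lk (KL n ?y w) 1 \<noteq> 0" by (simp add: qv_def)
  then show ?thesis using assms y by (auto simp: left_edge_def)
qed

lemma left_edge_mu_set:
  assumes "w \<in> sym n" "i \<in> {1..<n}" "\<not> desc i w" "y \<in> mu_set n i (KL n w)"
  shows "left_edge n y w"
  using assms by (auto simp: left_edge_def mu_set_def)

text \<open>An edge pointing the other way contributes little: by \<open>KL_desc_coeff\<close> the
  coefficient of \<open>q\<close> at \<open>w\<close> in \<open>C_y\<close> is minus the constant
  term at \<open>s_i w\<close>, which is nonzero only for \<open>y = s_i w\<close>. So the edges
  into \<open>w\<close> are exactly the terms of the products \<open>T_i C_w\<close> other than
  \<open>C_w\<close>.\<close>

lemma left_edgeE:
  assumes "left_edge n y w"
  obtains i where "i \<in> {1..<n}" "\<not> desc i w" "y = simple_refl i \<circ> w \<or> y \<in> mu_set n i (KL n w)"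
proof -
  obtain i where i: "y \<in> sym n" "w \<in> sym n" "i \<in> {1..<n}" "desc i y" "\<not> desc i w"
      "lk (KL n w y) 1 \<noteq> 0 \<or> lk (KL n y w) 1 \<noteq> 0"
    using assms by (auto simp: left_edge_def)
  have "y = simple_refl i \<circ> w \<or> y \<in> mu_set n i (KL n w)"
  proof (cases "lk (KL n w y) 1 = 0")
    case True
    then have "lk (KL n y w) 1 \<noteq> 0" using i by simp
    then have "lk (KL n y (simple_refl i \<circ> w)) 0 \<noteq> 0" unfolding KL_desc_coeff[OF i(1-5)] by simp
    then have "simple_refl i \<circ> w = y" using KL_D(8)[OF i(1)] by blast
    then show ?thesis by simp
  qed (use i in \<open>simp add: mu_set_def\<close>)
  then show thesis using that i by blast
qed

lemma left_le_sym: "left_le n y w \<Longrightarrow> w \<in> sym n \<Longrightarrow> y \<in> sym n"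
  by (induction rule: converse_rtranclp_induct) (auto simp: left_edge_def)


subsection \<open>Lattices\<close>

text \<open>\<open>K\<close> is a bare set of scalars: besides \<open>UNIV\<close> it will be
  \<open>qpos\<close>, \<open>qnonneg\<close> or \<open>mild\<close>, and \<open>mild\<close> is not
  even closed under products.\<close>

inductive_set lat :: "laurent set \<Rightarrow> hfun set \<Rightarrow> hfun set" for K B
  where lat_zero: "0 \<in> lat K B"
  | lat_add_scl: "z \<in> lat K B \<Longrightarrow> a \<in> K \<Longrightarrow> b \<in> B \<Longrightarrow> z + scl a b \<in> lat K B"

lemma lat_least:
  assumes "z \<in> lat K B" "0 \<in> S" "\<And>x y. x \<in> S \<Longrightarrow> y \<in> S \<Longrightarrow> x + y \<in> S"
    "\<And>a b. a \<in> K \<Longrightarrow> b \<in> B \<Longrightarrow> scl a b \<in> S"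
  shows "z \<in> S"
  using assms(1) by induction (use assms(2-) in blast)+

lemma lat_base: "a \<in> K \<Longrightarrow> b \<in> B \<Longrightarrow> scl a b \<in> lat K B"
  using lat_add_scl[OF lat_zero] by (metis add_0)

lemma lat_add:
  assumes "y \<in> lat K B" "x \<in> lat K B"
  shows "x + y \<in> lat K B"
  using assms(1)
proof induction
  case lat_zero
  show ?case using assms(2) by (simp only: add_0_right)
next
  case (lat_add_scl z a b)
  then show ?case unfolding add.assoc[symmetric] by (intro lat.lat_add_scl)
qed

lemma lat_subset:
  assumes "z \<in> lat K B" "\<And>a b. a \<in> K \<Longrightarrow> b \<in> B \<Longrightarrow> scl a b \<in> lat K' B'"
  shows "z \<in> lat K' B'"
  by (rule lat_least[OF assms(1)]) (use assms(2) lat.lat_zero lat_add in auto)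

lemma lat_mono: "z \<in> lat K B \<Longrightarrow> K \<subseteq> K' \<Longrightarrow> B \<subseteq> B' \<Longrightarrow> z \<in> lat K' B'"
  by (erule lat_subset) (auto intro: lat_base)

lemma lat_scl:
  assumes "z \<in> lat K B" "\<And>a. a \<in> K \<Longrightarrow> c * a \<in> K'"
  shows "scl c z \<in> lat K' B"
proof -
  have "z \<in> {z. scl c z \<in> lat K' B}"
    by (rule lat_least[OF assms(1)]) (use assms(2) in \<open>auto simp: scl_simps intro: lat.lat_zero lat_add lat_base\<close>)
  then show ?thesis by simp
qed

lemma lat_sum: "(\<And>a. a \<in> A \<Longrightarrow> f a \<in> lat K B) \<Longrightarrow> sum f A \<in> lat K B"
  by (induction A rule: infinite_finite_induct)
    (simp_all only: sum.infinite sum.empty sum.insert lat.lat_zero lat_add insertI1 insertI2 simp_thms)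

lemma lat_UNIV_diff: "x \<in> lat UNIV B \<Longrightarrow> y \<in> lat UNIV B \<Longrightarrow> x - y \<in> lat UNIV B"
  using lat_add[OF lat_scl[of y UNIV B "- 1" UNIV], of x] by (simp add: scl_simps)

lemma lat_Lop:
  assumes "z \<in> lat UNIV B" "\<And>b. b \<in> B \<Longrightarrow> Lop i b \<in> lat UNIV B"
  shows "Lop i z \<in> lat UNIV B"
proof -
  have "z \<in> {z. Lop i z \<in> lat UNIV B}"
    by (rule lat_least[OF assms(1)])
      (use assms(2) in \<open>auto simp: Lop_add Lop_scl intro: lat.lat_zero lat_add lat_scl\<close>)
  then show ?thesis by simp
qed

lemma lat_KL_expand:
  assumes "z \<in> lat UNIV (KL n ` B)" "B \<subseteq> sym n"
  shows "\<exists>e. z = (\<Sum>u\<in>sym n. scl (e u) (KL n u)) \<and> (\<forall>u. u \<notin> B \<longrightarrow> e u = 0)"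
  using assms(1)
proof induction
  case lat_zero
  have "0 = (\<Sum>u\<in>sym n. scl 0 (KL n u))" by (simp only: scl_trivial sum.neutral_const)
  then show ?case by (intro exI[of _ "\<lambda>u. 0"]) blast
next
  case (lat_add_scl z a b)
  then obtain e u where e: "z = (\<Sum>u\<in>sym n. scl (e u) (KL n u))" "\<forall>u. u \<notin> B \<longrightarrow> e u = 0"
    and u: "b = KL n u" "u \<in> B" by blast
  define e' where "e' = (\<lambda>v. e v + (if v = u then a else 0))"
  have "(\<Sum>v\<in>sym n. scl (if v = u then a else 0) (KL n v)) = (\<Sum>v\<in>sym n. if u = v then scl a (KL n u) else 0)"
    by (intro sum.cong) auto
  also have "\<dots> = scl a (KL n u)" using u assms(2) by auto
  finally have "(\<Sum>v\<in>sym n. scl (e' v) (KL n v)) = z + scl a b"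
    unfolding e'_def scl_simps(3) sum.distrib e(1) u(1) by simp
  moreover have "\<forall>v. v \<notin> B \<longrightarrow> e' v = 0" using e(2) u(2) by (auto simp: e'_def)
  ultimately show ?case by (intro exI[of _ e'] conjI) (simp_all only:)
qed

text \<open>By linear independence the explicit expansion of \<open>T_i C_w\<close> agrees with the
  one supported on \<open>B\<close>, so every term with nonzero coefficient has its index in
  \<open>B\<close>.\<close>

lemma Lop_KL_coeffs:
  assumes "Lop i (KL n w) \<in> lat UNIV (KL n ` B)" "B \<subseteq> sym n" "w \<in> sym n" "i \<in> {1..<n}" "\<not> desc i w"
    and "y = simple_refl i \<circ> w \<or> y \<in> mu_set n i (KL n w)"
  shows "y \<in> B"
proof -
  let ?sw = "simple_refl i \<circ> w" and ?M = "mu_set n i (KL n w)"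
  obtain e where e: "Lop i (KL n w) = (\<Sum>u\<in>sym n. scl (e u) (KL n u))" "\<forall>u. u \<notin> B \<longrightarrow> e u = 0"
    using lat_KL_expand[OF assms(1,2)] by blast
  define d where "d u = (if u = w then qv else 0) + (if u = ?sw then 1 else 0) -
    (if u \<in> ?M then of_int (lk (KL n w u) 1) else 0)" for u
  have sw: "?sw \<in> sym n" using assms(3,4) by simp
  have d: "(\<Sum>u\<in>sym n. scl (d u) (KL n u)) = Lop i (KL n w)"
  proof -
    have delta: "(\<Sum>u\<in>sym n. scl (if u = v then a else 0) (KL n u)) = scl a (KL n v)"
      if "v \<in> sym n" for a v
    proof -
      have "(\<Sum>u\<in>sym n. scl (if u = v then a else 0) (KL n u)) = (\<Sum>u\<in>sym n. if v = u then scl a (KL n v) else 0)"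
        by (intro sum.cong) auto
      then show ?thesis using that by simp
    qed
    have "(\<Sum>u\<in>sym n. scl (if u \<in> ?M then of_int (lk (KL n w u) 1) else 0) (KL n u)) =
        (\<Sum>u\<in>?M. scl (of_int (lk (KL n w u) 1)) (KL n u))"
    proof (rule sum.mono_neutral_cong_right)
      show "?M \<subseteq> sym n" by (auto simp: mu_set_def)
    qed auto
    then show ?thesis
      unfolding d_def scl_simps(3,4) sum.distrib sum_subtractf delta[OF assms(3)] delta[OF sw]
      using Lop_KL_asc[OF assms(3-5)] by simp
  qed
  have "(\<Sum>u\<in>sym n. scl (d u - e u) (KL n u)) = 0"
    unfolding scl_simps sum_subtractf d e(1)[symmetric] by simp
  moreover have y: "y \<in> sym n" using assms(6) sw by (auto simp: mu_set_def)
  ultimately have "d y - e y = 0" using KL_independent[of "sym n" n "\<lambda>u. d u - e u" y] by simp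
  moreover have "d y \<noteq> 0"
  \<comment> \<open>The three kinds of terms cannot cancel: \<open>s_i w\<close> is longer than
    \<open>w\<close>, and the elements of \<open>?M\<close> are shorter.\<close>
  proof (cases "y = ?sw")
    case True
    have "ell w < ell ?sw" using ell_asc assms by simp
    moreover have "ell u < ell w" if "u \<in> ?M" for u
      using that lk_kl_nonzero_parity(3)[OF is_C_KL[OF assms(3)]] by (auto simp: mu_set_def)
    ultimately have "?sw \<notin> ?M" "?sw \<noteq> w" by fastforce+
    then show ?thesis by (simp add: d_def True)
  next
    case False
    then have "y \<in> ?M" using assms(6) by simp
    moreover have "y \<noteq> w" using assms(5) \<open>y \<in> ?M\<close> by (auto simp: mu_set_def)
    ultimately show ?thesis using False by (simp add: d_def mu_set_def)
  qed
  ultimately show "y \<in> B" using e(2) by auto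
qed

lemma qpos_mult_qnonneg:
  assumes "a \<in> qpos" "b \<in> qnonneg"
  shows "a * b \<in> qpos"
proof -
  have "1 \<le> k" if "k \<in> Poly_Mapping.keys (a * b)" for k
  proof -
    obtain i j where "i \<in> Poly_Mapping.keys a" "j \<in> Poly_Mapping.keys b" "k = i + j"
      using keys_mult[of a b] \<open>k \<in> Poly_Mapping.keys (a * b)\<close> by blast
    moreover have "1 \<le> i" "0 \<le> j"
      using assms calculation by (auto simp: qpos_def qnonneg_def in_keys_iff)
    ultimately show ?thesis by simp
  qed
  then show ?thesis by (simp add: qpos_def in_keys_iff)
qed


subsection \<open>Left ideals induced from a parabolic subgroup\<close>

text \<open>For a minimal left coset representative \<open>x\<close> of \<open>S\<^sub>m\<close> in \<open>S\<^sub>n\<close> the translate by \<open>x\<close> represents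
  multiplication by \<open>T\<^sub>x\<close> from the left.\<close>

definition translate :: "(nat \<Rightarrow> nat) \<Rightarrow> hfun \<Rightarrow> hfun"
  where "translate x f = (\<lambda>w. f (pinv x \<circ> w))"

text \<open>Increasing on the block \<open>{1..m}\<close> means having no inversion inside it, that
  is, being the shortest element of the coset \<open>x S_m\<close>.\<close>

definition min_reps :: "nat \<Rightarrow> nat \<Rightarrow> (nat \<Rightarrow> nat) set"
  where "min_reps m n = {x \<in> sym n. \<forall>a b. 1 \<le> a \<and> a < b \<and> b \<le> m \<longrightarrow> x a < x b}"

lemma translate_simps:
  "translate x (f + g) = translate x f + translate x g"
  "translate x (f - g) = translate x f - translate x g"
  "translate x (scl a f) = scl a (translate x f)"
  "translate x (- f) = - translate x f"
  by (auto simp: translate_def fun_eq_iff)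

lemma translate_sum: "translate x (sum f A) = (\<Sum>a\<in>A. translate x (f a))"
  by (simp add: translate_def fun_eq_iff sum_fun_apply)

lemma pinv_simps: "bij x \<Longrightarrow> pinv x (x a) = a" "bij x \<Longrightarrow> x (pinv x a) = a"
  by (simp_all add: bij_is_inj bij_is_surj inv_f_f surj_f_inv_f)

lemma comp_pinv_comp: "bij x \<Longrightarrow> x \<circ> (pinv x \<circ> w) = w" "bij x \<Longrightarrow> pinv x \<circ> (x \<circ> w) = w"
  by (simp_all add: fun_eq_iff pinv_simps)

lemma pinv_comp_eq_iff:
  fixes x :: "'a \<Rightarrow> 'a"
  assumes "bij x"
  shows "pinv x \<circ> w = v \<longleftrightarrow> w = x \<circ> v"
proof
  assume "pinv x \<circ> w = v"
  then have "x \<circ> (pinv x \<circ> w) = x \<circ> v" by (rule arg_cong)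
  then show "w = x \<circ> v" by (simp only: comp_pinv_comp[OF assms])
next
  assume "w = x \<circ> v"
  then show "pinv x \<circ> w = v" by (simp only: comp_pinv_comp[OF assms])
qed

lemma translate_id: "translate id f = f"
  by (simp add: translate_def)

lemma translate_support:
  assumes "x \<in> sym n" "f \<in> Fn m" "f (pinv x \<circ> w) \<noteq> 0"
  obtains u where "u \<in> sym m" "u = pinv x \<circ> w" "\<And>k. pinv w k = pinv u (pinv x k)" "bij u"
proof -
  define u where "u = pinv x \<circ> w"
  have u: "u \<in> sym m" using assms FnD by (auto simp: u_def)
  have x: "bij x" using assms sym_bij by blast
  have "w = x \<circ> u" unfolding u_def comp_pinv_comp(1)[OF x] ..
  then have "pinv w = pinv u \<circ> pinv x" using x u sym_bij by (simp add: o_inv_distrib)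
  then show thesis using that u u_def sym_bij by simp
qed

text \<open>A position strictly between those of \<open>i\<close> and \<open>i + 1\<close> would lie
  in the block and carry a value strictly between them.\<close>

lemma min_reps_adjacent:
  assumes "x \<in> min_reps m n" "pinv x i \<in> {1..m}" "pinv x (Suc i) \<in> {1..m}"
  shows "pinv x (Suc i) = Suc (pinv x i)"
proof -
  let ?j = "pinv x i" and ?k = "pinv x (Suc i)"
  have x: "bij x" and inc: "\<And>a b. 1 \<le> a \<Longrightarrow> a < b \<Longrightarrow> b \<le> m \<Longrightarrow> x a < x b"
    using assms(1) sym_bij by (auto simp: min_reps_def)
  have xj: "x ?j = i" and xk: "x ?k = Suc i" using pinv_simps(2)[OF x] by auto
  have "\<not> ?k \<le> ?j"
  proof
    assume "?k \<le> ?j"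
    then have "?k < ?j \<or> ?k = ?j" by auto
    then show False using inc[of ?k ?j] assms(2,3) xj xk by auto
  qed
  moreover have "\<not> Suc ?j < ?k"
  proof
    assume "Suc ?j < ?k"
    then show False using inc[of ?j "Suc ?j"] inc[of "Suc ?j" ?k] assms(2,3) xj xk by auto
  qed
  ultimately show ?thesis by simp
qed

text \<open>With \<open>j\<close> the position of \<open>i\<close> in \<open>x\<close> one has
  \<open>s_i x = x s_j\<close>, hence \<open>T_i T_x = T_x T_j\<close>. This is one half of
  Deodhar's dichotomy for minimal coset representatives.\<close>

lemma Lop_translate_inner:
  assumes "x \<in> min_reps m n" "f \<in> Fn m" "pinv x i \<in> {1..m}" "pinv x (Suc i) \<in> {1..m}"
  shows "pinv x i \<in> {1..<m}" "Lop i (translate x f) = translate x (Lop (pinv x i) f)"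
proof -
  let ?j = "pinv x i"
  have xs: "x \<in> sym n" and x: "bij x" using assms(1) sym_bij by (auto simp: min_reps_def)
  note adj = min_reps_adjacent[OF assms(1,3,4)]
  show "?j \<in> {1..<m}" using adj assms(3,4) by auto
  have comm: "pinv x \<circ> (simple_refl i \<circ> w) = simple_refl ?j \<circ> (pinv x \<circ> w)" for w
  proof
    fix a
    have "pinv x (simple_refl i b) = simple_refl ?j (pinv x b)" for b
    proof -
      consider "b = i" | "b = Suc i" | "b \<noteq> i" "b \<noteq> Suc i" by blast
      then show ?thesis
      proof cases
        case 3
        then have "pinv x b \<noteq> ?j" "pinv x b \<noteq> Suc ?j" using inv_eq_bij[OF x] adj by metis+
        then show ?thesis using 3 by (simp add: simple_refl_def)
      qed (use adj in simp_all)
    qed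
    then show "(pinv x \<circ> (simple_refl i \<circ> w)) a = (simple_refl ?j \<circ> (pinv x \<circ> w)) a" by simp
  qed
  have desc: "desc i w \<longleftrightarrow> desc ?j (pinv x \<circ> w)" if nz: "f (pinv x \<circ> w) \<noteq> 0" for w
  proof -
    obtain u where u: "u \<in> sym m" "u = pinv x \<circ> w" "\<And>k. pinv w k = pinv u (pinv x k)" "bij u"
      using translate_support[OF xs assms(2) nz] by blast
    show ?thesis unfolding desc_def u(2)[symmetric] u(3) adj ..
  qed
  show "Lop i (translate x f) = translate x (Lop ?j f)"
  proof
    fix w show "Lop i (translate x f) w = translate x (Lop ?j f) w"
      using desc[of w] by (cases "f (pinv x \<circ> w) = 0") (simp_all add: Lop_def translate_def comm)
  qed
qed

text \<open>The other half of the dichotomy: \<open>s_i x\<close> is again a minimal representative,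
  and \<open>T_i\<close> multiplies \<open>T_x\<close> as it multiplies a basis element of the whole
  algebra.\<close>

lemma Lop_translate_outer:
  assumes "x \<in> min_reps m n" "f \<in> Fn m" "i \<in> {1..<n}"
    "\<not> (pinv x i \<in> {1..m} \<and> pinv x (Suc i) \<in> {1..m})"
  shows "simple_refl i \<circ> x \<in> min_reps m n"
    "Lop i (translate x f) =
      translate (simple_refl i \<circ> x) f + (if desc i x then scl zeta (translate x f) else 0)"
proof -
  have xs: "x \<in> sym n" and x: "bij x" and inc: "\<And>a b. 1 \<le> a \<Longrightarrow> a < b \<Longrightarrow> b \<le> m \<Longrightarrow> x a < x b"
    using assms(1) sym_bij by (auto simp: min_reps_def)
  show "simple_refl i \<circ> x \<in> min_reps m n"
    unfolding min_reps_def
  proof safe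
    show "simple_refl i \<circ> x \<in> sym n" using xs assms(3) by (simp only: simple_refl_comp_sym)
    fix a b assume ab: "1 \<le> a" "a < b" "b \<le> m"
    then have l: "x a < x b" by (rule inc)
    have "\<not> (x b = Suc i \<and> x a = i)"
    proof
      assume "x b = Suc i \<and> x a = i"
      then have "pinv x (Suc i) = b" "pinv x i = a" using pinv_simps(1)[OF x] by metis+
      then show False using assms(4) ab by auto
    qed
    then show "(simple_refl i \<circ> x) a < (simple_refl i \<circ> x) b"
      using simple_refl_less_iff[of "x b" "x a" i] l by auto
  qed
  have comm: "pinv (simple_refl i \<circ> x) \<circ> w = pinv x \<circ> (simple_refl i \<circ> w)" for w
    using inv_simple_refl_comp[OF x] by (simp add: comp_assoc)
  let ?a = "pinv x i" and ?b = "pinv x (Suc i)"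
  have "pinv x permutes {1..n}" using xs by (simp add: sym_def permutes_inv)
  then have rng: "1 \<le> ?a" "1 \<le> ?b"
    using permutes_in_image[of "pinv x" "{1..n}" i] permutes_in_image[of "pinv x" "{1..n}" "Suc i"] assms(3) by auto
  have desc: "desc i w \<longleftrightarrow> desc i x" if nz: "f (pinv x \<circ> w) \<noteq> 0" for w
  proof -
    obtain u where u: "u \<in> sym m" "u = pinv x \<circ> w" "\<And>k. pinv w k = pinv u (pinv x k)" "bij u"
      using translate_support[OF xs assms(2) nz] by blast
    have pu: "pinv u permutes {1..m}" using u(1) by (simp add: sym_def permutes_inv)
    have in_iff: "pinv u c \<in> {1..m} \<longleftrightarrow> c \<in> {1..m}" for c using permutes_in_image[OF pu] .
    have out: "pinv u c = c" if "c \<notin> {1..m}" for c using permutes_not_in[OF pu that] .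
    \<comment> \<open>At most one of the two positions lies in the block, and \<open>u\<close> maps
      the block to itself and fixes everything beyond it, so it cannot change their order.\<close>
    have "pinv u ?b < pinv u ?a \<longleftrightarrow> ?b < ?a"
    proof (cases "?a \<in> {1..m}")
      case True
      then have "?b \<notin> {1..m}" using assms(4) by blast
      then show ?thesis using True in_iff[of ?a] out[of ?b] rng by auto
    next
      case False
      then show ?thesis
        using in_iff[of ?b] out[of ?a] out[of ?b] rng by (cases "?b \<in> {1..m}") auto
    qed
    then show ?thesis by (simp add: desc_def u(3))
  qed
  show "Lop i (translate x f) =
      translate (simple_refl i \<circ> x) f + (if desc i x then scl zeta (translate x f) else 0)"
  proof
    fix w show "Lop i (translate x f) w =
      (translate (simple_refl i \<circ> x) f + (if desc i x then scl zeta (translate x f) else 0)) w"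
      using desc[of w] by (cases "f (pinv x \<circ> w) = 0") (simp_all add: Lop_def translate_def comm)
  qed
qed

text \<open>\<open>Y_closed\<close> is the combinatorial form of the span of the \<open>C_v\<close>
  being a left ideal: the terms of \<open>T_i C_v\<close> other than \<open>C_v\<close> are those
  with an edge to \<open>v\<close>.\<close>

locale parabolic_ideal =
  fixes m n :: nat and Y :: "(nat \<Rightarrow> nat) set"
  assumes mn: "m \<le> n" and Y: "Y \<subseteq> sym m"
    and Y_closed: "\<And>v y. v \<in> Y \<Longrightarrow> left_edge m y v \<Longrightarrow> y \<in> Y"
begin

text \<open>The bound \<open>k\<close> filters the products \<open>T_x C_v\<close> by the length of
  \<open>x\<close>; multiplication by \<open>T_i\<close> moves up by at most one step.\<close>

definition induced :: "nat \<Rightarrow> hfun set"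
  where "induced k = {translate x (KL m v) | x v. x \<in> min_reps m n \<and> v \<in> Y \<and> ell x < k}"

lemma induced_mono: "k \<le> l \<Longrightarrow> induced k \<subseteq> induced l"
  by (force simp: induced_def)

lemma induced_I: "x \<in> min_reps m n \<Longrightarrow> v \<in> Y \<Longrightarrow> ell x < k \<Longrightarrow> translate x (KL m v) \<in> induced k"
  by (auto simp: induced_def)

lemma comp_sym_n: "x \<in> min_reps m n \<Longrightarrow> v \<in> Y \<Longrightarrow> x \<circ> v \<in> sym n"
  using Y sym_mono[OF mn] sym_comp by (auto simp: min_reps_def)

lemma translate_KL_coeff:
  assumes "x \<in> min_reps m n" "v \<in> Y"
  shows "translate x (KL m v) (x \<circ> v) = 1" "w \<noteq> x \<circ> v \<Longrightarrow> translate x (KL m v) w \<in> qpos"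
proof -
  have x: "bij x" using assms(1) sym_bij by (auto simp: min_reps_def)
  have v: "v \<in> sym m" using assms Y by auto
  have "pinv x \<circ> (x \<circ> v) = v" using pinv_comp_eq_iff[OF x] by blast
  then show "translate x (KL m v) (x \<circ> v) = 1" using KL_D(3)[OF v] by (simp add: translate_def)
  assume "w \<noteq> x \<circ> v"
  then have "pinv x \<circ> w \<noteq> v" using pinv_comp_eq_iff[OF x] by blast
  then show "translate x (KL m v) w \<in> qpos" using KL_D(9)[OF v] by (simp add: translate_def)
qed

lemma lat_qpos_induced_coeff:
  assumes "z \<in> lat qpos (induced k)"
  shows "z w \<in> qpos"
proof -
  have "z \<in> {z. z w \<in> qpos}"
  proof (rule lat_least[OF assms])
    fix a b assume a: "a \<in> qpos" and "b \<in> induced k"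
    then obtain x v where b: "b = translate x (KL m v)" "x \<in> min_reps m n" "v \<in> Y" by (auto simp: induced_def)
    have "b w \<in> qnonneg" unfolding b(1)
      using translate_KL_coeff(1)[OF b(2,3)] translate_KL_coeff(2)[OF b(2,3), of w] qpos_subset_qnonneg
      by (cases "w = x \<circ> v") auto
    then show "scl a b \<in> {z. z w \<in> qpos}" using qpos_mult_qnonneg[OF a] by simp
  qed (auto intro: qpos_add)
  then show ?thesis by simp
qed

text \<open>Multiplication by these coefficients lowers the \<open>q\<close>-order by at most one.\<close>

definition mild :: "laurent set"
  where "mild = {c. \<forall>a\<in>qpos. a * c \<in> qnonneg}"

lemma mild_I: "c \<in> qnonneg \<Longrightarrow> c \<in> mild"
  using qpos_mult_qnonneg qpos_subset_qnonneg by (auto simp: mild_def)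

lemma mild_uminus: "c \<in> mild \<Longrightarrow> - c \<in> mild"
  unfolding mild_def
proof safe
  fix a assume "\<forall>a\<in>qpos. a * c \<in> qnonneg" "a \<in> qpos"
  then have "- a * c \<in> qnonneg" using qpos_minus by blast
  then show "a * - c \<in> qnonneg" by simp
qed

lemma of_int_mild: "of_int c \<in> mild"
  by (intro mild_I) (auto simp: qnonneg_def lookup_of_int when_def)

lemma qv_mild: "qv \<in> mild"
  by (intro mild_I) (auto simp: qnonneg_def qv_def lookup_single when_def)

lemma qv_inv_mild: "qv_inv \<in> mild"
  by (auto simp: mild_def mult.commute[of _ qv_inv] intro: qv_inv_mult_qpos)

lemma mild_add: "c \<in> mild \<Longrightarrow> d \<in> mild \<Longrightarrow> c + d \<in> mild"
  by (auto simp: mild_def distrib_left intro: qnonneg_add)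

text \<open>In all cases the coefficients are integers, \<open>- q\<close>, \<open>- q^-1\<close> or
  \<open>- (q + q^-1)\<close>, hence mild. Therefore \<open>T_i - q\<close> takes combinations with
  coefficients in \<open>q Z[q]\<close> to combinations with coefficients in
  \<open>Z[q]\<close>.\<close>

lemma Lop_induced:
  assumes "b \<in> induced k" "i \<in> {1..<n}"
  shows "Lop i b - scl qv b \<in> lat mild (induced (Suc k))"
proof -
  obtain x v where b: "b = translate x (KL m v)" "x \<in> min_reps m n" "v \<in> Y" "ell x < k"
    using assms(1) by (auto simp: induced_def)
  have v: "v \<in> sym m" using b Y by auto
  have f: "KL m v \<in> Fn m" using KL_D(1)[OF v] .
  have xs: "x \<in> sym n" using b(2) by (simp add: min_reps_def)
  have base: "scl c (translate x (KL m y)) \<in> lat mild (induced (Suc k))" if "c \<in> mild" "y \<in> Y" for c y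
    using that b by (intro lat_base induced_I) auto
  show ?thesis
  proof (cases "pinv x i \<in> {1..m} \<and> pinv x (Suc i) \<in> {1..m}")
    case True
    let ?j = "pinv x i"
    have j: "?j \<in> {1..<m}" and eq: "Lop i (translate x (KL m v)) = translate x (Lop ?j (KL m v))"
      using Lop_translate_inner[OF b(2) f] True by auto
    show ?thesis
    proof (cases "desc ?j v")
      case True
      have "Lop i b - scl qv b = scl (- (qv_inv + qv)) (translate x (KL m v))"
        unfolding b(1) eq Lop_KL_desc[OF v j True] by (simp add: translate_simps scl_simps)
      then show ?thesis using base[OF mild_uminus[OF mild_add[OF qv_inv_mild qv_mild]] b(3)] by simp
    next
      case False
      let ?M = "mu_set m ?j (KL m v)"
      have "Lop i b - scl qv b = scl (of_int 1) (translate x (KL m (simple_refl ?j \<circ> v))) +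
          (\<Sum>y\<in>?M. scl (of_int (- lk (KL m v y) 1)) (translate x (KL m y)))"
        unfolding b(1) eq Lop_KL_asc[OF v j False]
        by (simp add: translate_simps translate_sum scl_simps sum_negf)
      moreover have "scl (of_int 1) (translate x (KL m (simple_refl ?j \<circ> v))) \<in> lat mild (induced (Suc k))"
        by (intro base of_int_mild Y_closed[OF b(3)] left_edge_asc v j False)
      moreover have "(\<Sum>y\<in>?M. scl (of_int (- lk (KL m v y) 1)) (translate x (KL m y))) \<in> lat mild (induced (Suc k))"
        by (intro lat_sum base of_int_mild Y_closed[OF b(3)] left_edge_mu_set[OF v j False])
      ultimately show ?thesis by (simp only: lat_add)
    qed
  next
    case False
    note sx = Lop_translate_outer[OF b(2) f assms(2) False]
    have "ell (simple_refl i \<circ> x) < Suc k"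
      using ell_simple_refl_le[OF xs assms(2)] b(4) by simp
    then have 1: "scl (of_int 1) (translate (simple_refl i \<circ> x) (KL m v)) \<in> lat mild (induced (Suc k))"
      by (intro lat_base of_int_mild induced_I sx(1) b(3))
    define c where "c = (if desc i x then - qv_inv else - qv)"
    have "c \<in> mild" using mild_uminus qv_mild qv_inv_mild by (auto simp: c_def)
    then have 2: "scl c (translate x (KL m v)) \<in> lat mild (induced (Suc k))" using base b(3) by blast
    have "Lop i b - scl qv b = scl (of_int 1) (translate (simple_refl i \<circ> x) (KL m v)) + scl c (translate x (KL m v))"
      unfolding b(1) sx(2) by (simp add: c_def zeta_def scl_simps)
    then show ?thesis using lat_add[OF 2 1] by simp
  qed
qed

text \<open>For each term the constant part \<open>t\<close> of its coefficient is taken up by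
  \<open>t\<close> times the bar-invariant \<open>C\<close> at \<open>x v\<close>, which differs
  from \<open>T_x C_v\<close> by terms in \<open>q Z[q]\<close>.\<close>

lemma correct_to_bar_invariant:
  assumes "z \<in> lat qnonneg (induced k)"
    and IH: "\<And>x v. x \<in> min_reps m n \<Longrightarrow> v \<in> Y \<Longrightarrow> ell x < k \<Longrightarrow>
      KL n (x \<circ> v) - translate x (KL m v) \<in> lat qpos (induced k)"
  shows "\<exists>c\<in>Fn n. beta n c = c \<and> z - c \<in> lat qpos (induced k)"
  using assms(1)
proof induction
  case lat_zero
  have "0 - 0 \<in> lat qpos (induced k)" using lat.lat_zero by simp
  then show ?case by (intro bexI[of _ 0] conjI beta_zero Fn_zero)
next
  case (lat_add_scl z a b)
  then obtain c where c: "c \<in> Fn n" "beta n c = c" "z - c \<in> lat qpos (induced k)" by blast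
  obtain x v where b: "b = translate x (KL m v)" "x \<in> min_reps m n" "v \<in> Y" "ell x < k"
    using lat_add_scl(3) by (auto simp: induced_def)
  have xv: "x \<circ> v \<in> sym n" using comp_sym_n b by blast
  define t where "t = lk a 0"
  define c' where "c' = c + scl (of_int t) (KL n (x \<circ> v))"
  have 1: "c' \<in> Fn n" unfolding c'_def by (intro Fn_add Fn_scl c(1) KL_D(1)[OF xv])
  have 2: "beta n c' = c'" unfolding c'_def beta_add beta_scl bar_of_int c(2) KL_D(2)[OF xv] ..
  have "z + scl a b - c' = (z - c) + (scl (a - of_int t) b + scl (of_int (- t)) (KL n (x \<circ> v) - b))"
    by (simp add: c'_def scl_simps)
  moreover have "scl (a - of_int t) b \<in> lat qpos (induced k)"
    using qnonneg_const_part[OF lat_add_scl(2)] lat_add_scl(3) unfolding t_def by (rule lat_base)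
  moreover have "scl (of_int (- t)) (KL n (x \<circ> v) - b) \<in> lat qpos (induced k)"
    unfolding b(1) by (rule lat_scl[OF IH[OF b(2-4)]]) (rule qpos_of_int_mult)
  ultimately have 3: "z + scl a b - c' \<in> lat qpos (induced k)" using c(3) by (metis lat_add)
  show ?case using 1 2 3 by blast
qed

text \<open>Relative Kazhdan--Lusztig basis: applying \<open>T\<^sub>s - q\<close> to \<open>C\<^sub>x\<^sub>v\<close> and subtracting bar-invariant
  elements keeps the expansion in the \<open>T\<^sub>x C\<^sub>v\<close> unitriangular modulo \<open>q\<close>, hence, as each \<open>T\<^sub>x C\<^sub>v\<close> is
  \<open>T\<^sub>x\<^sub>v\<close> modulo \<open>q\<close>, gives the next \<open>C\<close>.\<close>

lemma KL_relative:
  assumes "x \<in> min_reps m n" "v \<in> Y"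
  shows "KL n (x \<circ> v) - translate x (KL m v) \<in> lat qpos (induced (ell x))"
  using assms
proof (induction "ell x" arbitrary: x v rule: less_induct)
  case less
  have xs: "x \<in> sym n" and bx: "bij x" using less.prems sym_bij by (auto simp: min_reps_def)
  have v: "v \<in> sym m" using less.prems Y by auto
  show ?case
  proof (cases "x = id")
    case True
    have "KL n (x \<circ> v) - translate x (KL m v) = 0" using KL_mono[OF mn v] True by (simp add: translate_id)
    then show ?thesis by (simp only: lat.lat_zero)
  next
    case False
    then obtain i where i: "i \<in> {1..<n}" "desc i x" using exists_desc xs by blast
    \<comment> \<open>Inside the block the values \<open>i\<close> and \<open>i + 1\<close> would
      stand in increasing adjacent positions, contrary to the descent \<open>i\<close> of
      \<open>x\<close>.\<close>
    have not_inner: "\<not> (pinv x i \<in> {1..m} \<and> pinv x (Suc i) \<in> {1..m})"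
    proof
      assume "pinv x i \<in> {1..m} \<and> pinv x (Suc i) \<in> {1..m}"
      then have "pinv x (Suc i) = Suc (pinv x i)" using min_reps_adjacent[OF less.prems(1)] by blast
      then show False using i(2) by (simp add: desc_def)
    qed
    define x0 where "x0 = simple_refl i \<circ> x"
    have x0: "x0 \<in> min_reps m n"
      unfolding x0_def by (rule Lop_translate_outer(1)[OF less.prems(1) Fn_zero i(1) not_inner])
    have x0s: "x0 \<in> sym n" using x0 by (simp add: min_reps_def)
    have x: "x = simple_refl i \<circ> x0" by (simp add: x0_def)
    have nd: "\<not> desc i x0" unfolding x0_def using desc_simple_refl_comp[OF bx] i(2) by simp
    have ellx: "ell x = Suc (ell x0)" unfolding x by (rule ell_asc[OF x0s nd])
    have not_inner0: "\<not> (pinv x0 i \<in> {1..m} \<and> pinv x0 (Suc i) \<in> {1..m})"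
      using not_inner by (auto simp: x0_def bij_inv_simple_refl_comp_apply[OF bx])
    define r where "r = KL n (x0 \<circ> v) - translate x0 (KL m v)"
    have r: "r \<in> lat qpos (induced (ell x0))"
      unfolding r_def by (rule less.hyps) (use ellx x0 less.prems in auto)
    \<comment> \<open>The coefficients of \<open>r\<close> lie in \<open>q Z[q]\<close>, and
      \<open>T_i - q\<close> uses up at most one power of \<open>q\<close>, so those of the image
      lie in \<open>Z[q]\<close> and only constants need correcting.\<close>
    have "r \<in> {r. Lop i r - scl qv r \<in> lat qnonneg (induced (ell x))}"
    proof (rule lat_least[OF r])
      fix y z assume "y \<in> {r. Lop i r - scl qv r \<in> lat qnonneg (induced (ell x))}"
        "z \<in> {r. Lop i r - scl qv r \<in> lat qnonneg (induced (ell x))}"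
      then have "(Lop i y - scl qv y) + (Lop i z - scl qv z) \<in> lat qnonneg (induced (ell x))"
        by (simp only: lat_add mem_Collect_eq)
      then show "y + z \<in> {r. Lop i r - scl qv r \<in> lat qnonneg (induced (ell x))}"
        by (simp add: Lop_add scl_simps algebra_simps)
    next
      fix a b assume a: "a \<in> qpos" and b: "b \<in> induced (ell x0)"
      have "scl a (Lop i b - scl qv b) \<in> lat qnonneg (induced (ell x))"
        unfolding ellx by (rule lat_scl[OF Lop_induced[OF b i(1)]]) (use a in \<open>simp add: mild_def\<close>)
      then show "scl a b \<in> {r. Lop i r - scl qv r \<in> lat qnonneg (induced (ell x))}"
        by (simp add: Lop_scl scl_simps mult.commute)
    qed (simp add: lat.lat_zero)
    then have "Lop i r - scl qv r \<in> lat qnonneg (induced (ell x))" by simp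
    moreover have "KL n (x' \<circ> v') - translate x' (KL m v') \<in> lat qpos (induced (ell x))"
      if "x' \<in> min_reps m n" "v' \<in> Y" "ell x' < ell x" for x' v'
      using less.hyps[OF that(3,1,2)] induced_mono[of "ell x'" "ell x"] that(3) by (auto intro: lat_mono)
    ultimately obtain c where c: "c \<in> Fn n" "beta n c = c"
        "(Lop i r - scl qv r) - c \<in> lat qpos (induced (ell x))"
      using correct_to_bar_invariant by blast
    define y where "y = Lop i (KL n (x0 \<circ> v)) - scl qv (KL n (x0 \<circ> v)) - c"
    have x0v: "x0 \<circ> v \<in> sym n" and xv: "x \<circ> v \<in> sym n" using comp_sym_n less.prems x0 by auto
    have y_Fn: "y \<in> Fn n"
      unfolding y_def by (intro Fn_diff Fn_Lop Fn_scl c(1) KL_D(1)[OF x0v] i(1))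
    have y_bar: "beta n y = y"
      unfolding y_def beta_diff beta_Lop[OF i(1)] beta_scl c(2) KL_D(2)[OF x0v]
      by (simp add: Linv_def zeta_def scl_simps)
    have eq: "Lop i (translate x0 (KL m v)) = translate x (KL m v)"
      using Lop_translate_outer(2)[OF x0 KL_D(1)[OF v] i(1) not_inner0] nd x by simp
    have K: "KL n (x0 \<circ> v) = translate x0 (KL m v) + r" by (simp add: r_def)
    have y_eq: "y - translate x (KL m v) = (Lop i r - scl qv r - c) + scl (- qv) (translate x0 (KL m v))"
      unfolding y_def K Lop_add eq by (simp add: scl_simps algebra_simps)
    have "- qv \<in> qpos" by (auto simp: qpos_def qv_def lookup_single when_def)
    then have "scl (- qv) (translate x0 (KL m v)) \<in> lat qpos (induced (ell x))"
      using x0 less.prems ellx by (intro lat_base induced_I) auto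
    then have y_lat: "y - translate x (KL m v) \<in> lat qpos (induced (ell x))"
      unfolding y_eq using c(3) by (rule lat_add)
    \<comment> \<open>Both sides are bar-invariant and congruent to \<open>T\<close> at
      \<open>x v\<close> modulo \<open>q\<close>: the left one through \<open>T_x C_v\<close>, the
      right one by definition.\<close>
    have "y = KL n (x \<circ> v)"
    proof (rule eq_by_qpos[OF y_Fn KL_D(1)[OF xv] y_bar KL_D(2)[OF xv]])
      fix w
      have p: "y w - translate x (KL m v) w \<in> qpos" using lat_qpos_induced_coeff[OF y_lat, of w] by simp
      have q: "translate x (KL m v) w - KL n (x \<circ> v) w \<in> qpos"
        using translate_KL_coeff(1)[OF less.prems] translate_KL_coeff(2)[OF less.prems, of w] KL_D(3,9)[OF xv]
        by (cases "w = x \<circ> v") (auto intro: qpos_diff)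
      show "y w - KL n (x \<circ> v) w \<in> qpos" using qpos_add[OF p q] by simp
    qed
    then show ?thesis using y_lat by simp
  qed
qed

definition ideal_set :: "(nat \<Rightarrow> nat) set"
  where "ideal_set = {x \<circ> v | x v. x \<in> min_reps m n \<and> v \<in> Y}"

lemma ideal_set_subset: "ideal_set \<subseteq> sym n"
  using comp_sym_n by (auto simp: ideal_set_def)

text \<open>Inverts the unitriangular expansion of \<open>KL_relative\<close> by induction on the
  length of \<open>x\<close>.\<close>

lemma translate_in_KL_span:
  assumes "x \<in> min_reps m n" "v \<in> Y"
  shows "translate x (KL m v) \<in> lat UNIV (KL n ` ideal_set)"
  using assms
proof (induction "ell x" arbitrary: x v rule: less_induct)
  case less
  define r where "r = KL n (x \<circ> v) - translate x (KL m v)"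
  have "r \<in> lat qpos (induced (ell x))" unfolding r_def using KL_relative less.prems by blast
  then have r: "r \<in> lat UNIV (KL n ` ideal_set)"
  proof (rule lat_subset)
    fix a b assume "b \<in> induced (ell x)"
    then obtain x' v' where b: "b = translate x' (KL m v')" "x' \<in> min_reps m n" "v' \<in> Y" "ell x' < ell x"
      by (auto simp: induced_def)
    show "scl a b \<in> lat UNIV (KL n ` ideal_set)"
      unfolding b(1) by (rule lat_scl[OF less.hyps[OF b(4,2,3)]]) simp
  qed
  have "scl 1 (KL n (x \<circ> v)) \<in> lat UNIV (KL n ` ideal_set)"
    using less.prems by (intro lat_base) (auto simp: ideal_set_def)
  then have "scl 1 (KL n (x \<circ> v)) - r \<in> lat UNIV (KL n ` ideal_set)" using r by (rule lat_UNIV_diff)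
  then show ?case by (simp add: r_def)
qed

text \<open>The action of \<open>T_i\<close> is known on the products \<open>T_x C_v\<close>, so
  \<open>C_w\<close> is expanded in them, multiplied, and expanded back.\<close>

lemma Lop_KL_ideal:
  assumes "w \<in> ideal_set" "i \<in> {1..<n}"
  shows "Lop i (KL n w) \<in> lat UNIV (KL n ` ideal_set)"
proof -
  define B where "B = {translate x (KL m v) | x v. x \<in> min_reps m n \<and> v \<in> Y}"
  have ind: "induced k \<subseteq> B" for k by (auto simp: induced_def B_def)
  obtain x v where w: "w = x \<circ> v" "x \<in> min_reps m n" "v \<in> Y" using assms by (auto simp: ideal_set_def)
  have "KL n w - translate x (KL m v) \<in> lat UNIV B"
    unfolding w(1) by (rule lat_mono[OF KL_relative[OF w(2,3)]]) (use ind in auto)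
  moreover have "scl 1 (translate x (KL m v)) \<in> lat UNIV B" using w by (intro lat_base) (auto simp: B_def)
  ultimately have "(KL n w - translate x (KL m v)) + scl 1 (translate x (KL m v)) \<in> lat UNIV B"
    by (intro lat_add)
  then have "KL n w \<in> lat UNIV B" by simp
  then have "Lop i (KL n w) \<in> lat UNIV B"
  proof (rule lat_Lop)
    fix b assume "b \<in> B"
    then obtain x v where b: "b = translate x (KL m v)" "x \<in> min_reps m n" "v \<in> Y" by (auto simp: B_def)
    then have "b \<in> induced (Suc (ell x))" by (auto simp: induced_def)
    from Lop_induced[OF this assms(2)] have "Lop i b - scl qv b \<in> lat UNIV B"
      by (rule lat_mono) (use ind in auto)
    moreover have "scl qv b \<in> lat UNIV B" using \<open>b \<in> B\<close> by (intro lat_base) auto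
    ultimately have "(Lop i b - scl qv b) + scl qv b \<in> lat UNIV B" by (intro lat_add)
    then show "Lop i b \<in> lat UNIV B" by simp
  qed
  then show ?thesis
  proof (rule lat_subset)
    fix a b assume "b \<in> B"
    then obtain x v where b: "b = translate x (KL m v)" "x \<in> min_reps m n" "v \<in> Y" by (auto simp: B_def)
    show "scl a b \<in> lat UNIV (KL n ` ideal_set)"
      unfolding b(1) by (rule lat_scl[OF translate_in_KL_span[OF b(2,3)]]) simp
  qed
qed

text \<open>Each step down from \<open>z\<close> occurs with nonzero coefficient in some
  \<open>T_i C_z\<close>, which lies in the span of the \<open>C\<close> over
  \<open>ideal_set\<close>.\<close>

lemma left_le_ideal_set:
  assumes "left_le n y w" "w \<in> ideal_set"
  shows "y \<in> ideal_set"
  using assms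
proof (induction rule: converse_rtranclp_induct)
  case (step y z)
  then have z: "z \<in> ideal_set" "z \<in> sym n" using ideal_set_subset by auto
  obtain i where i: "i \<in> {1..<n}" "\<not> desc i z" "y = simple_refl i \<circ> z \<or> y \<in> mu_set n i (KL n z)"
    using left_edgeE[OF step(1)] .
  show ?case by (rule Lop_KL_coeffs[OF Lop_KL_ideal[OF z(1) i(1)] ideal_set_subset z(2) i])
qed

end

theorem left_le_parabolic:
  assumes "m \<le> n" "x \<in> min_reps m n" "v \<in> sym m" "left_le n w (x \<circ> v)"
  shows "\<exists>x' v'. x' \<in> min_reps m n \<and> w = x' \<circ> v' \<and> v' \<in> sym m \<and> left_le m v' v"
proof -
  \<comment> \<open>The smallest closed set containing \<open>v\<close>, so that membership in
    \<open>Y\<close> returns a chain in \<open>S_m\<close>.\<close>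
  define Y where "Y = {y. left_le m y v}"
  interpret parabolic_ideal m n Y
    by standard (use assms left_le_sym in \<open>auto simp: Y_def intro: converse_rtranclp_into_rtranclp\<close>)
  have "v \<in> Y" by (simp add: Y_def)
  then have "x \<circ> v \<in> ideal_set" using assms(2) unfolding ideal_set_def by blast
  then have "w \<in> ideal_set" using left_le_ideal_set assms(4) by blast
  then obtain x' v' where "w = x' \<circ> v'" "x' \<in> min_reps m n" "v' \<in> Y"
    unfolding ideal_set_def by blast
  moreover have "left_le m v' v" using \<open>v' \<in> Y\<close> by (simp add: Y_def)
  moreover have "v' \<in> sym m" using left_le_sym[OF calculation(4) assms(3)] .
  ultimately show ?thesis by blast
qed

subsection \<open>Products with commuting simple reflections\<close>

text \<open>Multiplication by \<open>\<Prod>\<^sub>k (T\<^sub>k - q)\<close> over pairwise commuting \<open>s\<^sub>k\<close> that also commute with \<open>S\<^sub>m\<close>.\<close>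

definition Uop :: "nat list \<Rightarrow> hfun \<Rightarrow> hfun"
  where "Uop ks x = foldr (\<lambda>k x. Lop k x - scl qv x) ks x"

lemma Uop_simps [simp]: "Uop [] x = x" "Uop (k # ks) x = Lop k (Uop ks x) - scl qv (Uop ks x)"
  by (simp_all add: Uop_def)

lemma Fn_Uop: "set ks \<subseteq> {1..<n} \<Longrightarrow> x \<in> Fn n \<Longrightarrow> Uop ks x \<in> Fn n"
  by (induction ks) (auto intro!: Fn_diff Fn_Lop Fn_scl)

lemma Uop_add: "Uop ks (x + y) = Uop ks x + Uop ks y"
  and Uop_scl: "Uop ks (scl a x) = scl a (Uop ks x)"
  and Uop_zero: "Uop ks 0 = 0"
proof -
  show "Uop ks (x + y) = Uop ks x + Uop ks y"
  proof (induction ks)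
    case (Cons k ks)
    show ?case unfolding Uop_simps Cons.IH Lop_add scl_simps by (rule add_diff_add)
  qed (simp only: Uop_simps)
  show scl: "Uop ks (scl a x) = scl a (Uop ks x)" for a x
  proof (induction ks)
    case (Cons k ks)
    show ?case unfolding Uop_simps Cons.IH Lop_scl scl_simps by (simp only: mult.commute)
  qed (simp only: Uop_simps)
  show "Uop ks 0 = 0" using scl[of 0 0] by simp
qed

lemma Uop_sum: "Uop ks (sum f A) = (\<Sum>a\<in>A. Uop ks (f a))"
  by (induction A rule: infinite_finite_induct)
    (simp_all only: sum.infinite sum.empty sum.insert Uop_add Uop_zero not_False_eq_True)

lemma Lop_Uop:
  assumes "x \<in> Fn n" "i \<in> {1..<n}" "set ks \<subseteq> {1..<n}" "\<And>k. k \<in> set ks \<Longrightarrow> 1 < \<bar>int i - int k\<bar>"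
  shows "Lop i (Uop ks x) = Uop ks (Lop i x)"
  using assms(3,4)
proof (induction ks)
  case (Cons k ks)
  then have "Lop i (Lop k (Uop ks x)) = Lop k (Lop i (Uop ks x))"
    using assms by (intro Lop_comm[of _ n] Fn_Uop) auto
  then show ?case using Cons unfolding Uop_simps Lop_diff Lop_scl by simp
qed (simp only: Uop_simps)

text \<open>From \<open>m < k\<close> every \<open>s_i\<close> with \<open>i < m\<close> is at
  distance at least two from \<open>s_k\<close>, so the two commute; \<open>far\<close> does the
  same for the letters of \<open>ks\<close> among themselves.\<close>

locale commuting_reflections =
  fixes m n :: nat and ks :: "nat list"
  assumes mn: "m \<le> n" and far: "sorted_wrt (\<lambda>a b. Suc a < b) ks"
    and range: "\<And>k. k \<in> set ks \<Longrightarrow> m < k \<and> k < n"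
begin

lemma set_ks: "set ks \<subseteq> {1..<n}"
  using range by force

text \<open>The three claims are proved together. The fixed points of the support are what the
  induction lives on: they show that the next letter \<open>k\<close> is not a descent in the
  support, so that no correction arises. The last claim is the equality of coefficients from which
  \<open>mu\<close> is compared.\<close>

lemma KL_product:
  assumes w: "w \<in> sym m"
  shows "KL n (perm_of_word ks \<circ> w) = Uop ks (KL n w) \<and>
    (\<forall>y a. KL n (perm_of_word ks \<circ> w) y \<noteq> 0 \<longrightarrow> m < a \<longrightarrow> (\<forall>k\<in>set ks. a \<noteq> k \<and> a \<noteq> Suc k) \<longrightarrow> y a = a) \<and>
    (\<forall>y. y \<in> sym m \<longrightarrow> KL n (perm_of_word ks \<circ> w) (perm_of_word ks \<circ> y) = KL n w y)"
  using far range
proof (induction ks)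
  case Nil
  have "y a = a" if "KL n w y \<noteq> 0" "m < a" for y a
  proof -
    have "y \<in> sym m" using FnD[OF KL_D(1)[OF w], of y] that KL_mono[OF mn w] by auto
    then show ?thesis using that(2) by (simp add: sym_def permutes_not_in)
  qed
  then show ?case unfolding perm_of_word_simps Uop_simps id_comp by blast
next
  case (Cons k ks)
  define v where "v = perm_of_word ks \<circ> w"
  have far: "Suc k < k'" if "k' \<in> set ks" for k' using Cons.prems(1) that by simp
  have mk: "m < k" "k < n" using Cons.prems(2) by auto
  have IH: "KL n v = Uop ks (KL n w)"
      "\<And>y a. KL n v y \<noteq> 0 \<Longrightarrow> m < a \<Longrightarrow> \<forall>k\<in>set ks. a \<noteq> k \<and> a \<noteq> Suc k \<Longrightarrow> y a = a"
      "\<And>y. y \<in> sym m \<Longrightarrow> KL n v (perm_of_word ks \<circ> y) = KL n w y"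
    using Cons.IH Cons.prems by (auto simp: v_def simp del: o_apply)
  have ks: "set ks \<subseteq> {1..<n}"
  proof
    fix k' assume "k' \<in> set ks"
    then show "k' \<in> {1..<n}" using Cons.prems(2)[of k'] by auto
  qed
  have v: "v \<in> sym n"
    unfolding v_def using perm_of_word_sym[OF ks] w sym_mono[OF mn] sym_comp by blast
  \<comment> \<open>Both \<open>k\<close> and \<open>k + 1\<close> exceed \<open>m\<close> and are
    smaller than all letters of the tail, so they are fixed throughout the support of
    \<open>C_v\<close>.\<close>
  have fix_k: "y k = k" "y (Suc k) = Suc k" if "KL n v y \<noteq> 0" for y
    by (rule IH(2)[OF that]; use mk far in force)+
  have eq: "KL n (simple_refl k \<circ> v) = Lop k (KL n v) - scl qv (KL n v)"
  proof (rule KL_product_step[OF v])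
    show "k \<in> {1..<n}" using mk by auto
    fix y assume nz: "KL n v y \<noteq> 0"
    then have "bij y" using FnD[OF KL_D(1)[OF v], of y] sym_bij by blast
    then have "pinv y k = k" "pinv y (Suc k) = Suc k"
      using fix_k[OF nz] by (metis pinv_simps(1))+
    then show "\<not> desc k y" by (simp add: desc_def)
  qed
  have p: "perm_of_word (k # ks) \<circ> y = simple_refl k \<circ> (perm_of_word ks \<circ> y)" for y
    by (simp only: perm_of_word_simps comp_assoc)
  show ?case unfolding p v_def[symmetric]
  proof (intro conjI allI impI)
    show "KL n (simple_refl k \<circ> v) = Uop (k # ks) (KL n w)" unfolding eq Uop_simps IH(1) ..
  next
    fix y a assume nz: "KL n (simple_refl k \<circ> v) y \<noteq> 0" and a: "m < a" "\<forall>k\<in>set (k # ks). a \<noteq> k \<and> a \<noteq> Suc k"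
    have "KL n v (simple_refl k \<circ> y) \<noteq> 0 \<or> KL n v y \<noteq> 0"
      using nz unfolding eq Lop_def by (auto split: if_splits)
    then show "y a = a"
    proof
      assume "KL n v y \<noteq> 0"
      then show ?thesis using IH(2)[of y a] a by simp
    next
      assume "KL n v (simple_refl k \<circ> y) \<noteq> 0"
      then have "simple_refl k (y a) = a" using IH(2)[of "simple_refl k \<circ> y" a] a by simp
      then have "y a = simple_refl k a" by (metis simple_refl_invol)
      then show ?thesis using a by (simp add: simple_refl_def)
    qed
  next
    fix y assume y: "y \<in> sym m"
    let ?z = "simple_refl k \<circ> (perm_of_word ks \<circ> y)"
    have fy: "(perm_of_word ks \<circ> y) k = k"
    proof -
      have "y k = k" using y mk by (simp add: sym_def permutes_not_in)
      moreover have "perm_of_word ks k = k"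
        using far
      proof (induction ks)
        case (Cons j ks)
        then have "perm_of_word ks k = k" "Suc k < j" by auto
        then show ?case unfolding perm_of_word_simps by (simp add: simple_refl_def)
      qed (simp only: perm_of_word_simps id_apply)
      ultimately show ?thesis by simp
    qed
    \<comment> \<open>\<open>?z\<close> sends \<open>k\<close> to \<open>k + 1\<close> and so lies
      outside the support of \<open>C_v\<close>; only the shifted term of \<open>T_k C_v\<close>
      contributes at \<open>?z\<close>.\<close>
    have "KL n v ?z = 0"
    proof (rule ccontr)
      assume "KL n v ?z \<noteq> 0"
      from fix_k(1)[OF this] show False using fy by simp
    qed
    then show "KL n (simple_refl k \<circ> v) ?z = KL n w y"
      unfolding eq minus_hfun_apply scl_apply Lop_def simple_refl_comp_invol IH(3)[OF y] by simp
  qed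
qed

abbreviation "u \<equiv> perm_of_word ks"

lemmas KL_u = KL_product[THEN conjunct1]

lemma KL_u_coeff: "w \<in> sym m \<Longrightarrow> y \<in> sym m \<Longrightarrow> KL n (u \<circ> w) (u \<circ> y) = KL n w y"
  using KL_product by blast

lemma u_sym: "u \<in> sym n"
  by (rule perm_of_word_sym[OF set_ks])

lemma u_permutes: "u permutes {m<..n}"
  using range
proof (induction ks)
  case Nil
  show ?case unfolding perm_of_word_simps by (rule permutes_id)
next
  case (Cons k ks)
  have "u permutes {m<..n}" if "u = perm_of_word ks" for u using Cons that by simp
  moreover have "simple_refl k permutes {m<..n}"
    unfolding simple_refl_def using Cons.prems[of k] by (intro permutes_swap_id) auto
  ultimately show ?case unfolding perm_of_word_simps by (intro permutes_compose) auto
qed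

lemma u_fixes: "a \<le> m \<Longrightarrow> u a = a"
  using permutes_not_in[OF u_permutes] by simp

lemma u_comm:
  assumes "w \<in> sym m"
  shows "w \<circ> u = u \<circ> w"
proof
  fix a
  have w: "w permutes {1..m}" using assms by (simp add: sym_def)
  show "(w \<circ> u) a = (u \<circ> w) a"
  proof (cases "a \<le> m")
    case True
    have "w a \<le> m"
      using permutes_in_image[OF w, of a] permutes_not_in[OF w, of a] True by (cases "a \<in> {1..m}") auto
    then show ?thesis using u_fixes True by simp
  next
    case False
    then have "w a = a" using permutes_not_in[OF w] by simp
    moreover have "m < u a"
      using permutes_in_image[OF u_permutes, of a] permutes_not_in[OF u_permutes, of a] False
      by (cases "a \<in> {m<..n}") auto
    then have "w (u a) = u a" using permutes_not_in[OF w] by simp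
    ultimately show ?thesis by simp
  qed
qed

lemma u_comp_sym: "w \<in> sym m \<Longrightarrow> u \<circ> w \<in> sym n"
  using u_sym sym_mono[OF mn] sym_comp by blast

lemma desc_u:
  assumes "w \<in> sym m" "i \<in> {1..<m}"
  shows "desc i (u \<circ> w) \<longleftrightarrow> desc i w"
proof -
  have b: "bij u" "bij w" using u_sym assms sym_bij by auto
  have "pinv u a = a" if "a \<le> m" for a using u_fixes[OF that] pinv_simps(1)[OF b(1), of a] by simp
  then show ?thesis using assms(2) b by (simp add: desc_def o_inv_distrib)
qed

text \<open>The coefficients agree by \<open>KL_u_coeff\<close>, and the descent that separates
  \<open>y\<close> from \<open>w\<close> is some \<open>i < m\<close>, which \<open>u\<close> does
  not affect.\<close>

lemma left_edge_u:
  assumes "left_edge m y w"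
  shows "left_edge n (u \<circ> y) (u \<circ> w)"
proof -
  have yw: "y \<in> sym m" "w \<in> sym m" using assms by (auto simp: left_edge_def)
  obtain i where i: "i \<in> {1..<m}" "desc i y" "\<not> desc i w"
    and mu: "lk (KL m w y) 1 \<noteq> 0 \<or> lk (KL m y w) 1 \<noteq> 0"
    using assms by (auto simp: left_edge_def)
  have "KL n (u \<circ> w) (u \<circ> y) = KL m w y" "KL n (u \<circ> y) (u \<circ> w) = KL m y w"
    using KL_u_coeff[OF yw(2,1)] KL_u_coeff[OF yw] KL_mono[OF mn] yw by simp_all
  moreover have "i \<in> {1..<n}" using i(1) mn by auto
  moreover have "desc i (u \<circ> y)" "\<not> desc i (u \<circ> w)" using desc_u yw i by blast+
  ultimately show ?thesis
    using mu u_comp_sym[OF yw(1)] u_comp_sym[OF yw(2)] unfolding left_edge_def by metis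
qed

lemma left_le_u: "left_le m y w \<Longrightarrow> left_le n (u \<circ> y) (u \<circ> w)"
  by (induction rule: rtranclp_induct) (blast intro: rtranclp.intros left_edge_u)+

lemma u_min_reps: "u \<in> min_reps m n"
  using u_sym u_fixes by (auto simp: min_reps_def)

text \<open>On the block, \<open>x\<close> agrees with the inverse of \<open>v\<close> followed by
  \<open>w\<close>, a permutation of the block. Being increasing there, this permutation is the
  identity.\<close>

lemma min_reps_unique:
  assumes "w \<in> sym m" "v \<in> sym m" "x \<in> min_reps m n" "u \<circ> w = x \<circ> v"
  shows "w = v"
proof -
  have b: "bij v" "bij w" using assms sym_bij by auto
  have pv: "pinv v permutes {1..m}" using assms(2) by (simp add: sym_def permutes_inv)
  define z where "z = w \<circ> pinv v"
  have z: "z permutes {1..m}"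
    unfolding z_def using pv assms(1) by (simp add: sym_def permutes_compose)
  have zx: "z a = x a" if "a \<in> {1..m}" for a
  proof -
    have "w (pinv v a) \<le> m"
      using permutes_in_image[OF z, of a] that by (auto simp: z_def)
    then have "z a = u (w (pinv v a))" using u_fixes by (simp add: z_def)
    also have "\<dots> = x (v (pinv v a))" using assms(4) by (metis comp_apply)
    finally show ?thesis using pinv_simps(2)[OF b(1)] by simp
  qed
  have "z = id"
  proof (rule increasing_perm_id[OF z])
    fix i assume "i \<in> {1..<m}"
    then show "z i < z (Suc i)" using zx[of i] zx[of "Suc i"] assms(3) by (auto simp: min_reps_def)
  qed
  then have "z \<circ> v = v" by simp
  moreover have "z \<circ> v = w" by (simp add: z_def fun_eq_iff pinv_simps(1)[OF b(1)])
  ultimately show ?thesis by simp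
qed

lemma left_le_u_iff:
  assumes "w \<in> sym m" "z \<in> sym m"
  shows "left_le n (u \<circ> w) (u \<circ> z) \<longleftrightarrow> left_le m w z"
proof
  assume "left_le n (u \<circ> w) (u \<circ> z)"
  then obtain x' v' where "x' \<in> min_reps m n" "u \<circ> w = x' \<circ> v'" "v' \<in> sym m" "left_le m v' z"
    using left_le_parabolic[OF mn u_min_reps assms(2)] by blast
  then show "left_le m w z" using min_reps_unique assms by blast
qed (rule left_le_u)

end

section \<open>The Hecke algebra acts on the regular representation\<close>

abbreviation Lword :: "nat list \<Rightarrow> hfun \<Rightarrow> hfun"
  where "Lword js \<equiv> foldr Lop js"

definition act :: "free_elt \<Rightarrow> hfun \<Rightarrow> hfun"
  where "act f x = (\<Sum>u\<in>Poly_Mapping.keys f. scl (Poly_Mapping.lookup f u) (Lword (letters u) x))"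

definition free_word :: "nat list \<Rightarrow> free_elt"
  where "free_word js = Poly_Mapping.single (Mon js) 1"

lemma Lword_add: "Lword js (x + y) = Lword js x + Lword js y"
proof (induction js)
  case (Cons j js)
  show ?case unfolding foldr.simps comp_apply Cons.IH Lop_add ..
qed simp

lemma Lword_scl: "Lword js (scl a x) = scl a (Lword js x)"
proof (induction js)
  case (Cons j js)
  show ?case unfolding foldr.simps comp_apply Cons.IH Lop_scl ..
qed simp

lemma Lword_zero: "Lword js 0 = 0"
  using Lword_scl[of js 0 0] by simp

lemma act_superset:
  assumes "finite A" "Poly_Mapping.keys f \<subseteq> A"
  shows "act f x = (\<Sum>u\<in>A. scl (Poly_Mapping.lookup f u) (Lword (letters u) x))"
  unfolding act_def using assms by (intro sum.mono_neutral_left) (auto simp: in_keys_iff)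

lemma act_add: "act (f + g) x = act f x + act g x"
proof -
  let ?A = "Poly_Mapping.keys f \<union> Poly_Mapping.keys g"
  have "act h x = (\<Sum>u\<in>?A. scl (Poly_Mapping.lookup h u) (Lword (letters u) x))"
    if "h \<in> {f + g, f, g}" for h
    using that keys_add[of f g] by (intro act_superset) auto
  then show ?thesis by (simp add: lookup_add scl_simps sum.distrib)
qed

lemma act_zero [simp]: "act 0 x = 0"
  by (simp add: act_def)

lemma act_minus: "act (- f) x = - act f x"
  using act_add[of "- f" f x] by (simp add: eq_neg_iff_add_eq_0)

lemma act_diff: "act (f - g) x = act f x - act g x"
  using act_add[of f "- g" x] act_minus by simp

lemma act_sum: "act (sum f A) x = (\<Sum>a\<in>A. act (f a) x)"
  by (induction A rule: infinite_finite_induct)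
    (simp_all only: sum.infinite sum.empty sum.insert act_add act_zero not_False_eq_True)

lemma act_single: "act (Poly_Mapping.single u a) x = scl a (Lword (letters u) x)"
  using act_superset[of "{u}" "Poly_Mapping.single u a" x] by simp

lemma act_linear: "act f (x + y) = act f x + act f y" "act f (scl a x) = scl a (act f x)" "act f 0 = 0"
  by (simp_all add: act_def Lword_add Lword_scl Lword_zero scl_simps sum.distrib scl_sum mult.commute)

lemma act_hsum: "act f (sum g A) = (\<Sum>a\<in>A. act f (g a))"
  by (induction A rule: infinite_finite_induct)
    (simp_all only: sum.infinite sum.empty sum.insert act_linear not_False_eq_True)

lemma poly_mapping_expand:
  "f = (\<Sum>u\<in>Poly_Mapping.keys f. Poly_Mapping.single u (Poly_Mapping.lookup f u))"
proof (rule poly_mapping_eqI)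
  fix k
  have "Poly_Mapping.lookup (\<Sum>u\<in>Poly_Mapping.keys f. Poly_Mapping.single u (Poly_Mapping.lookup f u)) k =
      (\<Sum>u\<in>Poly_Mapping.keys f. if k = u then Poly_Mapping.lookup f k else 0)"
    unfolding lookup_sum by (intro sum.cong) (auto simp: lookup_single when_def)
  then show "Poly_Mapping.lookup f k =
      Poly_Mapping.lookup (\<Sum>u\<in>Poly_Mapping.keys f. Poly_Mapping.single u (Poly_Mapping.lookup f u)) k"
    by (simp add: in_keys_iff)
qed

lemma letters_add: "letters (u + v) = letters u @ letters v" "letters 0 = []"
  by (simp_all add: plus_free_mon_def zero_free_mon_def)

lemma act_mult: "act (f * g) x = act f (act g x)"
proof -
  have 1: "act (Poly_Mapping.single u a * Poly_Mapping.single v b) x =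
      act (Poly_Mapping.single u a) (act (Poly_Mapping.single v b) x)" for u v a b
    by (simp add: mult_single act_single letters_add Lword_scl scl_simps)
  have 2: "act (Poly_Mapping.single u a * g) x = act (Poly_Mapping.single u a) (act g x)" for u a
    by (subst (1 2) poly_mapping_expand[of g]) (simp only: sum_distrib_left act_sum act_hsum 1)
  show ?thesis
    by (subst (1 2) poly_mapping_expand[of f]) (simp only: sum_distrib_right act_sum 2)
qed

lemma act_one [simp]: "act 1 x = x"
  using act_single[of 0 1 x] by (simp add: letters_add)

lemma act_free_gen [simp]: "act (free_gen i) x = Lop i x"
  by (simp add: free_gen_def act_single)

lemma act_free_scalar [simp]: "act (free_scalar a) x = scl a x"
  by (simp add: free_scalar_def act_single letters_add)

lemma act_free_word [simp]: "act (free_word js) x = Lword js x"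
  by (simp add: free_word_def act_single)

section \<open>The free algebra as a ring, and the relations as operators\<close>

lemma free_alg_simps [simp]:
  "f \<otimes>\<^bsub>free_alg n\<^esub> g = f * g" "f \<oplus>\<^bsub>free_alg n\<^esub> g = f + g" "\<one>\<^bsub>free_alg n\<^esub> = 1" "\<zero>\<^bsub>free_alg n\<^esub> = 0"
  by (simp_all add: free_alg_def ring_of_type_algebra_def)

lemma free_alg_carrier:
  "f \<in> carrier (free_alg n) \<longleftrightarrow> (\<forall>u\<in>Poly_Mapping.keys f. set (letters u) \<subseteq> {1..<n})"
  by (simp add: free_alg_def)

lemma free_alg_closed:
  assumes "f \<in> carrier (free_alg n)" "g \<in> carrier (free_alg n)"
  shows "f + g \<in> carrier (free_alg n)" "f - g \<in> carrier (free_alg n)" "f * g \<in> carrier (free_alg n)"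
    "- f \<in> carrier (free_alg n)"
proof -
  have add: "f + g \<in> carrier (free_alg n)"
    if "f \<in> carrier (free_alg n)" "g \<in> carrier (free_alg n)" for f g :: free_elt
    using that keys_add[of f g] unfolding free_alg_carrier by blast
  have neg: "- f \<in> carrier (free_alg n)" if "f \<in> carrier (free_alg n)" for f :: free_elt
    using that by (simp add: free_alg_carrier in_keys_iff)
  show "f + g \<in> carrier (free_alg n)" "- f \<in> carrier (free_alg n)" using add neg assms by auto
  show "f - g \<in> carrier (free_alg n)" using add[OF assms(1) neg[OF assms(2)]] by simp
  show "f * g \<in> carrier (free_alg n)"
    unfolding free_alg_carrier
  proof
    fix u assume "u \<in> Poly_Mapping.keys (f * g)"
    then obtain a b where "a \<in> Poly_Mapping.keys f" "b \<in> Poly_Mapping.keys g" "u = a + b"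
      using keys_mult[of f g] by blast
    then show "set (letters u) \<subseteq> {1..<n}" using assms unfolding free_alg_carrier by (simp add: letters_add)
  qed
qed

lemma free_alg_consts:
  "0 \<in> carrier (free_alg n)" "1 \<in> carrier (free_alg n)" "free_scalar a \<in> carrier (free_alg n)"
  "i \<in> {1..<n} \<Longrightarrow> free_gen i \<in> carrier (free_alg n)"
  "set js \<subseteq> {1..<n} \<Longrightarrow> free_word js \<in> carrier (free_alg n)"
  by (auto simp: free_alg_carrier free_scalar_def free_gen_def free_word_def letters_add)

lemma free_alg_sum:
  "(\<And>a. a \<in> A \<Longrightarrow> f a \<in> carrier (free_alg n)) \<Longrightarrow> sum f A \<in> carrier (free_alg n)"
  by (induction A rule: infinite_finite_induct) (auto intro: free_alg_closed free_alg_consts)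

lemma free_alg_mono: "m \<le> n \<Longrightarrow> f \<in> carrier (free_alg m) \<Longrightarrow> f \<in> carrier (free_alg n)"
  unfolding free_alg_carrier by fastforce

lemma free_alg_abelian_group: "abelian_group (free_alg n)"
proof (rule abelian_groupI)
  fix x assume x: "x \<in> carrier (free_alg n)"
  show "\<exists>y\<in>carrier (free_alg n). y \<oplus>\<^bsub>free_alg n\<^esub> x = \<zero>\<^bsub>free_alg n\<^esub>"
    by (rule bexI[of _ "- x"]) (use x free_alg_closed in auto)
qed (auto simp: algebra_simps intro: free_alg_closed free_alg_consts)

lemma free_alg_ring: "ring (free_alg n)"
proof (rule ringI[OF free_alg_abelian_group])
  show "Group.monoid (free_alg n)"
    by (rule monoidI) (auto simp: algebra_simps intro: free_alg_closed free_alg_consts)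
qed (auto simp: algebra_simps)

text \<open>Stated for arbitrary \<open>S\<close> because it serves both \<open>Fn n\<close> and the
  spans of Kazhdan-Lusztig elements.\<close>

lemma act_closed:
  assumes "f \<in> carrier (free_alg n)" "x \<in> S" "0 \<in> S" "\<And>x y. x \<in> S \<Longrightarrow> y \<in> S \<Longrightarrow> x + y \<in> S"
    "\<And>a x. x \<in> S \<Longrightarrow> scl a x \<in> S" "\<And>i x. i \<in> {1..<n} \<Longrightarrow> x \<in> S \<Longrightarrow> Lop i x \<in> S"
  shows "act f x \<in> S"
proof -
  have L: "Lword js x \<in> S" if "set js \<subseteq> {1..<n}" for js
    using that by (induction js) (use assms in auto)
  have S: "sum g A \<in> S" if "\<And>a. a \<in> A \<Longrightarrow> g a \<in> S" for g :: "nat free_mon \<Rightarrow> hfun" and A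
    using that by (induction A rule: infinite_finite_induct) (use assms(3,4) in auto)
  show ?thesis
    unfolding act_def by (intro S assms(5) L) (use assms(1) in \<open>auto simp: free_alg_carrier\<close>)
qed

lemma Fn_act: "f \<in> carrier (free_alg n) \<Longrightarrow> x \<in> Fn n \<Longrightarrow> act f x \<in> Fn n"
  by (rule act_closed) (auto intro: Fn_add Fn_scl Fn_Lop)

lemma hecke_relators_carrier: "hecke_relators n \<subseteq> carrier (free_alg n)"
  unfolding hecke_relators_def
  by (auto simp del: One_nat_def intro!: free_alg_closed free_alg_consts)

lemma hecke_ideal_ideal: "ideal (hecke_ideal n) (free_alg n)"
  unfolding hecke_ideal_def by (rule ring.genideal_ideal[OF free_alg_ring hecke_relators_carrier])

lemma hecke_relators_ideal: "hecke_relators n \<subseteq> hecke_ideal n"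
  unfolding hecke_ideal_def by (rule ring.genideal_self[OF free_alg_ring hecke_relators_carrier])

lemma act_hecke_relators:
  assumes "r \<in> hecke_relators n" "x \<in> Fn n"
  shows "act r x = 0"
proof -
  consider i where "r = free_gen i * free_gen (i + 1) * free_gen i - free_gen (i + 1) * free_gen i * free_gen (i + 1)"
      "i \<in> {1..<n}" "i + 1 \<in> {1..<n}"
    | i j where "r = free_gen i * free_gen j - free_gen j * free_gen i"
      "i \<in> {1..<n}" "j \<in> {1..<n}" "\<bar>int i - int j\<bar> > 1"
    | i where "r = free_gen i * free_gen i - (1 + free_scalar (qv - qv_inv) * free_gen i)" "i \<in> {1..<n}"
    using assms(1) unfolding hecke_relators_def by blast
  then show ?thesis
  proof cases
    case 1
    then show ?thesis using Lop_braid[OF assms(2), of i] by (simp add: act_diff act_mult)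
  next
    case 2
    then show ?thesis using Lop_comm[OF assms(2), of i j] by (simp add: act_diff act_mult)
  next
    case 3
    then show ?thesis using Lop_quadratic[OF assms(2), of i] by (simp add: act_diff act_add act_mult zeta_def)
  qed
qed

lemma free_alg_a_inv:
  assumes "f \<in> carrier (free_alg n)"
  shows "\<ominus>\<^bsub>free_alg n\<^esub> f = - f"
proof -
  interpret abelian_group "free_alg n" by (rule free_alg_abelian_group)
  show ?thesis by (rule minus_equality) (use assms free_alg_closed in auto)
qed

text \<open>The annihilator of \<open>Fn n\<close> is a two-sided ideal, since \<open>Fn n\<close>
  is stable under the action, and it contains the relators.\<close>

lemma act_hecke_ideal:
  assumes "f \<in> hecke_ideal n" "x \<in> Fn n"
  shows "act f x = 0"
proof -
  define J where "J = {f \<in> carrier (free_alg n). \<forall>x\<in>Fn n. act f x = 0}"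
  have "ideal J (free_alg n)"
  proof (rule idealI[OF free_alg_ring])
    interpret abelian_group "free_alg n" by (rule free_alg_abelian_group)
    show "subgroup J (add_monoid (free_alg n))"
    proof (rule add.subgroupI)
      fix f assume f: "f \<in> J"
      then have "\<ominus>\<^bsub>free_alg n\<^esub> f = - f" by (intro free_alg_a_inv) (simp add: J_def)
      then show "\<ominus>\<^bsub>free_alg n\<^esub> f \<in> J" using f free_alg_closed by (auto simp: J_def act_minus)
    qed (auto simp: J_def act_add intro: free_alg_closed free_alg_consts)
  qed (auto simp: J_def act_mult act_linear Fn_act intro: free_alg_closed)
  moreover have "hecke_relators n \<subseteq> J"
    using hecke_relators_carrier act_hecke_relators by (auto simp: J_def)
  ultimately have "hecke_ideal n \<subseteq> J"
    unfolding hecke_ideal_def by (rule ring.genideal_minimal[OF free_alg_ring])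
  then show ?thesis using assms by (auto simp: J_def)
qed

subsection \<open>Congruence modulo the relations\<close>

definition hcong :: "nat \<Rightarrow> free_elt \<Rightarrow> free_elt \<Rightarrow> bool"
  where "hcong n f g \<longleftrightarrow> f - g \<in> hecke_ideal n"

lemma hecke_ideal_closed:
  "0 \<in> hecke_ideal n"
  "f \<in> hecke_ideal n \<Longrightarrow> g \<in> hecke_ideal n \<Longrightarrow> f + g \<in> hecke_ideal n"
  "f \<in> hecke_ideal n \<Longrightarrow> - f \<in> hecke_ideal n"
  "f \<in> hecke_ideal n \<Longrightarrow> g \<in> carrier (free_alg n) \<Longrightarrow> g * f \<in> hecke_ideal n"
  "f \<in> hecke_ideal n \<Longrightarrow> g \<in> carrier (free_alg n) \<Longrightarrow> f * g \<in> hecke_ideal n"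
  "f \<in> hecke_ideal n \<Longrightarrow> f \<in> carrier (free_alg n)"
proof -
  interpret ideal "hecke_ideal n" "free_alg n" by (rule hecke_ideal_ideal)
  show "0 \<in> hecke_ideal n"
    using additive_subgroup.zero_closed[OF is_additive_subgroup] by simp
  show "f \<in> hecke_ideal n \<Longrightarrow> g \<in> hecke_ideal n \<Longrightarrow> f + g \<in> hecke_ideal n" using additive_subgroup.a_closed[OF is_additive_subgroup, of f g] by simp
  show car: "f \<in> hecke_ideal n \<Longrightarrow> f \<in> carrier (free_alg n)" by (rule a_Hcarr)
  show "f \<in> hecke_ideal n \<Longrightarrow> - f \<in> hecke_ideal n"
    using additive_subgroup.a_inv_closed[OF is_additive_subgroup, of f] free_alg_a_inv[OF car] by simp
  show "f \<in> hecke_ideal n \<Longrightarrow> g \<in> carrier (free_alg n) \<Longrightarrow> g * f \<in> hecke_ideal n"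
    using I_l_closed[of f g] by simp
  show "f \<in> hecke_ideal n \<Longrightarrow> g \<in> carrier (free_alg n) \<Longrightarrow> f * g \<in> hecke_ideal n"
    using I_r_closed[of f g] by simp
qed

lemma hcong_refl [simp]: "hcong n f f"
  by (simp add: hcong_def hecke_ideal_closed)

lemma hcong_sym: "hcong n f g \<Longrightarrow> hcong n g f"
  unfolding hcong_def using hecke_ideal_closed(3)[of "f - g" n] by simp

lemma hcong_trans [trans]: "hcong n f g \<Longrightarrow> hcong n g h \<Longrightarrow> hcong n f h"
  unfolding hcong_def using hecke_ideal_closed(2)[of "f - g" n "g - h"] by simp

lemma hcong_add: "hcong n f g \<Longrightarrow> hcong n f' g' \<Longrightarrow> hcong n (f + f') (g + g')"
  unfolding hcong_def using hecke_ideal_closed(2)[of "f - g" n "f' - g'"] by (simp add: algebra_simps)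

lemma hcong_mult_left: "hcong n f g \<Longrightarrow> h \<in> carrier (free_alg n) \<Longrightarrow> hcong n (h * f) (h * g)"
  unfolding hcong_def using hecke_ideal_closed(4)[of "f - g" n h] by (simp add: algebra_simps)

lemma hcong_mult_right: "hcong n f g \<Longrightarrow> h \<in> carrier (free_alg n) \<Longrightarrow> hcong n (f * h) (g * h)"
  unfolding hcong_def using hecke_ideal_closed(5)[of "f - g" n h] by (simp add: algebra_simps)

lemma hcong_sum: "(\<And>a. a \<in> A \<Longrightarrow> hcong n (f a) (g a)) \<Longrightarrow> hcong n (sum f A) (sum g A)"
  by (induction A rule: infinite_finite_induct) (auto intro: hcong_add)

lemma hecke_class_eq_iff: "hecke_class n f = hecke_class n g \<longleftrightarrow> hcong n f g"
proof
  assume "hecke_class n f = hecke_class n g"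
  then have "f \<in> hecke_class n g"
    using hecke_ideal_closed(1)[of n] by (force simp: hecke_class_def a_r_coset_def')
  then show "hcong n f g" by (auto simp: hecke_class_def a_r_coset_def' hcong_def)
next
  have sub: "hecke_class n f \<subseteq> hecke_class n g" if "hcong n f g" for f g
  proof
    fix x assume "x \<in> hecke_class n f"
    then obtain h where h: "h \<in> hecke_ideal n" "x = h + f" by (auto simp: hecke_class_def a_r_coset_def')
    then have "h + (f - g) \<in> hecke_ideal n" using that hecke_ideal_closed(2) by (auto simp: hcong_def)
    moreover have "x = (h + (f - g)) + g" using h(2) by simp
    ultimately show "x \<in> hecke_class n g" unfolding hecke_class_def a_r_coset_def' free_alg_simps by blast
  qed
  assume "hcong n f g"
  then show "hecke_class n f = hecke_class n g" using sub hcong_sym by blast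
qed

lemma free_word_Cons: "free_word (i # js) = free_gen i * free_word js"
  by (simp add: free_word_def free_gen_def mult_single plus_free_mon_def)

lemma free_word_Nil: "free_word [] = 1"
  unfolding free_word_def by (metis single_one zero_free_mon_def)

lemma free_scalar_simps:
  "free_scalar (a + b) = free_scalar a + free_scalar b" "free_scalar 0 = 0"
  "free_scalar (a * b) = free_scalar a * free_scalar b" "free_scalar 1 = 1"
  "free_gen i * free_scalar a = free_scalar a * free_gen i"
  by (simp_all add: free_scalar_def free_gen_def single_add mult_single)

lemma hcong_relations:
  assumes "i \<in> {1..<n}"
  shows "Suc i \<in> {1..<n} \<Longrightarrow> hcong n (free_gen i * free_gen (Suc i) * free_gen i)
      (free_gen (Suc i) * free_gen i * free_gen (Suc i))"
    and "j \<in> {1..<n} \<Longrightarrow> 1 < \<bar>int i - int j\<bar> \<Longrightarrow> hcong n (free_gen i * free_gen j) (free_gen j * free_gen i)"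
    and "hcong n (free_gen i * free_gen i) (1 + free_scalar zeta * free_gen i)"
proof -
  show "hcong n (free_gen i * free_gen (Suc i) * free_gen i) (free_gen (Suc i) * free_gen i * free_gen (Suc i))"
    if "Suc i \<in> {1..<n}"
  proof -
    have "free_gen i * free_gen (i + 1) * free_gen i - free_gen (i + 1) * free_gen i * free_gen (i + 1) \<in> hecke_relators n"
      unfolding hecke_relators_def using assms that by (intro UnI1 CollectI) (auto simp del: One_nat_def)
    then show ?thesis using hecke_relators_ideal by (auto simp: hcong_def)
  qed
  show "hcong n (free_gen i * free_gen j) (free_gen j * free_gen i)"
    if "j \<in> {1..<n}" "1 < \<bar>int i - int j\<bar>"
  proof -
    have "free_gen i * free_gen j - free_gen j * free_gen i \<in> hecke_relators n"
      unfolding hecke_relators_def using assms that by blast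
    then show ?thesis using hecke_relators_ideal by (auto simp: hcong_def)
  qed
  show "hcong n (free_gen i * free_gen i) (1 + free_scalar zeta * free_gen i)"
  proof -
    have "free_gen i * free_gen i - (1 + free_scalar (qv - qv_inv) * free_gen i) \<in> hecke_relators n"
      unfolding hecke_relators_def using assms by blast
    then show ?thesis using hecke_relators_ideal by (auto simp: hcong_def zeta_def)
  qed
qed

text \<open>\<open>matsumoto\<close> produces equalities, whereas the relations hold as congruences;
  it is therefore applied to congruence classes as sets.\<close>

lemma hcong_reduced_words:
  assumes "set js \<subseteq> {1..<n}" "set ks \<subseteq> {1..<n}" "reduced js" "reduced ks"
    "perm_of_word js = perm_of_word ks"
  shows "hcong n (free_word js) (free_word ks)"
proof -
  \<comment> \<open>Multiplication of a class by a generator from the left, saturated under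
    congruence so that the value is again a class.\<close>
  define \<phi> where "\<phi> i A = {h. \<exists>f\<in>A. hcong n h (free_gen i * f)}" for i A
  define D where "D = {{h. hcong n h f} | f. f \<in> carrier (free_alg n)}"
  have \<phi>: "\<phi> i {h. hcong n h f} = {h. hcong n h (free_gen i * f)}"
    if "i \<in> {1..<n}" "f \<in> carrier (free_alg n)" for i f
  proof -
    have "free_gen i \<in> carrier (free_alg n)" using that by (intro free_alg_consts)
    then have "hcong n x (free_gen i * f)" if "hcong n f' f" "hcong n x (free_gen i * f')" for x f'
      using that hcong_mult_left hcong_trans by blast
    moreover have "hcong n f f" by simp
    ultimately show ?thesis unfolding \<phi>_def by blast
  qed
  have cl: "free_gen i * f \<in> carrier (free_alg n)" if "i \<in> {1..<n}" "f \<in> carrier (free_alg n)" for i f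
    using that by (intro free_alg_closed free_alg_consts)
  have eq: "{h. hcong n h f} = {h. hcong n h g}" if "hcong n f g" for f g
  proof -
    have "hcong n h f \<longleftrightarrow> hcong n h g" for h
      using hcong_trans[OF _ that, of h] hcong_trans[OF _ hcong_sym[OF that], of h] by blast
    then show ?thesis by simp
  qed
  have word: "foldr \<phi> js {h. hcong n h 1} = {h. hcong n h (free_word js)}" if "set js \<subseteq> {1..<n}" for js
    using that
  proof (induction js)
    case (Cons j js)
    then show ?case using \<phi>[of j "free_word js"] by (simp add: free_word_Cons free_alg_consts)
  qed (simp add: free_word_Nil)
  have "foldr \<phi> js {h. hcong n h 1} = foldr \<phi> ks {h. hcong n h 1}"
  proof (rule matsumoto[where D = D and n = n])
    fix i A assume "i \<in> {1..<n}" "A \<in> D"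
    then show "\<phi> i A \<in> D" using \<phi> cl by (auto simp: D_def)
  next
    fix i A assume i: "i \<in> {1..<n}" "Suc i \<in> {1..<n}" and "A \<in> D"
    then obtain f where f: "A = {h. hcong n h f}" "f \<in> carrier (free_alg n)" by (auto simp: D_def)
    show "\<phi> i (\<phi> (Suc i) (\<phi> i A)) = \<phi> (Suc i) (\<phi> i (\<phi> (Suc i) A))"
      unfolding f(1) using hcong_mult_right[OF hcong_relations(1)[OF i] f(2)]
      by (simp only: \<phi> cl f(2) i eq mult.assoc)
  next
    fix i j A assume i: "i \<in> {1..<n}" "j \<in> {1..<n}" "1 < \<bar>int i - int j\<bar>" and "A \<in> D"
    then obtain f where f: "A = {h. hcong n h f}" "f \<in> carrier (free_alg n)" by (auto simp: D_def)
    show "\<phi> i (\<phi> j A) = \<phi> j (\<phi> i A)"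
      unfolding f(1) using hcong_mult_right[OF hcong_relations(2)[OF i] f(2)]
      by (simp only: \<phi> cl f(2) i eq mult.assoc)
  next
    show "{h. hcong n h 1} \<in> D" using free_alg_consts(2) by (auto simp: D_def)
  qed (use assms in auto)
  then have "free_word js \<in> {h. hcong n h (free_word ks)}"
    using word assms(1,2) by (metis hcong_refl mem_Collect_eq)
  then show ?thesis by simp
qed

section \<open>Spanning by the \<open>T_w\<close> and faithfulness\<close>

definition red_word :: "nat \<Rightarrow> (nat \<Rightarrow> nat) \<Rightarrow> nat list"
  where "red_word n w = (SOME js. expression_of n js w \<and> reduced js)"

lemma red_word: "w \<in> sym n \<Longrightarrow> expression_of n (red_word n w) w \<and> reduced (red_word n w)"
  unfolding red_word_def using someI_ex[OF exists_reduced] .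

lemma red_wordD:
  assumes "w \<in> sym n"
  shows "set (red_word n w) \<subseteq> {1..<n}" "perm_of_word (red_word n w) = w" "reduced (red_word n w)"
  using red_word[OF assms] by (auto simp: expression_of_def)

text \<open>The normal form with given coordinates. It inverts \<open>act f (Tb id)\<close>: exactly
  in \<open>act_lift\<close>, up to congruence in \<open>hcong_lift_act\<close>.\<close>

definition lift :: "nat \<Rightarrow> hfun \<Rightarrow> free_elt"
  where "lift n x = (\<Sum>w\<in>sym n. free_scalar (x w) * free_word (red_word n w))"

lemma lift_carrier: "lift n x \<in> carrier (free_alg n)"
  unfolding lift_def using red_wordD(1) by (intro free_alg_sum free_alg_closed free_alg_consts) auto

lemma hcong_red_word:
  assumes "w \<in> sym n" "set js \<subseteq> {1..<n}" "perm_of_word js = w" "reduced js"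
  shows "hcong n (free_word js) (free_word (red_word n w))"
  using assms red_wordD[OF assms(1)] by (intro hcong_reduced_words) auto

text \<open>If \<open>i\<close> is an ascent, prefixing \<open>i\<close> gives a reduced word. If it
  is a descent, then \<open>w = s_i v\<close> and the quadratic relation is applied to the two
  leading generators.\<close>

lemma gen_red_word:
  assumes "w \<in> sym n" "i \<in> {1..<n}"
  shows "hcong n (free_gen i * free_word (red_word n w))
    (free_word (red_word n (simple_refl i \<circ> w)) + (if desc i w then free_scalar zeta * free_word (red_word n w) else 0))"
proof -
  have asc: "hcong n (free_gen i * free_word (red_word n v)) (free_word (red_word n (simple_refl i \<circ> v)))"
    if v: "v \<in> sym n" "\<not> desc i v" for v
  proof -
    note r = red_wordD[OF v(1)]
    have "set (i # red_word n v) \<subseteq> {1..<n}" using r(1) assms(2) by auto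
    moreover have "reduced (i # red_word n v)"
      using reduced_Cons[OF calculation] r v by simp
    moreover have "simple_refl i \<circ> v \<in> sym n" using v assms(2) by (simp only: simple_refl_comp_sym)
    moreover have "perm_of_word (i # red_word n v) = simple_refl i \<circ> v" using r(2) by (simp only: perm_of_word_simps)
    ultimately show ?thesis unfolding free_word_Cons[symmetric] by (intro hcong_red_word)
  qed
  show ?thesis
  proof (cases "desc i w")
    case False
    then show ?thesis using asc assms by simp
  next
    case True
    define v where "v = simple_refl i \<circ> w"
    have v: "v \<in> sym n" "\<not> desc i v" "simple_refl i \<circ> v = w"
      using True assms by (auto simp: v_def desc_simple_refl_comp sym_bij)
    let ?g = "free_gen i" and ?v = "free_word (red_word n v)" and ?w = "free_word (red_word n w)"
    have g: "?g \<in> carrier (free_alg n)" using assms(2) by (intro free_alg_consts)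
    have vc: "?v \<in> carrier (free_alg n)" using red_wordD(1)[OF v(1)] by (intro free_alg_consts)
    have vw: "hcong n (?g * ?v) ?w" using asc[OF v(1,2)] v(3) by simp
    have "hcong n (?g * ?w) (?g * (?g * ?v))" by (rule hcong_mult_left[OF hcong_sym[OF vw] g])
    also have "hcong n (?g * (?g * ?v)) ((1 + free_scalar zeta * ?g) * ?v)"
      using hcong_mult_right[OF hcong_relations(3)[OF assms(2)] vc] by (simp add: mult.assoc)
    also have "(1 + free_scalar zeta * ?g) * ?v = ?v + free_scalar zeta * (?g * ?v)"
      by (simp add: algebra_simps)
    also have "hcong n (?v + free_scalar zeta * (?g * ?v)) (?v + free_scalar zeta * ?w)"
      by (intro hcong_add hcong_refl hcong_mult_left vw free_alg_consts)
    finally show ?thesis using True by (simp add: v_def)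
  qed
qed

lemma gen_scalar: "free_gen i * (free_scalar a * f) = free_scalar a * (free_gen i * f)"
  by (simp only: mult.assoc[symmetric] free_scalar_simps(5))

lemma scalar_zeta: "free_scalar a * (free_scalar zeta * f) = free_scalar (zeta * a) * f"
  by (simp only: mult.assoc[symmetric] free_scalar_simps(3)[symmetric] mult.commute[of a])

text \<open>\<open>gen_red_word\<close> summed over all \<open>w\<close>, with one of the sums
  reindexed by \<open>s_i\<close>, reproduces the definition of \<open>Lop\<close>.\<close>

lemma gen_lift:
  assumes "i \<in> {1..<n}"
  shows "hcong n (free_gen i * lift n x) (lift n (Lop i x))"
proof -
  let ?t = "\<lambda>w. free_word (red_word n w)"
  have "free_gen i * lift n x = (\<Sum>w\<in>sym n. free_scalar (x w) * (free_gen i * ?t w))"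
    unfolding lift_def sum_distrib_left
    by (simp only: gen_scalar)
  also have "hcong n \<dots> (\<Sum>w\<in>sym n. free_scalar (x w) *
      (?t (simple_refl i \<circ> w) + (if desc i w then free_scalar zeta * ?t w else 0)))"
    by (intro hcong_sum hcong_mult_left gen_red_word assms free_alg_consts)
  also have "(\<Sum>w\<in>sym n. free_scalar (x w) *
      (?t (simple_refl i \<circ> w) + (if desc i w then free_scalar zeta * ?t w else 0))) =
      (\<Sum>w\<in>sym n. free_scalar (x w) * ?t (simple_refl i \<circ> w)) +
      (\<Sum>w\<in>sym n. if desc i w then free_scalar (zeta * x w) * ?t w else 0)"
    unfolding sum.distrib[symmetric]
    by (intro sum.cong refl) (simp add: distrib_left scalar_zeta)
  also have "(\<Sum>w\<in>sym n. free_scalar (x w) * ?t (simple_refl i \<circ> w)) =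
      (\<Sum>w\<in>sym n. free_scalar (x (simple_refl i \<circ> w)) * ?t w)"
    using sum_sym_simple_refl[OF assms, of "\<lambda>w. free_scalar (x (simple_refl i \<circ> w)) * ?t w"]
    by (simp only: simple_refl_comp_invol)
  also have "\<dots> + (\<Sum>w\<in>sym n. if desc i w then free_scalar (zeta * x w) * ?t w else 0) = lift n (Lop i x)"
    unfolding lift_def sum.distrib[symmetric]
    by (intro sum.cong refl) (simp add: Lop_def free_scalar_simps distrib_right)
  finally show ?thesis .
qed

lemma lift_Tb:
  assumes "w \<in> sym n"
  shows "lift n (Tb w) = free_word (red_word n w)"
proof -
  have "lift n (Tb w) = (\<Sum>v\<in>sym n. if w = v then free_word (red_word n w) else 0)"
    unfolding lift_def by (intro sum.cong refl) (auto simp: Tb_def free_scalar_simps)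
  then show ?thesis using assms by simp
qed

lemma lift_add: "lift n (x + y) = lift n x + lift n y"
  and lift_scl: "lift n (scl a x) = free_scalar a * lift n x"
  and lift_zero: "lift n 0 = 0"
  by (simp_all add: lift_def free_scalar_simps distrib_right sum.distrib sum_distrib_left mult.assoc)

lemma lift_sum: "lift n (sum f A) = (\<Sum>a\<in>A. lift n (f a))"
  by (induction A rule: infinite_finite_induct)
    (simp_all only: sum.infinite sum.empty sum.insert lift_add lift_zero not_False_eq_True)

lemma hcong_free_word_lift: "set js \<subseteq> {1..<n} \<Longrightarrow> hcong n (free_word js) (lift n (Lword js (Tb id)))"
proof (induction js)
  case Nil
  have "Lword [] (Tb id) = Tb id" by simp
  then show ?case unfolding lift_Tb[OF id_sym] by (simp only: lift_Tb[OF id_sym]) (rule hcong_red_word; simp)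
next
  case (Cons j js)
  have "hcong n (free_word js) (lift n (Lword js (Tb id)))"
    by (rule Cons.IH) (use Cons.prems in auto)
  then have "hcong n (free_gen j * free_word js) (free_gen j * lift n (Lword js (Tb id)))"
    using Cons.prems by (intro hcong_mult_left free_alg_consts) auto
  also have "hcong n \<dots> (lift n (Lop j (Lword js (Tb id))))"
    using Cons by (intro gen_lift) auto
  finally show ?case unfolding free_word_Cons foldr.simps comp_apply .
qed

lemma hcong_lift_act:
  assumes "f \<in> carrier (free_alg n)"
  shows "hcong n f (lift n (act f (Tb id)))"
proof -
  have s: "Poly_Mapping.single u a = free_scalar a * free_word (letters u)" for u a
    by (cases u) (simp add: free_scalar_def free_word_def mult_single)
  have "f = (\<Sum>u\<in>Poly_Mapping.keys f. free_scalar (Poly_Mapping.lookup f u) * free_word (letters u))"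
    using poly_mapping_expand[of f] unfolding s .
  also have "hcong n \<dots> (\<Sum>u\<in>Poly_Mapping.keys f. free_scalar (Poly_Mapping.lookup f u) *
      lift n (Lword (letters u) (Tb id)))"
    using assms unfolding free_alg_carrier
    by (intro hcong_sum hcong_mult_left hcong_free_word_lift free_alg_consts) auto
  also have "\<dots> = lift n (act f (Tb id))"
    unfolding act_def lift_sum lift_scl ..
  finally show ?thesis .
qed

text \<open>From left to right the ideal annihilates \<open>Tb id\<close>; from right to left both
  elements are congruent to the same normal form.\<close>

theorem hcong_iff_act:
  assumes "f \<in> carrier (free_alg n)" "g \<in> carrier (free_alg n)"
  shows "hcong n f g \<longleftrightarrow> act f (Tb id) = act g (Tb id)"
proof
  assume "hcong n f g"
  then have "act (f - g) (Tb id) = 0"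
    unfolding hcong_def by (rule act_hecke_ideal) (intro Fn_Tb id_sym)
  then show "act f (Tb id) = act g (Tb id)" by (simp add: act_diff)
next
  assume "act f (Tb id) = act g (Tb id)"
  then show "hcong n f g" using hcong_lift_act[OF assms(1)] hcong_lift_act[OF assms(2)]
    by (metis hcong_sym hcong_trans)
qed

lemma Lword_Tb:
  assumes "set js \<subseteq> {1..<n}" "reduced js"
  shows "Lword js (Tb id) = Tb (perm_of_word js)"
  using assms
proof (induction js)
  case Nil
  show ?case by (simp only: foldr.simps perm_of_word_simps id_apply)
next
  case (Cons j js)
  then have r: "reduced js" "\<not> desc j (perm_of_word js)" using reduced_Cons[of j js n] by auto
  have "Lword js (Tb id) = Tb (perm_of_word js)" by (rule Cons.IH) (use Cons.prems r in auto)
  then have "Lword (j # js) (Tb id) = Lop j (Tb (perm_of_word js))" by (simp only: foldr.simps comp_apply)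
  also have "\<dots> = Tb (perm_of_word (j # js))"
    unfolding Lop_Tb[OF bij_perm_of_word] perm_of_word_simps using r by simp
  finally show ?case .
qed

lemma act_lift:
  assumes "x \<in> Fn n"
  shows "act (lift n x) (Tb id) = x"
proof -
  have "act (lift n x) (Tb id) = (\<Sum>w\<in>sym n. scl (x w) (Tb w))"
    unfolding lift_def act_sum act_mult act_free_scalar act_free_word
    using Lword_Tb red_wordD by (intro sum.cong refl) metis
  then show ?thesis using hfun_expand[OF assms] by simp
qed

section \<open>Coordinates in the Hecke algebra\<close>

lemma hecke_ring: "ring (hecke n)"
  unfolding hecke_def by (rule ideal.quotient_is_ring[OF hecke_ideal_ideal])

lemma hecke_class_ring_hom: "hecke_class n \<in> ring_hom (free_alg n) (hecke n)"
  unfolding hecke_def hecke_class_def[abs_def] by (rule ideal.rcos_ring_hom[OF hecke_ideal_ideal])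

lemma hecke_class_carrier: "f \<in> carrier (free_alg n) \<Longrightarrow> hecke_class n f \<in> carrier (hecke n)"
  by (rule ring_hom_memE(1)[OF hecke_class_ring_hom])

lemma hecke_class_ops:
  assumes "f \<in> carrier (free_alg n)" "g \<in> carrier (free_alg n)"
  shows "hecke_class n f \<otimes>\<^bsub>hecke n\<^esub> hecke_class n g = hecke_class n (f * g)"
    "hecke_class n f \<oplus>\<^bsub>hecke n\<^esub> hecke_class n g = hecke_class n (f + g)"
  using ring_hom_memE[OF hecke_class_ring_hom] assms by simp_all

lemma hecke_one: "\<one>\<^bsub>hecke n\<^esub> = hecke_class n 1"
  using ring_hom_memE(4)[OF hecke_class_ring_hom] by simp

lemma hecke_zero: "\<zero>\<^bsub>hecke n\<^esub> = hecke_class n 0"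
  by (simp add: hecke_def FactRing_def hecke_class_def a_r_coset_def')

lemma hecke_carrierE:
  assumes "h \<in> carrier (hecke n)"
  obtains f where "f \<in> carrier (free_alg n)" "h = hecke_class n f"
  using assms unfolding hecke_def FactRing_def A_RCOSETS_def' hecke_class_def by auto

lemma hecke_scalar_carrier: "hecke_scalar n a \<in> carrier (hecke n)"
  unfolding hecke_scalar_def by (intro hecke_class_carrier free_alg_consts)

text \<open>The coordinates of \<open>h\<close> in the basis \<open>T_w\<close>, found by applying a
  representative to \<open>T_e\<close>. \<open>Psi_class\<close> shows independence of the choice;
  \<open>Phi\<close> is the inverse.\<close>

definition Psi :: "nat \<Rightarrow> hecke_elt \<Rightarrow> hfun"
  where "Psi n h = act (SOME f. f \<in> carrier (free_alg n) \<and> h = hecke_class n f) (Tb id)"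

definition Phi :: "nat \<Rightarrow> hfun \<Rightarrow> hecke_elt"
  where "Phi n x = hecke_class n (lift n x)"

lemma hecke_class_eq_iff_act:
  "f \<in> carrier (free_alg n) \<Longrightarrow> g \<in> carrier (free_alg n) \<Longrightarrow>
    hecke_class n f = hecke_class n g \<longleftrightarrow> act f (Tb id) = act g (Tb id)"
  unfolding hecke_class_eq_iff by (rule hcong_iff_act)

lemma Psi_class:
  assumes "f \<in> carrier (free_alg n)"
  shows "Psi n (hecke_class n f) = act f (Tb id)"
proof -
  let ?g = "SOME g. g \<in> carrier (free_alg n) \<and> hecke_class n f = hecke_class n g"
  have g: "?g \<in> carrier (free_alg n) \<and> hecke_class n f = hecke_class n ?g"
    by (rule someI[of _ f]) (use assms in simp)
  have "act f (Tb id) = act ?g (Tb id)"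
    using hecke_class_eq_iff_act[OF assms conjunct1[OF g]] conjunct2[OF g] by (rule iffD1)
  then show ?thesis unfolding Psi_def by (simp only:)
qed

lemma Psi_inj:
  assumes "h \<in> carrier (hecke n)" "h' \<in> carrier (hecke n)" "Psi n h = Psi n h'"
  shows "h = h'"
proof -
  obtain f g where "f \<in> carrier (free_alg n)" "h = hecke_class n f"
    "g \<in> carrier (free_alg n)" "h' = hecke_class n g"
    using assms(1,2) by (metis hecke_carrierE)
  then show ?thesis using assms(3) hecke_class_eq_iff_act by (simp add: Psi_class)
qed

lemma Fn_Psi: "h \<in> carrier (hecke n) \<Longrightarrow> Psi n h \<in> Fn n"
  by (erule hecke_carrierE) (simp only: Psi_class, intro Fn_act Fn_Tb id_sym)

lemma Phi_carrier [simp]: "Phi n x \<in> carrier (hecke n)"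
  unfolding Phi_def by (intro hecke_class_carrier lift_carrier)

lemma Psi_Phi: "x \<in> Fn n \<Longrightarrow> Psi n (Phi n x) = x"
  unfolding Phi_def by (simp only: Psi_class lift_carrier act_lift)

lemma Phi_eqI: "h \<in> carrier (hecke n) \<Longrightarrow> Psi n h = x \<Longrightarrow> h = Phi n x"
  by (rule Psi_inj[of _ n]) (use Fn_Psi Psi_Phi in auto)

lemma Psi_add:
  assumes "h \<in> carrier (hecke n)" "h' \<in> carrier (hecke n)"
  shows "Psi n (h \<oplus>\<^bsub>hecke n\<^esub> h') = Psi n h + Psi n h'"
proof -
  obtain f g where *: "f \<in> carrier (free_alg n)" "h = hecke_class n f"
    "g \<in> carrier (free_alg n)" "h' = hecke_class n g"
    using assms by (metis hecke_carrierE)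
  show ?thesis unfolding *(2,4) hecke_class_ops(2)[OF *(1,3)]
    by (simp only: Psi_class *(1,3) free_alg_closed act_add)
qed

lemma Psi_zero: "Psi n \<zero>\<^bsub>hecke n\<^esub> = 0"
  unfolding hecke_zero using Psi_class[OF free_alg_consts(1)] by simp

lemma Psi_mult_class:
  assumes "f \<in> carrier (free_alg n)" "h \<in> carrier (hecke n)"
  shows "Psi n (hecke_class n f \<otimes>\<^bsub>hecke n\<^esub> h) = act f (Psi n h)"
proof -
  obtain g where g: "g \<in> carrier (free_alg n)" "h = hecke_class n g" using assms hecke_carrierE by blast
  show ?thesis unfolding g(2) hecke_class_ops(1)[OF assms(1) g(1)]
    by (simp only: Psi_class assms(1) g(1) free_alg_closed act_mult)
qed

lemma Psi_scalar: "h \<in> carrier (hecke n) \<Longrightarrow> Psi n (hecke_scalar n a \<otimes>\<^bsub>hecke n\<^esub> h) = scl a (Psi n h)"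
  unfolding hecke_scalar_def by (simp only: Psi_mult_class free_alg_consts act_free_scalar)

lemma hecke_mult_closed:
  "h \<in> carrier (hecke n) \<Longrightarrow> h' \<in> carrier (hecke n) \<Longrightarrow> h \<otimes>\<^bsub>hecke n\<^esub> h' \<in> carrier (hecke n)"
  by (rule ring.ring_simprules(5)[OF hecke_ring])

lemma Psi_finsum:
  assumes "finite A" "\<And>a. a \<in> A \<Longrightarrow> f a \<in> carrier (hecke n)"
  shows "Psi n (\<Oplus>\<^bsub>hecke n\<^esub>a\<in>A. f a) = (\<Sum>a\<in>A. Psi n (f a))"
proof -
  interpret ring "hecke n" by (rule hecke_ring)
  show ?thesis
    using assms
  proof (induction A rule: finite_induct)
    case empty
    show ?case by (simp only: finsum_empty Psi_zero sum.empty)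
  next
    case (insert a A)
    have "(\<Oplus>\<^bsub>hecke n\<^esub>a\<in>insert a A. f a) = f a \<oplus>\<^bsub>hecke n\<^esub> (\<Oplus>\<^bsub>hecke n\<^esub>a\<in>A. f a)"
      using insert by (intro finsum_insert) auto
    moreover have "(\<Oplus>\<^bsub>hecke n\<^esub>a\<in>A. f a) \<in> carrier (hecke n)"
      using insert by (intro finsum_closed) auto
    moreover have "Psi n (\<Oplus>\<^bsub>hecke n\<^esub>a\<in>A. f a) = (\<Sum>a\<in>A. Psi n (f a))"
      by (rule insert.IH) (use insert.prems in blast)
    ultimately show ?case
      using insert.prems insert.hyps by (simp only: Psi_add insertI1 sum.insert not_False_eq_True)
  qed
qed

lemma Psi_lin_comb:
  assumes "finite Y" "\<And>y. y \<in> Y \<Longrightarrow> b y \<in> carrier (hecke n)"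
  shows "lin_comb n b a Y \<in> carrier (hecke n)"
    "Psi n (lin_comb n b a Y) = (\<Sum>y\<in>Y. scl (a y) (Psi n (b y)))"
proof -
  interpret ring "hecke n" by (rule hecke_ring)
  have c: "hecke_scalar n (a y) \<otimes>\<^bsub>hecke n\<^esub> b y \<in> carrier (hecke n)" if "y \<in> Y" for y
    by (intro hecke_mult_closed hecke_scalar_carrier assms(2) that)
  show "lin_comb n b a Y \<in> carrier (hecke n)"
    unfolding lin_comb_def using c by (intro finsum_closed) auto
  show "Psi n (lin_comb n b a Y) = (\<Sum>y\<in>Y. scl (a y) (Psi n (b y)))"
    unfolding lin_comb_def
    by (subst Psi_finsum[OF assms(1) c], assumption) (intro sum.cong refl Psi_scalar assms(2))
qed

lemma hecke_word_class:
  "set js \<subseteq> {1..<n} \<Longrightarrow> hecke_word n js = hecke_class n (free_word js)"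
proof (induction js)
  case Nil
  show ?case by (simp add: hecke_word_def hecke_one free_word_Nil)
next
  case (Cons j js)
  have "hecke_word n (j # js) = hecke_gen n j \<otimes>\<^bsub>hecke n\<^esub> hecke_word n js" by (simp add: hecke_word_def)
  also have "\<dots> = hecke_class n (free_gen j * free_word js)"
    using Cons unfolding hecke_gen_def by (subst Cons.IH) (auto intro!: hecke_class_ops(1) free_alg_consts)
  finally show ?case by (simp add: free_word_Cons)
qed

text \<open>The description defining \<open>hecke_T\<close> is unique because reduced words of one
  permutation are congruent.\<close>

lemma hecke_T_word:
  assumes "expression_of n js w" "reduced js"
  shows "hecke_T n w = hecke_class n (free_word js)"
proof -
  have js: "set js \<subseteq> {1..<n}" "perm_of_word js = w" using assms by (auto simp: expression_of_def)
  show ?thesis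
    unfolding hecke_T_def
  proof (rule the_equality)
    show "\<exists>ks. reduced_expression_of n ks w \<and> hecke_class n (free_word js) = hecke_word n ks"
      using assms js by (intro exI[of _ js]) (simp add: reduced_expression_iff hecke_word_class)
    fix t assume "\<exists>ks. reduced_expression_of n ks w \<and> t = hecke_word n ks"
    then obtain ks where ks: "expression_of n ks w" "reduced ks" "t = hecke_word n ks"
      by (auto simp: reduced_expression_iff)
    then have "set ks \<subseteq> {1..<n}" "perm_of_word ks = w" by (auto simp: expression_of_def)
    then show "t = hecke_class n (free_word js)"
      unfolding ks(3) using hcong_reduced_words[of ks n js] js assms(2) ks(2)
      by (simp add: hecke_word_class hecke_class_eq_iff)
  qed
qed

lemma hecke_T:
  assumes "w \<in> sym n"
  shows "hecke_T n w \<in> carrier (hecke n)" "Psi n (hecke_T n w) = Tb w"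
proof -
  note r = red_wordD[OF assms]
  have T: "hecke_T n w = hecke_class n (free_word (red_word n w))"
    using hecke_T_word red_word[OF assms] by blast
  show "hecke_T n w \<in> carrier (hecke n)"
    unfolding T using r by (intro hecke_class_carrier free_alg_consts)
  show "Psi n (hecke_T n w) = Tb w"
    unfolding T Psi_class[OF free_alg_consts(5)[OF r(1)]] act_free_word Lword_Tb[OF r(1,3)] r(2) ..
qed

lemma Linv_Lword_cancel:
  assumes "set js \<subseteq> {1..<n}" "x \<in> Fn n"
  shows "foldr Linv js (Lword (rev js) x) = x" "Lword (rev js) (foldr Linv js x) = x"
proof -
  show "foldr Linv js (Lword (rev js) x) = x"
    using assms
  proof (induction js arbitrary: x)
    case (Cons j js)
    have j: "j \<in> {1..<n}" "set js \<subseteq> {1..<n}" using Cons.prems by auto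
    have "foldr Linv js (Lword (rev js) (Lop j x)) = Lop j x"
      by (rule Cons.IH[OF j(2) Fn_Lop[OF Cons.prems(2) j(1)]])
    then show ?case using Lop_Linv(2)[OF Cons.prems(2) j(1)] by simp
  qed simp
  have Fn: "foldr Linv js x \<in> Fn n" if "set js \<subseteq> {1..<n}" for js
    using that by (induction js) (use assms(2) in \<open>auto intro!: Fn_Linv\<close>)
  show "Lword (rev js) (foldr Linv js x) = x"
    using assms(1)
  proof (induction js)
    case (Cons j js)
    have j: "j \<in> {1..<n}" "set js \<subseteq> {1..<n}" using Cons.prems by auto
    have "Lword (rev (j # js)) (foldr Linv (j # js) x) = Lword (rev js) (Lop j (Linv j (foldr Linv js x)))"
      by simp
    also have "\<dots> = Lword (rev js) (foldr Linv js x)" unfolding Lop_Linv(1)[OF Fn[OF j(2)] j(1)] ..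
    also have "\<dots> = x" by (rule Cons.IH[OF j(2)])
    finally show ?case .
  qed simp
qed

text \<open>Product of the inverses of the generators in the order of \<open>js\<close>, hence the
  inverse of the word \<open>rev js\<close>.\<close>

definition inv_word :: "nat list \<Rightarrow> free_elt"
  where "inv_word js = foldr (\<lambda>i f. (free_gen i - free_scalar zeta) * f) js 1"

lemma act_inv_word: "act (inv_word js) x = foldr Linv js x"
proof (induction js)
  case Nil
  show ?case by (simp add: inv_word_def)
next
  case (Cons j js)
  have "act (inv_word (j # js)) x = Linv j (act (inv_word js) x)"
    by (simp add: inv_word_def act_mult act_diff Linv_def)
  then show ?case using Cons.IH by simp
qed

lemma inv_word_carrier: "set js \<subseteq> {1..<n} \<Longrightarrow> inv_word js \<in> carrier (free_alg n)"
proof (induction js)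
  case Nil
  show ?case by (simp add: inv_word_def free_alg_consts)
next
  case (Cons j js)
  have "inv_word (j # js) = (free_gen j - free_scalar zeta) * inv_word js" by (simp add: inv_word_def)
  then show ?case using Cons by (auto intro!: free_alg_closed free_alg_consts)
qed

text \<open>A reduced word of \<open>w\<close>, reversed, is one of the inverse permutation.
  Inverting its \<open>T\<close> restores the original order, with each factor replaced by its
  inverse, which is the word operator defining \<open>Bb\<close>.\<close>

lemma inv_hecke_T:
  assumes "w \<in> sym n"
  shows "inv\<^bsub>hecke n\<^esub> (hecke_T n (pinv w)) \<in> carrier (hecke n)"
    "Psi n (inv\<^bsub>hecke n\<^esub> (hecke_T n (pinv w))) = Bb n w"
proof -
  let ?js = "red_word n w"
  note r = red_wordD[OF assms]
  have rev: "set (rev ?js) \<subseteq> {1..<n}" using r(1) by simp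
  have T: "hecke_T n (pinv w) = hecke_class n (free_word (rev ?js))"
    by (rule hecke_T_word) (use r rev perm_of_word_rev[of ?js] reduced_rev in \<open>auto simp: expression_of_def\<close>)
  have c: "free_word (rev ?js) \<in> carrier (free_alg n)" "inv_word ?js \<in> carrier (free_alg n)"
    by (rule free_alg_consts(5)[OF rev], rule inv_word_carrier[OF r(1)])
  have e: "Tb id \<in> Fn n" by (intro Fn_Tb id_sym)
  interpret ring "hecke n" by (rule hecke_ring)
  have "hecke_class n (inv_word ?js) = inv\<^bsub>hecke n\<^esub> (hecke_class n (free_word (rev ?js)))"
  proof (rule inv_unique')
    show "hecke_class n (free_word (rev ?js)) \<otimes>\<^bsub>hecke n\<^esub> hecke_class n (inv_word ?js) = \<one>\<^bsub>hecke n\<^esub>"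
      unfolding hecke_class_ops(1)[OF c] hecke_one
        hecke_class_eq_iff_act[OF free_alg_closed(3)[OF c] free_alg_consts(2)]
      using Linv_Lword_cancel(2)[OF r(1) e] by (simp only: act_mult act_inv_word act_free_word act_one)
    show "hecke_class n (inv_word ?js) \<otimes>\<^bsub>hecke n\<^esub> hecke_class n (free_word (rev ?js)) = \<one>\<^bsub>hecke n\<^esub>"
      unfolding hecke_class_ops(1)[OF c(2,1)] hecke_one
        hecke_class_eq_iff_act[OF free_alg_closed(3)[OF c(2,1)] free_alg_consts(2)]
      using Linv_Lword_cancel(1)[OF r(1) e] by (simp only: act_mult act_inv_word act_free_word act_one)
  qed (use c hecke_class_carrier in auto)
  then have inv: "inv\<^bsub>hecke n\<^esub> (hecke_T n (pinv w)) = hecke_class n (inv_word ?js)" unfolding T ..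
  show "inv\<^bsub>hecke n\<^esub> (hecke_T n (pinv w)) \<in> carrier (hecke n)"
    unfolding inv by (rule hecke_class_carrier[OF c(2)])
  show "Psi n (inv\<^bsub>hecke n\<^esub> (hecke_T n (pinv w))) = Bb n w"
    unfolding inv Psi_class[OF c(2)] act_inv_word
    by (rule Bb_word[symmetric]) (use red_word[OF assms] in auto)
qed

lemma sum_Tb_apply:
  assumes "finite A"
  shows "(\<Sum>w\<in>A. scl (a w) (Tb w)) v = (if v \<in> A then a v else 0)"
proof -
  have "(\<Sum>w\<in>A. a w * Tb w v) = (\<Sum>w\<in>A. if v = w then a v else 0)"
    by (intro sum.cong) (auto simp: Tb_def)
  then show ?thesis using assms by (simp add: sum_fun_apply)
qed

text \<open>The coefficient function in the definition is determined on \<open>sym n\<close> only,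
  but every admissible choice yields the same value, so the description is unique.\<close>

lemma hecke_bar_eq:
  assumes "h \<in> carrier (hecke n)"
  shows "hecke_bar n h = Phi n (beta n (Psi n h))"
proof -
  have val: "lin_comb n (\<lambda>w. inv\<^bsub>hecke n\<^esub> (hecke_T n (pinv w))) (\<lambda>w. laurent_bar (a w)) (sym n) =
      Phi n (beta n (Psi n h))" if h: "h = lin_comb n (hecke_T n) a (sym n)" for a
  proof (rule Phi_eqI)
    have "Psi n h = (\<Sum>w\<in>sym n. scl (a w) (Tb w))"
      unfolding h by (subst Psi_lin_comb(2)) (simp_all add: hecke_T cong: sum.cong)
    then have a: "Psi n h w = a w" if "w \<in> sym n" for w using that by (simp add: sum_Tb_apply)
    show "Psi n (lin_comb n (\<lambda>w. inv\<^bsub>hecke n\<^esub> (hecke_T n (pinv w))) (\<lambda>w. laurent_bar (a w)) (sym n)) =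
        beta n (Psi n h)"
      unfolding beta_def using a
      by (subst Psi_lin_comb(2)) (simp_all add: inv_hecke_T cong: sum.cong)
  qed (rule Psi_lin_comb(1), simp_all add: inv_hecke_T)
  have ex: "h = lin_comb n (hecke_T n) (Psi n h) (sym n)"
  proof (rule Psi_inj[OF assms])
    show "lin_comb n (hecke_T n) (Psi n h) (sym n) \<in> carrier (hecke n)"
      by (rule Psi_lin_comb(1)) (simp_all add: hecke_T)
    show "Psi n h = Psi n (lin_comb n (hecke_T n) (Psi n h) (sym n))"
      using hfun_expand[OF Fn_Psi[OF assms]]
      by (subst Psi_lin_comb(2)) (simp_all add: hecke_T cong: sum.cong)
  qed
  show ?thesis
    unfolding hecke_bar_def
  proof (rule the_equality)
    show "\<exists>a. h = lin_comb n (hecke_T n) a (sym n) \<and> Phi n (beta n (Psi n h)) =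
        lin_comb n (\<lambda>w. inv\<^bsub>hecke n\<^esub> (hecke_T n (pinv w))) (\<lambda>w. laurent_bar (a w)) (sym n)"
      using ex val[OF ex] by (intro exI[of _ "Psi n h"]) simp
  next
    fix h' assume "\<exists>a. h = lin_comb n (hecke_T n) a (sym n) \<and> h' =
        lin_comb n (\<lambda>w. inv\<^bsub>hecke n\<^esub> (hecke_T n (pinv w))) (\<lambda>w. laurent_bar (a w)) (sym n)"
    then show "h' = Phi n (beta n (Psi n h))" using val by blast
  qed
qed


subsection \<open>Kazhdan--Lusztig polynomials\<close>

definition kl_coeff :: "nat \<Rightarrow> int poly \<Rightarrow> laurent"
  where "kl_coeff L p = (- qv) ^ L * laurent_bar (poly (map_poly of_int p) (qv ^ 2))"

lemma lk_poly_qv: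
  "lk (poly (map_poly of_int p) (qv ^ 2)) k = (if 0 \<le> k \<and> even k then coeff p (nat (k div 2)) else 0)"
proof (induction p arbitrary: k)
  case 0
  show ?case by simp
next
  case (pCons c p)
  have "poly (map_poly of_int (pCons c p)) (qv ^ 2) = of_int c + qv * (qv * poly (map_poly of_int p) (qv ^ 2))"
    by (simp add: map_poly_pCons power2_eq_square mult.assoc)
  then have eq: "lk (poly (map_poly of_int (pCons c p)) (qv ^ 2)) k =
      (if k = 0 then c else 0) + lk (poly (map_poly of_int p) (qv ^ 2)) (k - 1 - 1)"
    by (simp add: lookup_add lookup_of_int when_def)
  consider "k < 0" | "k = 0" | "k = 1" | "2 \<le> k" by linarith
  then show ?case
  proof cases
    case 4
    then have "nat (k div 2) = Suc (nat ((k - 1 - 1) div 2))" by linarith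
    then show ?thesis unfolding eq pCons.IH using 4 by simp
  qed (unfold eq pCons.IH, auto)
qed

lemma minus_qv_power: "(- qv) ^ L = Poly_Mapping.single (int L) ((- 1) ^ L)"
proof -
  have "- qv = Poly_Mapping.single 1 (- 1)" by (simp only: qv_def single_uminus)
  moreover have "Poly_Mapping.single 1 (- 1) ^ L = Poly_Mapping.single (int L) ((- 1) ^ L)"
    by (induction L) (simp_all add: mult_single)
  ultimately show ?thesis by (simp only:)
qed

text \<open>The term of degree \<open>i\<close> contributes to the exponent \<open>L - 2 i\<close>,
  so the exponent \<open>k\<close> belongs to the degree \<open>(L - k) / 2\<close>.\<close>

lemma lk_kl_coeff:
  "lk (kl_coeff L p) k = (if k \<le> int L \<and> even (int L - k) then (- 1) ^ L * coeff p (nat ((int L - k) div 2)) else 0)"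
  unfolding kl_coeff_def minus_qv_power lk_single_mult lk_bar lk_poly_qv by simp

lemma kl_coeff_inj:
  assumes "kl_coeff L p = kl_coeff L p'"
  shows "p = p'"
proof (rule poly_eqI)
  fix i
  have "lk (kl_coeff L p) (int L - 2 * int i) = lk (kl_coeff L p') (int L - 2 * int i)" using assms by simp
  then show "coeff p i = coeff p' i" unfolding lk_kl_coeff by simp
qed

lemma kl_coeff_0_1: "kl_coeff 0 1 = 1"
  by (rule poly_mapping_eqI) (auto simp: lk_kl_coeff lookup_one when_def)

lemma kl_coeff_exponents:
  assumes "2 * Polynomial.degree p + 1 \<le> L"
  shows "kl_exponents (int L) (kl_coeff L p)" "lk (kl_coeff L p) 0 = 0"
proof -
  have *: "1 \<le> k \<and> k \<le> int L \<and> even (k - int L)" if "lk (kl_coeff L p) k \<noteq> 0" for k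
  proof -
    have k: "k \<le> int L" "even (int L - k)" "coeff p (nat ((int L - k) div 2)) \<noteq> 0"
      using that unfolding lk_kl_coeff by (auto split: if_splits)
    then have d: "nat ((int L - k) div 2) \<le> Polynomial.degree p" by (intro le_degree)
    obtain j where j: "int L - k = 2 * j" using k(2) by (elim evenE)
    then have "j \<le> int (Polynomial.degree p)" using d by (simp add: nat_le_iff)
    then have "1 \<le> k" using assms j by linarith
    then show ?thesis using k by auto
  qed
  show "kl_exponents (int L) (kl_coeff L p)" unfolding kl_exponents_def using * by force
  show "lk (kl_coeff L p) 0 = 0" using *[of 0] by force
qed

lemma exists_kl_coeff:
  assumes "kl_exponents (int L) a" "lk a 0 = 0" "1 \<le> L"
  shows "\<exists>p. 2 * Polynomial.degree p + 1 \<le> L \<and> kl_coeff L p = a"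
proof -
  \<comment> \<open>The sign is its own inverse, and \<open>i < (L + 1) div 2\<close> is the
    condition \<open>L - 2 i >= 1\<close>, the range left by the vanishing constant term.\<close>
  define p where "p = Poly (map (\<lambda>i. (- 1) ^ L * lk a (int L - 2 * int i)) [0..<(L + 1) div 2])"
  have coeff: "coeff p i = (- 1) ^ L * lk a (int L - 2 * int i)" for i
  proof (cases "i < (L + 1) div 2")
    case True
    then show ?thesis by (simp add: p_def coeff_Poly_eq nth_default_def)
  next
    case False
    then have "int L - 2 * int i \<le> 0" by linarith
    then have "lk a (int L - 2 * int i) = 0"
      using assms(1,2) unfolding kl_exponents_def by (metis order_antisym)
    then show ?thesis using False by (simp add: p_def coeff_Poly_eq nth_default_def)
  qed
  have "2 * Polynomial.degree p + 1 \<le> L"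
  proof -
    have "coeff p i = 0" if "(L - 1) div 2 < i" for i
    proof -
      have "int L - 2 * int i \<le> 0" using that by linarith
      then have "lk a (int L - 2 * int i) = 0"
        using assms(1,2) unfolding kl_exponents_def by (metis order_antisym)
      then show ?thesis unfolding coeff by simp
    qed
    then have "Polynomial.degree p \<le> (L - 1) div 2" by (intro degree_le) auto
    then show ?thesis using assms(3) by linarith
  qed
  moreover have "kl_coeff L p = a"
  proof (rule poly_mapping_eqI)
    fix k
    show "lk (kl_coeff L p) k = lk a k"
    proof (cases "k \<le> int L \<and> even (int L - k)")
      case True
      then have "int L - 2 * int (nat ((int L - k) div 2)) = k" by (auto elim!: evenE)
      then show ?thesis unfolding lk_kl_coeff coeff using True
        by (simp add: mult.assoc[symmetric] power_mult_distrib[symmetric])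
    next
      case False
      have "lk a k = 0"
      proof (rule ccontr)
        assume "lk a k \<noteq> 0"
        then have "k \<le> int L \<and> even (k - int L)" using assms(1) by (auto simp: kl_exponents_def)
        then show False using False by (metis dvd_minus_iff minus_diff_eq)
      qed
      then show ?thesis unfolding lk_kl_coeff using False by auto
    qed
  qed
  ultimately show ?thesis by blast
qed

lemma finite_bruhat: "finite {y. bruhat_le n y w}"
  by (rule finite_subset[OF _ finite_sym[of n]]) (auto simp: bruhat_le_def)

text \<open>The bridge from the definition to coordinates. Values of \<open>P\<close> outside the
  Bruhat interval below \<open>w\<close> stay unconstrained.\<close>

lemma is_kl_iff:
  assumes w: "w \<in> sym n"
  shows "is_kl n w P C \<longleftrightarrow> C \<in> carrier (hecke n) \<and> is_C n w (Psi n C) \<and> P w = 1 \<and>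
    (\<forall>y. bruhat_le n y w \<longrightarrow> Psi n C y = kl_coeff (ell w - ell y) (P y)) \<and>
    (\<forall>y. bruhat_less n y w \<longrightarrow> 2 * Polynomial.degree (P y) + 1 \<le> ell w - ell y)"
proof -
  let ?B = "{y. bruhat_le n y w}"
  let ?c = "\<lambda>y. kl_coeff (ell w - ell y) (P y)"
  have B: "y \<in> sym n" if "y \<in> ?B" for y using that by (simp add: bruhat_le_def)
  have len: "len n w - len n y = ell w - ell y" if "y \<in> sym n" for y using w that by (simp add: len_eq_ell)
  have lc_eq: "lin_comb n (hecke_T n) (\<lambda>y. (- qv) ^ (len n w - len n y) *
      laurent_bar (poly (map_poly of_int (P y)) (qv ^ 2))) ?B = lin_comb n (hecke_T n) ?c ?B"
  proof -
    interpret ring "hecke n" by (rule hecke_ring)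
    show ?thesis unfolding lin_comb_def
      by (rule finsum_cong') (use len B hecke_T(1) in \<open>auto simp: kl_coeff_def intro!: hecke_mult_closed hecke_scalar_carrier\<close>)
  qed
  have lc: "lin_comb n (hecke_T n) ?c ?B \<in> carrier (hecke n)"
    "Psi n (lin_comb n (hecke_T n) ?c ?B) = (\<Sum>y\<in>?B. scl (?c y) (Tb y))"
  proof -
    show "lin_comb n (hecke_T n) ?c ?B \<in> carrier (hecke n)"
      by (rule Psi_lin_comb(1)[OF finite_bruhat]) (rule hecke_T(1)[OF B])
    show "Psi n (lin_comb n (hecke_T n) ?c ?B) = (\<Sum>y\<in>?B. scl (?c y) (Tb y))"
      by (subst Psi_lin_comb(2)[OF finite_bruhat], rule hecke_T(1)[OF B], assumption)
        (intro sum.cong refl, simp only: hecke_T(2)[OF B])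
  qed
  have lc_apply: "Psi n (lin_comb n (hecke_T n) ?c ?B) y = (if bruhat_le n y w then ?c y else 0)" for y
    unfolding lc(2) by (simp add: sum_Tb_apply[OF finite_bruhat])
  have deg: "(\<forall>y. bruhat_less n y w \<longrightarrow> 2 * Polynomial.degree (P y) + 1 \<le> len n w - len n y) \<longleftrightarrow>
      (\<forall>y. bruhat_less n y w \<longrightarrow> 2 * Polynomial.degree (P y) + 1 \<le> ell w - ell y)"
    using len by (auto simp: bruhat_less_def bruhat_le_def)
  show ?thesis
  proof
    assume kl: "is_kl n w P C"
    then have C: "C = lin_comb n (hecke_T n) ?c ?B" "hecke_bar n C = C" "P w = 1"
      and d: "\<forall>y. bruhat_less n y w \<longrightarrow> 2 * Polynomial.degree (P y) + 1 \<le> ell w - ell y"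
      unfolding is_kl_def lc_eq deg by auto
    have Cc: "C \<in> carrier (hecke n)" unfolding C(1) by (rule lc(1))
    have app: "Psi n C y = (if bruhat_le n y w then ?c y else 0)" for y unfolding C(1) by (rule lc_apply)
    have "is_C n w (Psi n C)"
      unfolding is_C_def
    proof (intro conjI allI impI)
      show "Psi n C \<in> Fn n" by (rule Fn_Psi[OF Cc])
      have "Psi n (Phi n (beta n (Psi n C))) = Psi n C" using C(2) hecke_bar_eq[OF Cc] by simp
      then show "beta n (Psi n C) = Psi n C" by (simp add: Psi_Phi Fn_beta)
      show "Psi n C w = 1" using w C(3) by (simp add: app kl_coeff_0_1)
      show "bruhat_le n y w" if "Psi n C y \<noteq> 0" for y using that by (auto simp: app split: if_splits)
      fix y assume "y \<noteq> w"
      then have "bruhat_less n y w" if "bruhat_le n y w" using that by (simp add: bruhat_less_def)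
      then have "kl_exponents (int (ell w - ell y)) (?c y) \<and> lk (?c y) 0 = 0 \<and> ell y < ell w" if "bruhat_le n y w"
        using kl_coeff_exponents d that bruhat_less_ell by blast
      then show "kl_exponents (int (ell w) - int (ell y)) (Psi n C y)" "lk (Psi n C y) 0 = 0"
        by (auto simp: app of_nat_diff)
    qed
    then show "C \<in> carrier (hecke n) \<and> is_C n w (Psi n C) \<and> P w = 1 \<and>
        (\<forall>y. bruhat_le n y w \<longrightarrow> Psi n C y = ?c y) \<and>
        (\<forall>y. bruhat_less n y w \<longrightarrow> 2 * Polynomial.degree (P y) + 1 \<le> ell w - ell y)"
      using Cc C(3) d by (simp add: app)
  next
    assume R: "C \<in> carrier (hecke n) \<and> is_C n w (Psi n C) \<and> P w = 1 \<and>
        (\<forall>y. bruhat_le n y w \<longrightarrow> Psi n C y = ?c y) \<and>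
        (\<forall>y. bruhat_less n y w \<longrightarrow> 2 * Polynomial.degree (P y) + 1 \<le> ell w - ell y)"
    then have isC: "is_C n w (Psi n C)" and Cc: "C \<in> carrier (hecke n)" by auto
    have "C = lin_comb n (hecke_T n) ?c ?B"
    proof (rule Psi_inj[OF Cc lc(1)], rule ext)
      fix y show "Psi n C y = Psi n (lin_comb n (hecke_T n) ?c ?B) y"
        unfolding lc_apply using R is_C_D(5)[OF isC, of y] by auto
    qed
    moreover have "hecke_bar n C = C"
      unfolding hecke_bar_eq[OF Cc] is_C_D(2)[OF isC] by (rule Phi_eqI[symmetric]) (use Cc in auto)
    ultimately show "is_kl n w P C" unfolding is_kl_def lc_eq deg using R by blast
  qed
qed

lemma exists_is_kl:
  assumes w: "w \<in> sym n"
  shows "\<exists>P. is_kl n w P (Phi n (KL n w))"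
proof -
  note K = KL_D[OF w]
  have "\<exists>p. 2 * Polynomial.degree p + 1 \<le> ell w - ell y \<and> kl_coeff (ell w - ell y) p = KL n w y"
    if "bruhat_less n y w" for y
  proof -
    have l: "ell y < ell w" using bruhat_less_ell[OF that] .
    have "y \<noteq> w" using that by (simp add: bruhat_less_def)
    then show ?thesis using l K(7,8)[of y] by (intro exists_kl_coeff) (auto simp: of_nat_diff)
  qed
  then obtain Q where Q: "\<And>y. bruhat_less n y w \<Longrightarrow> 2 * Polynomial.degree (Q y) + 1 \<le> ell w - ell y"
      "\<And>y. bruhat_less n y w \<Longrightarrow> kl_coeff (ell w - ell y) (Q y) = KL n w y" by metis
  \<comment> \<open>\<open>Q\<close> was obtained strictly below \<open>w\<close> only; the value at
    \<open>w\<close> is prescribed.\<close>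
  define P where "P = Q(w := 1)"
  have "is_kl n w P (Phi n (KL n w))"
    unfolding is_kl_iff[OF w] Psi_Phi[OF K(1)]
  proof (intro conjI allI impI)
    fix y assume le: "bruhat_le n y w"
    show "KL n w y = kl_coeff (ell w - ell y) (P y)"
      using le Q(2)[of y] K(3) by (cases "y = w") (auto simp: P_def bruhat_less_def kl_coeff_0_1)
  next
    fix y assume le: "bruhat_less n y w"
    then show "2 * Polynomial.degree (P y) + 1 \<le> ell w - ell y"
      using Q(1)[of y] by (auto simp: P_def bruhat_less_def)
  qed (use is_C_KL[OF w] in \<open>simp_all add: P_def\<close>)
  then show ?thesis by blast
qed

lemma kl_basis_eq:
  assumes w: "w \<in> sym n"
  shows "kl_basis n w = Phi n (KL n w)"
  unfolding kl_basis_def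
proof (rule the_equality)
  show "\<exists>P. is_kl n w P (Phi n (KL n w))" by (rule exists_is_kl[OF w])
next
  fix C assume "\<exists>P. is_kl n w P C"
  then have "C \<in> carrier (hecke n)" "is_C n w (Psi n C)" unfolding is_kl_iff[OF w] by auto
  then show "C = Phi n (KL n w)" using KL_eqI by (intro Phi_eqI) auto
qed

lemma kl_basis_carrier: "w \<in> sym n \<Longrightarrow> kl_basis n w \<in> carrier (hecke n)"
  and Psi_kl_basis: "w \<in> sym n \<Longrightarrow> Psi n (kl_basis n w) = KL n w"
  by (simp_all add: kl_basis_eq Psi_Phi KL_D(1))

text \<open>The polynomial is determined by the coefficient because \<open>kl_coeff\<close> is
  injective, so the definite description has a unique solution.\<close>

lemma kl_poly_props:
  assumes w: "w \<in> sym n" and y: "bruhat_less n y w"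
  shows "kl_coeff (ell w - ell y) (kl_poly n y w) = KL n w y"
    "2 * Polynomial.degree (kl_poly n y w) + 1 \<le> ell w - ell y"
proof -
  have le: "bruhat_le n y w" using y by (simp add: bruhat_less_def)
  obtain P where P: "is_kl n w P (kl_basis n w)" using exists_is_kl[OF w] kl_basis_eq[OF w] by auto
  have coeff: "KL n w y = kl_coeff (ell w - ell y) (Q y)" if "is_kl n w Q (kl_basis n w)" for Q
    using that le unfolding is_kl_iff[OF w] Psi_kl_basis[OF w] by blast
  have "kl_poly n y w = P y"
    unfolding kl_poly_def
  proof (rule the_equality)
    show "\<exists>Q. is_kl n w Q (kl_basis n w) \<and> P y = Q y" using P by blast
    fix p assume "\<exists>Q. is_kl n w Q (kl_basis n w) \<and> p = Q y"
    then show "p = P y" using coeff P kl_coeff_inj by metis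
  qed
  then show "kl_coeff (ell w - ell y) (kl_poly n y w) = KL n w y"
    "2 * Polynomial.degree (kl_poly n y w) + 1 \<le> ell w - ell y"
    using coeff[OF P] P y unfolding is_kl_iff[OF w] by auto
qed

text \<open>The exponent \<open>1\<close> belongs to the degree \<open>(L - 1) / 2\<close>, the
  largest one allowed. The coefficient of \<open>q\<close> is therefore nonzero exactly when
  \<open>L\<close> is odd and this degree is attained by a nonzero polynomial.\<close>

lemma kl_prec_iff:
  "kl_prec n y w \<longleftrightarrow> w \<in> sym n \<and> lk (KL n w y) 1 \<noteq> 0"
proof (cases "w \<in> sym n")
  case False
  then show ?thesis by (simp add: kl_prec_def bruhat_less_def bruhat_le_def)
next
  case w: True
  show ?thesis
  proof
    assume prec: "kl_prec n y w"
    then have le: "bruhat_less n y w" by (simp add: kl_prec_def)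
    then have y: "y \<in> sym n" by (simp add: bruhat_less_def bruhat_le_def)
    let ?p = "kl_poly n y w" and ?L = "ell w - ell y"
    have L: "?p \<noteq> 0" "2 * Polynomial.degree ?p + 1 = ?L"
      using prec w y by (simp_all add: kl_prec_def len_eq_ell)
    then have "int ?L - 1 = 2 * int (Polynomial.degree ?p)" by linarith
    then have "lk (kl_coeff ?L ?p) 1 = (- 1) ^ ?L * lead_coeff ?p"
      unfolding lk_kl_coeff using L(2) by simp
    then show "w \<in> sym n \<and> lk (KL n w y) 1 \<noteq> 0" using kl_poly_props(1)[OF w le] L(1) w by simp
  next
    assume nz: "w \<in> sym n \<and> lk (KL n w y) 1 \<noteq> 0"
    note K = lk_kl_nonzero_parity[of n w "KL n w" y, OF is_C_KL[OF w] conjunct2[OF nz]]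
    have le: "bruhat_less n y w" using KL_D(5)[OF w K(2)] K(1) by (simp add: bruhat_less_def)
    let ?p = "kl_poly n y w" and ?L = "ell w - ell y"
    have k: "lk (kl_coeff ?L ?p) 1 \<noteq> 0" using nz kl_poly_props(1)[OF w le] by simp
    then have c: "even (int ?L - 1)" "coeff ?p (nat ((int ?L - 1) div 2)) \<noteq> 0"
      unfolding lk_kl_coeff by (auto split: if_splits)
    then have d: "nat ((int ?L - 1) div 2) \<le> Polynomial.degree ?p" by (intro le_degree)
    obtain j where j: "int ?L - 1 = 2 * j" using c(1) by (rule evenE)
    have "j \<le> int (Polynomial.degree ?p)" using d unfolding j by (simp add: nat_le_iff)
    then have "?L \<le> 2 * Polynomial.degree ?p + 1" using j by linarith
    moreover have "?p \<noteq> 0" using c(2) by auto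
    moreover have "odd ?L" using c(1) by simp
    ultimately show "kl_prec n y w"
      unfolding kl_prec_def using le kl_poly_props(2)[OF w le] w K(4) by (simp add: len_eq_ell)
  qed
qed

lemma kl_le_iff: "kl_le n y w \<longleftrightarrow> w \<in> sym n \<and> left_le n y w"
proof -
  have edge: "(\<lambda>y z. kl_edge n y z \<and> \<not> descents n y \<subseteq> descents n z) = left_edge n"
  proof (intro ext)
    fix y z
    have "y \<in> sym n \<and> z \<in> sym n" if "kl_edge n y z"
      using that by (auto simp: kl_edge_def kl_prec_def bruhat_less_def bruhat_le_def)
    then show "(kl_edge n y z \<and> \<not> descents n y \<subseteq> descents n z) = left_edge n y z"
      by (auto simp: left_edge_def kl_edge_def kl_prec_iff descents_eq)
  qed
  show ?thesis unfolding kl_le_def edge using left_le_sym by blast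
qed

section \<open>Subquotients of a ring as left modules\<close>

locale left_ideal_pair = R?: ring R
  for R :: "('a, 'r) ring_scheme" (structure) +
  fixes D D' :: "'a set"
  assumes D: "additive_subgroup D R" and D': "additive_subgroup D' R" and D'_D: "D' \<subseteq> D"
    and D_left: "\<And>h x. h \<in> carrier R \<Longrightarrow> x \<in> D \<Longrightarrow> h \<otimes> x \<in> D"
    and D'_left: "\<And>h x. h \<in> carrier R \<Longrightarrow> x \<in> D' \<Longrightarrow> h \<otimes> x \<in> D'"
begin

abbreviation subquotient :: "('a, 'a set) module"
  where "subquotient \<equiv>
    \<lparr> carrier = (\<lambda>x. D' +> x) ` D, monoid.mult = undefined, one = undefined, zero = D', add = set_add R,
      module.smult = (\<lambda>h A. \<Union>x\<in>A. D' +> (h \<otimes> x)) \<rparr>"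

lemma D_carrier: "x \<in> D \<Longrightarrow> x \<in> carrier R"
  using additive_subgroup.a_Hcarr[OF D] .

lemma D'_carrier: "x \<in> D' \<Longrightarrow> x \<in> carrier R"
  using additive_subgroup.a_Hcarr[OF D'] .

lemma abelian_subgroup_D': "abelian_subgroup D' R"
  by (rule abelian_subgroupI3[OF D' R.is_abelian_group])

lemma coset_add: "x \<in> carrier R \<Longrightarrow> y \<in> carrier R \<Longrightarrow> (D' +> x) <+> (D' +> y) = D' +> (x \<oplus> y)"
  by (rule abelian_subgroup.a_rcos_sum[OF abelian_subgroup_D'])

lemma mem_coset: "y \<in> D' +> x \<longleftrightarrow> (\<exists>d\<in>D'. y = d \<oplus> x)"
  by (auto simp: a_r_coset_def')

lemma coset_eqI: "x \<in> carrier R \<Longrightarrow> d \<in> D' \<Longrightarrow> D' +> (d \<oplus> x) = D' +> x"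
  by (rule abelian_subgroup.a_repr_independence'[OF abelian_subgroup_D', symmetric]) (auto simp: mem_coset)

lemma coset_zero: "D' +> \<zero> = D'"
  using R.a_coset_add_zero[of D'] D'_carrier by blast

lemma coset_of_D': "d \<in> D' \<Longrightarrow> D' +> d = D'"
  using coset_eqI[of \<zero> d] D'_carrier coset_zero by simp

lemma coset_self: "x \<in> carrier R \<Longrightarrow> x \<in> D' +> x"
  by (rule abelian_subgroup.a_rcos_self[OF abelian_subgroup_D'])

lemma coset_eq_iff:
  assumes "x \<in> carrier R" "y \<in> carrier R"
  shows "D' +> x = D' +> y \<longleftrightarrow> (\<exists>d\<in>D'. x = d \<oplus> y)"
proof
  assume "D' +> x = D' +> y"
  then have "x \<in> D' +> y" using coset_self[OF assms(1)] by simp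
  then show "\<exists>d\<in>D'. x = d \<oplus> y" by (simp only: mem_coset)
qed (use coset_eqI assms in auto)

text \<open>Representatives differ by elements of \<open>D'\<close>, which \<open>h\<close> maps
  into \<open>D'\<close>; so all cosets in the union coincide.\<close>

lemma coset_smult:
  assumes "h \<in> carrier R" "x \<in> carrier R"
  shows "(\<Union>z\<in>D' +> x. D' +> (h \<otimes> z)) = D' +> (h \<otimes> x)"
proof -
  have "D' +> (h \<otimes> z) = D' +> (h \<otimes> x)" if "z \<in> D' +> x" for z
  proof -
    obtain d where d: "d \<in> D'" "z = d \<oplus> x" using \<open>z \<in> D' +> x\<close> by (auto simp: mem_coset)
    have "h \<otimes> z = h \<otimes> d \<oplus> h \<otimes> x" unfolding d(2) using assms D'_carrier[OF d(1)] by (intro R.r_distr)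
    then show ?thesis using coset_eqI[of "h \<otimes> x" "h \<otimes> d"] assms d(1) D'_left by simp
  qed
  then show ?thesis using coset_self[OF assms(2)] by blast
qed

lemma D_closed: "x \<in> D \<Longrightarrow> y \<in> D \<Longrightarrow> x \<oplus> y \<in> D" "\<zero> \<in> D" "x \<in> D \<Longrightarrow> \<ominus> x \<in> D"
  using additive_subgroup.a_closed[OF D] additive_subgroup.zero_closed[OF D]
    additive_subgroup.a_inv_closed[OF D] by auto

lemma subquotient_abelian_group: "abelian_group subquotient"
proof (rule abelian_groupI)
  fix A B assume "A \<in> carrier subquotient" "B \<in> carrier subquotient"
  then obtain x y where x: "x \<in> D" "A = D' +> x" and y: "y \<in> D" "B = D' +> y" by auto
  note xc = D_carrier[OF x(1)] and yc = D_carrier[OF y(1)]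
  show "A \<oplus>\<^bsub>subquotient\<^esub> B \<in> carrier subquotient"
    using coset_add[OF xc yc] D_closed(1)[OF x(1) y(1)] by (simp add: x(2) y(2))
  show "A \<oplus>\<^bsub>subquotient\<^esub> B = B \<oplus>\<^bsub>subquotient\<^esub> A"
    using coset_add[OF xc yc] coset_add[OF yc xc] R.a_comm[OF xc yc] by (simp add: x(2) y(2))
  fix C assume "C \<in> carrier subquotient"
  then obtain z where z: "z \<in> D" "C = D' +> z" by auto
  note zc = D_carrier[OF z(1)]
  show "A \<oplus>\<^bsub>subquotient\<^esub> B \<oplus>\<^bsub>subquotient\<^esub> C = A \<oplus>\<^bsub>subquotient\<^esub> (B \<oplus>\<^bsub>subquotient\<^esub> C)"
    using xc yc zc by (simp add: x(2) y(2) z(2) coset_add R.a_assoc)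
next
  show "\<zero>\<^bsub>subquotient\<^esub> \<in> carrier subquotient"
    using D_closed(2) coset_zero by (auto intro: image_eqI[of _ _ \<zero>])
next
  fix A assume "A \<in> carrier subquotient"
  then obtain x where x: "x \<in> D" "A = D' +> x" by auto
  note xc = D_carrier[OF x(1)]
  have "D' <+> (D' +> x) = D' +> x" using coset_add[OF R.zero_closed xc] xc by (simp add: coset_zero)
  then show "\<zero>\<^bsub>subquotient\<^esub> \<oplus>\<^bsub>subquotient\<^esub> A = A" by (simp add: x(2))
  have "(D' +> (\<ominus> x)) <+> (D' +> x) = D'"
    using coset_add[of "\<ominus> x" x] xc by (simp add: R.l_neg coset_zero)
  then show "\<exists>B\<in>carrier subquotient. B \<oplus>\<^bsub>subquotient\<^esub> A = \<zero>\<^bsub>subquotient\<^esub>"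
    using D_closed(3)[OF x(1)] by (auto simp: x(2))
qed

lemma subquotient_left_module: "left_module R subquotient"
proof (intro left_module.intro left_module_axioms.intro)
  show "ring R" by (rule R.ring_axioms)
  show "abelian_group subquotient" by (rule subquotient_abelian_group)
next
  fix a b A B assume a: "a \<in> carrier R" and "A \<in> carrier subquotient"
  then obtain x where x: "x \<in> D" "A = D' +> x" by auto
  note xc = D_carrier[OF x(1)]
  show "a \<odot>\<^bsub>subquotient\<^esub> A \<in> carrier subquotient"
    using D_left[OF a x(1)] by (simp add: x(2) coset_smult[OF a xc])
  show "(a \<oplus> b) \<odot>\<^bsub>subquotient\<^esub> A = a \<odot>\<^bsub>subquotient\<^esub> A \<oplus>\<^bsub>subquotient\<^esub> b \<odot>\<^bsub>subquotient\<^esub> A"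
    if b: "b \<in> carrier R"
    using a b xc by (simp add: x(2) coset_smult coset_add R.l_distr)
  show "(a \<otimes> b) \<odot>\<^bsub>subquotient\<^esub> A = a \<odot>\<^bsub>subquotient\<^esub> (b \<odot>\<^bsub>subquotient\<^esub> A)"
    if b: "b \<in> carrier R"
    using a b xc by (simp add: x(2) coset_smult R.m_assoc)
  assume "B \<in> carrier subquotient"
  then obtain y where y: "y \<in> D" "B = D' +> y" by auto
  note yc = D_carrier[OF y(1)]
  show "a \<odot>\<^bsub>subquotient\<^esub> (A \<oplus>\<^bsub>subquotient\<^esub> B) = a \<odot>\<^bsub>subquotient\<^esub> A \<oplus>\<^bsub>subquotient\<^esub> a \<odot>\<^bsub>subquotient\<^esub> B"
    using a xc yc by (simp add: x(2) y(2) coset_smult coset_add R.r_distr)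
next
  fix A assume "A \<in> carrier subquotient"
  then obtain x where x: "x \<in> D" "A = D' +> x" by auto
  show "\<one> \<odot>\<^bsub>subquotient\<^esub> A = A"
    using coset_smult[OF R.one_closed D_carrier[OF x(1)]] D_carrier[OF x(1)] by (simp add: x(2))
qed

end

lemma restrict_scalars_simps [simp]:
  "carrier (restrict_scalars f M) = carrier M" "\<zero>\<^bsub>restrict_scalars f M\<^esub> = \<zero>\<^bsub>M\<^esub>"
  "x \<oplus>\<^bsub>restrict_scalars f M\<^esub> y = x \<oplus>\<^bsub>M\<^esub> y" "b \<odot>\<^bsub>restrict_scalars f M\<^esub> x = f b \<odot>\<^bsub>M\<^esub> x"
  by (simp_all add: restrict_scalars_def)

lemma restrict_scalars_left_module:
  fixes M :: "('a, 'm) module"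
  assumes "left_module S M" "ring R" "f \<in> ring_hom R S"
  shows "left_module R (restrict_scalars f M)"
proof -
  interpret left_module S M by fact
  interpret Q: ring R by fact
  show ?thesis
  proof (intro left_module.intro left_module_axioms.intro)
    show "abelian_group (restrict_scalars f M)"
    proof (rule abelian_groupI)
      fix x assume "x \<in> carrier (restrict_scalars f M)"
      then show "\<exists>y\<in>carrier (restrict_scalars f M). y \<oplus>\<^bsub>restrict_scalars f M\<^esub> x = \<zero>\<^bsub>restrict_scalars f M\<^esub>"
        by (intro bexI[of _ "\<ominus>\<^bsub>M\<^esub> x"]) (simp_all add: M.l_neg)
    qed (simp_all add: M.a_assoc M.a_comm M.a_lcomm)
  qed (use ring_hom_memE[OF assms(3)] Q.ring_axioms in
    \<open>simp_all add: lsmult_closed lsmult_l_distr lsmult_r_distr lsmult_assoc lsmult_one\<close>)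
qed


section \<open>Cell modules in coordinates\<close>

lemma hecke_add_closed:
  "h \<in> carrier (hecke n) \<Longrightarrow> h' \<in> carrier (hecke n) \<Longrightarrow> h \<oplus>\<^bsub>hecke n\<^esub> h' \<in> carrier (hecke n)"
  by (rule ring.ring_simprules(1)[OF hecke_ring])

lemma Psi_a_inv:
  assumes "h \<in> carrier (hecke n)"
  shows "Psi n (\<ominus>\<^bsub>hecke n\<^esub> h) = - Psi n h"
proof -
  interpret ring "hecke n" by (rule hecke_ring)
  have "Psi n (\<ominus>\<^bsub>hecke n\<^esub> h) + Psi n h = 0"
    using assms Psi_add[of "\<ominus>\<^bsub>hecke n\<^esub> h" n h] by (simp add: l_neg Psi_zero)
  then show ?thesis by (simp add: eq_neg_iff_add_eq_0)
qed

lemma lat_UNIV_iff_sum: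
  assumes "Y \<subseteq> sym n"
  shows "z \<in> lat UNIV (KL n ` Y) \<longleftrightarrow> (\<exists>a. z = (\<Sum>y\<in>Y. scl (a y) (KL n y)))"
proof
  assume "z \<in> lat UNIV (KL n ` Y)"
  then obtain e where e: "z = (\<Sum>u\<in>sym n. scl (e u) (KL n u))" "\<forall>u. u \<notin> Y \<longrightarrow> e u = 0"
    using lat_KL_expand[OF _ assms] by blast
  have "(\<Sum>u\<in>sym n. scl (e u) (KL n u)) = (\<Sum>u\<in>Y. scl (e u) (KL n u))"
    using assms e(2) by (intro sum.mono_neutral_right) auto
  then show "\<exists>a. z = (\<Sum>y\<in>Y. scl (a y) (KL n y))" using e(1) by (intro exI[of _ e]) (simp only:)
next
  assume "\<exists>a. z = (\<Sum>y\<in>Y. scl (a y) (KL n y))"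
  then obtain a where z: "z = (\<Sum>y\<in>Y. scl (a y) (KL n y))" by blast
  show "z \<in> lat UNIV (KL n ` Y)" unfolding z by (intro lat_sum lat_base UNIV_I imageI)
qed

text \<open>Carries the spans occurring in the definition of the cell modules over to
  coordinates.\<close>

lemma kl_span_iff:
  assumes "Y \<subseteq> sym n"
  shows "h \<in> kl_span n Y \<longleftrightarrow> h \<in> carrier (hecke n) \<and> Psi n h \<in> lat UNIV (KL n ` Y)"
proof -
  have fin: "finite Y" by (rule finite_subset[OF assms finite_sym])
  have c: "kl_basis n y \<in> carrier (hecke n)" if "y \<in> Y" for y using that assms kl_basis_carrier by blast
  have P: "Psi n (lin_comb n (kl_basis n) a Y) = (\<Sum>y\<in>Y. scl (a y) (KL n y))" for a
  proof -
    have "Psi n (lin_comb n (kl_basis n) a Y) = (\<Sum>y\<in>Y. scl (a y) (Psi n (kl_basis n y)))"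
      by (rule Psi_lin_comb(2)[OF fin c])
    also have "\<dots> = (\<Sum>y\<in>Y. scl (a y) (KL n y))" using assms Psi_kl_basis by (intro sum.cong) auto
    finally show ?thesis .
  qed
  have C: "lin_comb n (kl_basis n) a Y \<in> carrier (hecke n)" for a by (rule Psi_lin_comb(1)[OF fin c])
  show ?thesis
    unfolding lat_UNIV_iff_sum[OF assms] kl_span_def
  proof safe
    fix a show "lin_comb n (kl_basis n) a Y \<in> carrier (hecke n)" by (rule C)
    show "\<exists>b. Psi n (lin_comb n (kl_basis n) a Y) = (\<Sum>y\<in>Y. scl (b y) (KL n y))" using P by blast
  next
    fix a assume "h \<in> carrier (hecke n)" "Psi n h = (\<Sum>y\<in>Y. scl (a y) (KL n y))"
    then have "h = lin_comb n (kl_basis n) a Y" using P C by (intro Psi_inj[of h n]) auto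
    then show "\<exists>a. h = lin_comb n (kl_basis n) a Y \<and> True" by blast
  qed
qed

section \<open>Left ideals spanned by Kazhdan-Lusztig elements\<close>

definition left_closed :: "nat \<Rightarrow> (nat \<Rightarrow> nat) set \<Rightarrow> bool"
  where "left_closed n Y \<longleftrightarrow> Y \<subseteq> sym n \<and> (\<forall>w\<in>Y. \<forall>y. left_edge n y w \<longrightarrow> y \<in> Y)"

text \<open>Every term of \<open>T_i C_w\<close> other than a multiple of \<open>C_w\<close> is
  indexed by an element with an edge to \<open>w\<close>.\<close>

lemma Lop_KL_left_closed:
  assumes "left_closed n Y" "w \<in> Y" "i \<in> {1..<n}"
  shows "Lop i (KL n w) \<in> lat UNIV (KL n ` Y)"
proof -
  have w: "w \<in> sym n" using assms by (auto simp: left_closed_def)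
  have base: "scl a (KL n y) \<in> lat UNIV (KL n ` Y)" if "y \<in> Y" for a y
    using that by (intro lat_base) auto
  have cl: "y \<in> Y" if "left_edge n y w" for y using that assms by (auto simp: left_closed_def)
  show ?thesis
  proof (cases "desc i w")
    case True
    then show ?thesis using Lop_KL_desc[OF w assms(3)] base[OF assms(2)] by simp
  next
    case False
    have "scl 1 (KL n (simple_refl i \<circ> w)) \<in> lat UNIV (KL n ` Y)"
      by (rule base[OF cl[OF left_edge_asc[OF w assms(3) False]]])
    then have 1: "KL n (simple_refl i \<circ> w) \<in> lat UNIV (KL n ` Y)" by simp
    have 2: "(\<Sum>y\<in>mu_set n i (KL n w). scl (of_int (lk (KL n w y) 1)) (KL n y)) \<in> lat UNIV (KL n ` Y)"
      by (intro lat_sum base cl left_edge_mu_set[OF w assms(3) False])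
    show ?thesis unfolding Lop_KL_asc[OF w assms(3) False]
      by (rule lat_UNIV_diff[OF lat_add[OF 1 base[OF assms(2)]] 2])
  qed
qed

lemma kl_span_left_ideal:
  assumes Y: "left_closed n Y"
  shows "additive_subgroup (kl_span n Y) (hecke n)"
    "h \<in> carrier (hecke n) \<Longrightarrow> x \<in> kl_span n Y \<Longrightarrow> h \<otimes>\<^bsub>hecke n\<^esub> x \<in> kl_span n Y"
proof -
  have sub: "Y \<subseteq> sym n" using Y by (simp add: left_closed_def)
  interpret ring "hecke n" by (rule hecke_ring)
  show "additive_subgroup (kl_span n Y) (hecke n)"
  proof (rule additive_subgroupI, rule add.subgroupI)
    show "kl_span n Y \<subseteq> carrier (hecke n)" by (auto simp: kl_span_iff[OF sub])
    have "\<zero>\<^bsub>hecke n\<^esub> \<in> kl_span n Y" by (simp only: kl_span_iff[OF sub] Psi_zero lat.lat_zero zero_closed simp_thms)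
    then show "kl_span n Y \<noteq> {}" by blast
  next
    fix a assume "a \<in> kl_span n Y"
    then show "\<ominus>\<^bsub>hecke n\<^esub> a \<in> kl_span n Y"
      using lat_scl[of "Psi n a" UNIV "KL n ` Y" "- 1" UNIV]
      by (simp add: kl_span_iff[OF sub] Psi_a_inv scl_simps)
  next
    fix a b assume "a \<in> kl_span n Y" "b \<in> kl_span n Y"
    then show "a \<oplus>\<^bsub>hecke n\<^esub> b \<in> kl_span n Y"
      by (simp add: kl_span_iff[OF sub] Psi_add lat_add)
  qed
  assume h: "h \<in> carrier (hecke n)" and x: "x \<in> kl_span n Y"
  obtain f where f: "f \<in> carrier (free_alg n)" "h = hecke_class n f" using h by (rule hecke_carrierE)
  have xc: "x \<in> carrier (hecke n)" "Psi n x \<in> lat UNIV (KL n ` Y)" using x by (auto simp: kl_span_iff[OF sub])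
  have "act f (Psi n x) \<in> lat UNIV (KL n ` Y)"
  proof (rule act_closed[OF f(1) xc(2) lat.lat_zero])
    fix i z assume i: "i \<in> {1..<n}" and z: "z \<in> lat UNIV (KL n ` Y)"
    show "Lop i z \<in> lat UNIV (KL n ` Y)"
      by (rule lat_Lop[OF z]) (use Lop_KL_left_closed[OF Y _ i] in blast)
  qed (auto intro: lat_add lat_scl)
  then show "h \<otimes>\<^bsub>hecke n\<^esub> x \<in> kl_span n Y"
    using hecke_mult_closed[OF h xc(1)] Psi_mult_class[OF f(1) xc(1)] by (simp add: kl_span_iff[OF sub] f(2))
qed

definition lower :: "nat \<Rightarrow> (nat \<Rightarrow> nat) \<Rightarrow> (nat \<Rightarrow> nat) set"
  where "lower n w = {y. left_le n y w}"

definition strict_lower :: "nat \<Rightarrow> (nat \<Rightarrow> nat) \<Rightarrow> (nat \<Rightarrow> nat) set"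
  where "strict_lower n w = {y. left_le n y w \<and> \<not> left_le n w y}"

lemma left_closed_lower: "w \<in> sym n \<Longrightarrow> left_closed n (lower n w)"
  using left_le_sym unfolding left_closed_def lower_def
  by (auto intro: converse_rtranclp_into_rtranclp)

lemma left_closed_strict_lower: "w \<in> sym n \<Longrightarrow> left_closed n (strict_lower n w)"
  using left_le_sym unfolding left_closed_def strict_lower_def
  by (auto intro: converse_rtranclp_into_rtranclp rtranclp.rtrancl_into_rtrancl)

lemma cell_D_eq: "w \<in> sym n \<Longrightarrow> cell_D n w = kl_span n (lower n w)"
  by (simp add: cell_D_def lower_def kl_le_iff)

lemma cell_iff: "w \<in> sym n \<Longrightarrow> x \<in> cell n w \<longleftrightarrow> left_le n x w \<and> left_le n w x"
  using left_le_sym by (auto simp: cell_def kl_le_iff)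

lemma cell_D'_eq:
  assumes "w \<in> sym n"
  shows "cell_D' n w = kl_span n (strict_lower n w)"
proof -
  have "{y. kl_le n y w \<and> y \<notin> cell n w} = strict_lower n w"
    using assms by (auto simp: strict_lower_def kl_le_iff cell_iff)
  then show ?thesis by (simp add: cell_D'_def)
qed

lemma cell_pair:
  assumes w: "w \<in> sym n"
  shows "left_ideal_pair (hecke n) (cell_D n w) (cell_D' n w)"
proof (intro left_ideal_pair.intro left_ideal_pair_axioms.intro hecke_ring)
  have sub: "lower n w \<subseteq> sym n" "strict_lower n w \<subseteq> sym n"
    using left_closed_lower[OF w] left_closed_strict_lower[OF w] by (auto simp: left_closed_def)
  have le: "strict_lower n w \<subseteq> lower n w" by (auto simp: lower_def strict_lower_def)
  show "cell_D' n w \<subseteq> cell_D n w"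
    unfolding cell_D_eq[OF w] cell_D'_eq[OF w]
    using lat_mono[OF _ subset_refl image_mono[OF le]]
    by (auto simp: kl_span_iff[OF sub(1)] kl_span_iff[OF sub(2)])
qed (use kl_span_left_ideal left_closed_lower[OF w] left_closed_strict_lower[OF w] in
  \<open>auto simp: cell_D_eq[OF w] cell_D'_eq[OF w]\<close>)

lemma cell_module_eq: "w \<in> sym n \<Longrightarrow> cell_module n w = left_ideal_pair.subquotient (hecke n) (cell_D n w) (cell_D' n w)"
  unfolding cell_module_def ..

lemma KL_coeff_unique:
  assumes "B \<subseteq> sym n" "Y \<subseteq> sym n" "(\<Sum>y\<in>B. scl (e y) (KL n y)) \<in> lat UNIV (KL n ` Y)" "y \<in> B" "y \<notin> Y"
  shows "e y = 0"
proof -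
  obtain d where d: "(\<Sum>y\<in>B. scl (e y) (KL n y)) = (\<Sum>u\<in>sym n. scl (d u) (KL n u))" "\<forall>u. u \<notin> Y \<longrightarrow> d u = 0"
    using lat_KL_expand[OF assms(3,2)] by blast
  define c where "c u = (if u \<in> B then e u else 0) - d u" for u
  have "(\<Sum>y\<in>B. scl (e y) (KL n y)) = (\<Sum>u\<in>sym n. scl (if u \<in> B then e u else 0) (KL n u))"
    using assms(1) by (intro sum.mono_neutral_cong_left) auto
  then have "(\<Sum>u\<in>sym n. scl (c u) (KL n u)) = 0"
    unfolding c_def scl_simps sum_subtractf using d(1) by simp
  then have "c y = 0" using KL_independent[of "sym n" n c y] assms(1,4) by blast
  then show ?thesis using d(2) assms(4,5) by (simp add: c_def)
qed


section \<open>The embedding\<close>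

text \<open>Both regular representations use the same \<open>act\<close> and the same vector
  \<open>Tb id\<close>, so representatives of one class over \<open>m\<close> are congruent over
  \<open>n\<close>. The image in the definition of \<open>hecke_incl\<close> is thus a
  singleton.\<close>

lemma hecke_incl_class:
  assumes "m \<le> n" "f \<in> carrier (free_alg m)"
  shows "hecke_incl n (hecke_class m f) = hecke_class n f"
proof -
  have const: "hecke_class n g = hecke_class n f" if g: "g \<in> hecke_class m f" for g
  proof -
    obtain r where r: "r \<in> hecke_ideal m" "g = r + f" using g by (auto simp: hecke_class_def a_r_coset_def')
    have gc: "g \<in> carrier (free_alg m)" unfolding r(2) by (intro free_alg_closed hecke_ideal_closed(6)[OF r(1)] assms(2))
    have "hcong m g f" using r by (simp add: hcong_def)
    then have "act g (Tb id) = act f (Tb id)" using hcong_iff_act[OF gc assms(2)] by blast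
    then show ?thesis
      using hecke_class_eq_iff_act[OF free_alg_mono[OF assms(1) gc] free_alg_mono[OF assms]] by blast
  qed
  have self: "f \<in> hecke_class m f"
    using hecke_ideal_closed(1)[of m] unfolding hecke_class_def a_r_coset_def' by (auto intro!: bexI[of _ 0])
  have "hecke_class n ` hecke_class m f = {hecke_class n f}"
  proof (intro equalityI subsetI)
    fix x assume "x \<in> hecke_class n ` hecke_class m f"
    then obtain g where "g \<in> hecke_class m f" "x = hecke_class n g" by (elim imageE)
    then show "x \<in> {hecke_class n f}" by (simp only: const singleton_iff)
  next
    fix x assume "x \<in> {hecke_class n f}"
    then show "x \<in> hecke_class n ` hecke_class m f" using imageI[OF self] by (simp only: singleton_iff)
  qed
  then show ?thesis unfolding hecke_incl_def by (simp only: the_elem_eq)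
qed

lemma hecke_incl_ring_hom:
  assumes mn: "m \<le> n"
  shows "hecke_incl n \<in> ring_hom (hecke m) (hecke n)"
proof (rule ring_hom_memI)
  fix h assume "h \<in> carrier (hecke m)"
  then obtain f where f: "f \<in> carrier (free_alg m)" "h = hecke_class m f" by (rule hecke_carrierE)
  note fn = free_alg_mono[OF mn f(1)]
  show "hecke_incl n h \<in> carrier (hecke n)"
    unfolding f(2) hecke_incl_class[OF mn f(1)] by (rule hecke_class_carrier[OF fn])
  fix h' assume "h' \<in> carrier (hecke m)"
  then obtain g where g: "g \<in> carrier (free_alg m)" "h' = hecke_class m g" by (rule hecke_carrierE)
  note gn = free_alg_mono[OF mn g(1)]
  show "hecke_incl n (h \<otimes>\<^bsub>hecke m\<^esub> h') = hecke_incl n h \<otimes>\<^bsub>hecke n\<^esub> hecke_incl n h'"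
    unfolding f(2) g(2) hecke_class_ops(1)[OF f(1) g(1)]
    by (simp only: hecke_incl_class[OF mn] f(1) g(1) free_alg_closed hecke_class_ops fn gn)
  show "hecke_incl n (h \<oplus>\<^bsub>hecke m\<^esub> h') = hecke_incl n h \<oplus>\<^bsub>hecke n\<^esub> hecke_incl n h'"
    unfolding f(2) g(2) hecke_class_ops(2)[OF f(1) g(1)]
    by (simp only: hecke_incl_class[OF mn] f(1) g(1) free_alg_closed hecke_class_ops fn gn)
next
  show "hecke_incl n \<one>\<^bsub>hecke m\<^esub> = \<one>\<^bsub>hecke n\<^esub>"
    unfolding hecke_one by (rule hecke_incl_class[OF mn free_alg_consts(2)])
qed

locale cell_embedding = commuting_reflections +
  fixes w1 :: "nat \<Rightarrow> nat"
  assumes w1: "w1 \<in> sym m"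
begin

definition w2 :: "nat \<Rightarrow> nat" where "w2 = u \<circ> w1"

lemma w2: "w2 \<in> sym n"
  unfolding w2_def by (rule u_comp_sym[OF w1])

sublocale P1: left_ideal_pair "hecke m" "cell_D m w1" "cell_D' m w1"
  by (rule cell_pair[OF w1])

sublocale P2: left_ideal_pair "hecke n" "cell_D n w2" "cell_D' n w2"
  by (rule cell_pair[OF w2])

lemma sub: "lower m w1 \<subseteq> sym m" "strict_lower m w1 \<subseteq> sym m" "lower n w2 \<subseteq> sym n" "strict_lower n w2 \<subseteq> sym n"
  using left_closed_lower left_closed_strict_lower w1 w2 by (auto simp: left_closed_def)

lemma mem_D:
  "h \<in> cell_D m w1 \<longleftrightarrow> h \<in> carrier (hecke m) \<and> Psi m h \<in> lat UNIV (KL m ` lower m w1)"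
  "h \<in> cell_D' m w1 \<longleftrightarrow> h \<in> carrier (hecke m) \<and> Psi m h \<in> lat UNIV (KL m ` strict_lower m w1)"
  "h \<in> cell_D n w2 \<longleftrightarrow> h \<in> carrier (hecke n) \<and> Psi n h \<in> lat UNIV (KL n ` lower n w2)"
  "h \<in> cell_D' n w2 \<longleftrightarrow> h \<in> carrier (hecke n) \<and> Psi n h \<in> lat UNIV (KL n ` strict_lower n w2)"
  using w1 w2 by (simp_all add: cell_D_eq cell_D'_eq kl_span_iff sub)

text \<open>Left multiplication by the product of the \<open>T_k - q\<close>, after viewing
  \<open>h\<close> in the larger algebra.\<close>

definition emb :: "hecke_elt \<Rightarrow> hecke_elt"
  where "emb h = Phi n (Uop ks (Psi m h))"

lemma emb_carrier [simp]: "emb h \<in> carrier (hecke n)"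
  by (simp add: emb_def)

lemma Psi_emb: "h \<in> carrier (hecke m) \<Longrightarrow> Psi n (emb h) = Uop ks (Psi m h)"
  unfolding emb_def using Fn_Psi Fn_mono[OF mn] by (intro Psi_Phi Fn_Uop set_ks) blast

lemma emb_add:
  assumes "h \<in> carrier (hecke m)" "h' \<in> carrier (hecke m)"
  shows "emb (h \<oplus>\<^bsub>hecke m\<^esub> h') = emb h \<oplus>\<^bsub>hecke n\<^esub> emb h'"
proof (rule Psi_inj[of _ n])
  show "emb h \<oplus>\<^bsub>hecke n\<^esub> emb h' \<in> carrier (hecke n)" by (intro hecke_add_closed emb_carrier)
  show "Psi n (emb (h \<oplus>\<^bsub>hecke m\<^esub> h')) = Psi n (emb h \<oplus>\<^bsub>hecke n\<^esub> emb h')"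
    using assms by (simp only: Psi_emb Psi_add emb_carrier hecke_add_closed Uop_add)
qed simp

lemma Lword_Uop:
  assumes "x \<in> Fn m" "set js \<subseteq> {1..<m}"
  shows "Lword js (Uop ks x) = Uop ks (Lword js x)"
  using assms(2)
proof (induction js)
  case Nil
  show ?case by (simp only: foldr.simps id_apply)
next
  case (Cons j js)
  have js: "set js \<subseteq> {1..<m}" "j \<in> {1..<m}" using Cons.prems by auto
  have F: "Lword js x \<in> Fn m" if "set js \<subseteq> {1..<m}" for js
    using that by (induction js) (use assms(1) in \<open>auto intro!: Fn_Lop\<close>)
  have IH: "Lword js (Uop ks x) = Uop ks (Lword js x)" by (rule Cons.IH[OF js(1)])
  have "Lop j (Uop ks (Lword js x)) = Uop ks (Lop j (Lword js x))"
  proof (rule Lop_Uop[of _ n])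
    show "Lword js x \<in> Fn n" using F[OF js(1)] Fn_mono[OF mn] by blast
    show "j \<in> {1..<n}" using js(2) mn by auto
    show "1 < \<bar>int j - int k\<bar>" if "k \<in> set ks" for k using range[OF that] js(2) by auto
  qed (rule set_ks)
  then show ?case unfolding foldr.simps comp_apply IH .
qed

lemma act_Uop:
  assumes "x \<in> Fn m" "f \<in> carrier (free_alg m)"
  shows "act f (Uop ks x) = Uop ks (act f x)"
  unfolding act_def Uop_sum Uop_scl using assms(2) Lword_Uop[OF assms(1)]
  by (intro sum.cong refl) (simp add: free_alg_carrier)

text \<open>The generators of the smaller algebra commute with each \<open>T_k - q\<close>.\<close>

lemma emb_mult:
  assumes "h \<in> carrier (hecke m)" "h' \<in> carrier (hecke m)"
  shows "emb (h \<otimes>\<^bsub>hecke m\<^esub> h') = hecke_incl n h \<otimes>\<^bsub>hecke n\<^esub> emb h'"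
proof (rule Psi_inj[of _ n])
  obtain f where f: "f \<in> carrier (free_alg m)" "h = hecke_class m f" using assms(1) by (rule hecke_carrierE)
  note fn = free_alg_mono[OF mn f(1)]
  show "hecke_incl n h \<otimes>\<^bsub>hecke n\<^esub> emb h' \<in> carrier (hecke n)"
    unfolding f(2) hecke_incl_class[OF mn f(1)]
    by (intro hecke_mult_closed hecke_class_carrier fn emb_carrier)
  have "Psi n (emb (h \<otimes>\<^bsub>hecke m\<^esub> h')) = Uop ks (Psi m (h \<otimes>\<^bsub>hecke m\<^esub> h'))"
    by (rule Psi_emb[OF hecke_mult_closed[OF assms]])
  also have "\<dots> = Uop ks (act f (Psi m h'))" unfolding f(2) Psi_mult_class[OF f(1) assms(2)] ..
  also have "\<dots> = act f (Uop ks (Psi m h'))" by (rule act_Uop[OF Fn_Psi[OF assms(2)] f(1), symmetric])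
  also have "\<dots> = Psi n (hecke_incl n h \<otimes>\<^bsub>hecke n\<^esub> emb h')"
    unfolding f(2) hecke_incl_class[OF mn f(1)] Psi_mult_class[OF fn emb_carrier] Psi_emb[OF assms(2)] ..
  finally show "Psi n (emb (h \<otimes>\<^bsub>hecke m\<^esub> h')) = Psi n (hecke_incl n h \<otimes>\<^bsub>hecke n\<^esub> emb h')" .
qed simp

lemma emb_scalar:
  "h \<in> carrier (hecke m) \<Longrightarrow>
    emb (hecke_scalar m a \<otimes>\<^bsub>hecke m\<^esub> h) = hecke_scalar n a \<otimes>\<^bsub>hecke n\<^esub> emb h"
  using emb_mult[OF hecke_scalar_carrier, of h a] hecke_incl_class[OF mn free_alg_consts(3)]
  by (simp add: hecke_scalar_def)

lemma emb_kl_basis: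
  assumes "v \<in> sym m"
  shows "emb (kl_basis m v) = kl_basis n (u \<circ> v)"
  unfolding emb_def Psi_kl_basis[OF assms] kl_basis_eq[OF u_comp_sym[OF assms]] KL_u[OF assms] KL_mono[OF mn assms] ..

lemma lower_u: "y \<in> lower m w1 \<Longrightarrow> u \<circ> y \<in> lower n w2"
  unfolding lower_def w2_def using left_le_u by blast

lemma strict_lower_u_iff:
  assumes "y \<in> sym m"
  shows "u \<circ> y \<in> strict_lower n w2 \<longleftrightarrow> y \<in> strict_lower m w1"
  unfolding strict_lower_def w2_def using left_le_u_iff[OF assms w1] left_le_u_iff[OF w1 assms] by simp

lemma lat_Uop:
  assumes "z \<in> lat UNIV (KL m ` Y)" "Y \<subseteq> sym m" "\<And>y. y \<in> Y \<Longrightarrow> u \<circ> y \<in> Z"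
  shows "Uop ks z \<in> lat UNIV (KL n ` Z)"
proof -
  have "z \<in> {z. Uop ks z \<in> lat UNIV (KL n ` Z)}"
  proof (rule lat_least[OF assms(1)])
    fix a b assume "b \<in> KL m ` Y"
    then obtain y where y: "y \<in> Y" "b = KL m y" by blast
    have ys: "y \<in> sym m" using y assms(2) by blast
    have "Uop ks b = KL n (u \<circ> y)" unfolding y(2) KL_u[OF ys] KL_mono[OF mn ys] ..
    then show "scl a b \<in> {z. Uop ks z \<in> lat UNIV (KL n ` Z)}"
      using assms(3)[OF y(1)] by (auto simp: Uop_scl intro: lat_base)
  qed (auto simp: Uop_add Uop_zero intro: lat_add lat.lat_zero)
  then show ?thesis by simp
qed

lemma emb_D: "h \<in> cell_D m w1 \<Longrightarrow> emb h \<in> cell_D n w2"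
  using lat_Uop[OF _ sub(1) lower_u] by (simp add: mem_D Psi_emb)

lemma emb_D': "h \<in> cell_D' m w1 \<Longrightarrow> emb h \<in> cell_D' n w2"
  using lat_Uop[OF _ sub(2), of _ "strict_lower n w2"] strict_lower_u_iff sub(2) by (auto simp: mem_D Psi_emb)

text \<open>Here the reflected preorder enters: for \<open>y\<close> in \<open>lower m w1\<close>
  outside \<open>strict_lower m w1\<close>, the element \<open>u y\<close> lies outside
  \<open>strict_lower n w2\<close>, so linear independence forces the coefficient of
  \<open>C_y\<close> in \<open>h\<close> to vanish.\<close>

lemma emb_D'_iff:
  assumes h: "h \<in> cell_D m w1" and emb: "emb h \<in> cell_D' n w2"
  shows "h \<in> cell_D' m w1"
proof -
  have hc: "h \<in> carrier (hecke m)" using h by (simp add: mem_D)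
  obtain e where e: "Psi m h = (\<Sum>y\<in>lower m w1. scl (e y) (KL m y))"
    using h lat_UNIV_iff_sum[OF sub(1)] by (auto simp: mem_D)
  have inj: "inj_on (\<lambda>y. u \<circ> y) (lower m w1)"
  proof (rule inj_onI)
    fix y y' assume eq: "u \<circ> y = u \<circ> y'"
    have b: "bij u" using u_sym sym_bij by blast
    have "pinv u \<circ> (u \<circ> y) = pinv u \<circ> (u \<circ> y')" using eq by (rule arg_cong)
    then show "y = y'" by (simp only: comp_pinv_comp(2)[OF b])
  qed
  \<comment> \<open>The coefficients of \<open>h\<close>, carried along the injection that sends
    \<open>y\<close> to \<open>u y\<close>.\<close>
  define d where "d z = e (pinv u \<circ> z)" for z
  have du: "d (u \<circ> y) = e y" for y
    unfolding d_def using comp_pinv_comp(2)[OF sym_bij[OF u_sym], of y] by (simp only:)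
  have "Uop ks (Psi m h) = (\<Sum>y\<in>lower m w1. scl (d (u \<circ> y)) (KL n (u \<circ> y)))"
    unfolding e Uop_sum Uop_scl du using sub(1) KL_u KL_mono[OF mn] by (intro sum.cong refl) (metis subsetD)
  also have "\<dots> = (\<Sum>z\<in>(\<lambda>y. u \<circ> y) ` lower m w1. scl (d z) (KL n z))"
    using sum.reindex[OF inj, of "\<lambda>z. scl (d z) (KL n z)"] by (simp only: comp_def)
  finally have "(\<Sum>z\<in>(\<lambda>y. u \<circ> y) ` lower m w1. scl (d z) (KL n z)) \<in> lat UNIV (KL n ` strict_lower n w2)"
    using emb hc by (simp only: mem_D Psi_emb)
  note coeff = KL_coeff_unique[OF _ sub(4) this]
  have zero: "e y = 0" if "y \<in> lower m w1" "y \<notin> strict_lower m w1" for y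
  proof -
    have "d (u \<circ> y) = 0"
    proof (rule coeff)
      show "(\<lambda>y. u \<circ> y) ` lower m w1 \<subseteq> sym n" using sub(1) u_comp_sym by blast
      show "u \<circ> y \<in> (\<lambda>y. u \<circ> y) ` lower m w1" using that(1) by blast
      show "u \<circ> y \<notin> strict_lower n w2" using that strict_lower_u_iff sub(1) by blast
    qed
    then show ?thesis by (simp only: du)
  qed
  have "strict_lower m w1 \<subseteq> lower m w1" by (auto simp: lower_def strict_lower_def)
  then have "Psi m h = (\<Sum>y\<in>strict_lower m w1. scl (e y) (KL m y))"
    unfolding e using zero finite_subset[OF sub(1) finite_sym] by (intro sum.mono_neutral_right) auto
  then show ?thesis using hc lat_UNIV_iff_sum[OF sub(2)] by (auto simp: mem_D)
qed

section \<open>Passage to the quotients and uniqueness of the linear map\<close>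

abbreviation "V1 \<equiv> cell_module m w1"
abbreviation "V2 \<equiv> cell_module n w2"

abbreviation "cl1 x \<equiv> cell_D' m w1 +>\<^bsub>hecke m\<^esub> x"
abbreviation "cl2 x \<equiv> cell_D' n w2 +>\<^bsub>hecke n\<^esub> x"

lemma V_simps:
  "carrier V1 = cl1 ` cell_D m w1" "carrier V2 = cl2 ` cell_D n w2"
  "\<zero>\<^bsub>V1\<^esub> = cell_D' m w1" "\<zero>\<^bsub>V2\<^esub> = cell_D' n w2"
  by (simp_all add: cell_module_def)

lemma V1_ops:
  "x \<in> carrier (hecke m) \<Longrightarrow> y \<in> carrier (hecke m) \<Longrightarrow> cl1 x \<oplus>\<^bsub>V1\<^esub> cl1 y = cl1 (x \<oplus>\<^bsub>hecke m\<^esub> y)"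
  "h \<in> carrier (hecke m) \<Longrightarrow> x \<in> carrier (hecke m) \<Longrightarrow> h \<odot>\<^bsub>V1\<^esub> cl1 x = cl1 (h \<otimes>\<^bsub>hecke m\<^esub> x)"
  by (simp_all add: cell_module_def P1.coset_add P1.coset_smult)

lemma V2_ops:
  "x \<in> carrier (hecke n) \<Longrightarrow> y \<in> carrier (hecke n) \<Longrightarrow> cl2 x \<oplus>\<^bsub>V2\<^esub> cl2 y = cl2 (x \<oplus>\<^bsub>hecke n\<^esub> y)"
  "h \<in> carrier (hecke n) \<Longrightarrow> x \<in> carrier (hecke n) \<Longrightarrow> h \<odot>\<^bsub>V2\<^esub> cl2 x = cl2 (h \<otimes>\<^bsub>hecke n\<^esub> x)"
  by (simp_all add: cell_module_def P2.coset_add P2.coset_smult)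

text \<open>One direction makes the induced map on cosets well defined, since \<open>D'\<close> goes
  into \<open>D'\<close>; the other makes it injective, since nothing else does.\<close>

lemma cl_emb_eq_iff:
  assumes "x \<in> cell_D m w1" "y \<in> cell_D m w1"
  shows "cl2 (emb x) = cl2 (emb y) \<longleftrightarrow> cl1 x = cl1 y"
proof -
  note c = P1.D_carrier[OF assms(1)] P1.D_carrier[OF assms(2)]
  define d where "d = x \<oplus>\<^bsub>hecke m\<^esub> (\<ominus>\<^bsub>hecke m\<^esub> y)"
  have d: "d \<in> cell_D m w1" unfolding d_def using P1.D_closed assms by blast
  note dc = P1.D_carrier[OF d]
  have x: "x = d \<oplus>\<^bsub>hecke m\<^esub> y" using c by (simp add: d_def P1.R.a_assoc P1.R.l_neg)
  have ex: "emb x = emb d \<oplus>\<^bsub>hecke n\<^esub> emb y" unfolding x by (rule emb_add[OF dc c(2)])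
  show ?thesis
  proof
    assume "cl1 x = cl1 y"
    then obtain d' where d': "d' \<in> cell_D' m w1" "x = d' \<oplus>\<^bsub>hecke m\<^esub> y" using P1.coset_eq_iff[OF c] by blast
    have "emb x = emb d' \<oplus>\<^bsub>hecke n\<^esub> emb y" unfolding d'(2) by (rule emb_add[OF P1.D'_carrier[OF d'(1)] c(2)])
    then show "cl2 (emb x) = cl2 (emb y)" using P2.coset_eqI[OF emb_carrier emb_D'[OF d'(1)]] by simp
  next
    assume "cl2 (emb x) = cl2 (emb y)"
    then obtain d' where d': "d' \<in> cell_D' n w2" "emb x = d' \<oplus>\<^bsub>hecke n\<^esub> emb y"
      using P2.coset_eq_iff[OF emb_carrier emb_carrier] by blast
    then have "emb d = d'" using ex P2.D'_carrier[OF d'(1)] by (metis P2.R.add.right_cancel emb_carrier)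
    then have "d \<in> cell_D' m w1" using emb_D'_iff[OF d] d'(1) by simp
    then show "cl1 x = cl1 y" unfolding x by (rule P1.coset_eqI[OF c(2)])
  qed
qed

text \<open>The choice of a representative is harmless by \<open>cl_emb_eq_iff\<close>. The
  restriction to the carrier matches the uniqueness claim, which concerns extensional
  functions.\<close>

definition cell_map :: "hecke_elt set \<Rightarrow> hecke_elt set"
  where "cell_map = restrict (\<lambda>A. cl2 (emb (SOME x. x \<in> cell_D m w1 \<and> A = cl1 x))) (carrier V1)"

lemma cell_map:
  assumes "x \<in> cell_D m w1"
  shows "cell_map (cl1 x) = cl2 (emb x)"
proof -
  let ?y = "SOME y. y \<in> cell_D m w1 \<and> cl1 x = cl1 y"
  have "?y \<in> cell_D m w1 \<and> cl1 x = cl1 ?y" by (rule someI[of _ x]) (use assms in simp)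
  then have "cl2 (emb x) = cl2 (emb ?y)" using cl_emb_eq_iff[OF assms] by blast
  moreover have "cl1 x \<in> carrier V1" using assms by (simp add: V_simps)
  ultimately show ?thesis by (simp add: cell_map_def)
qed

text \<open>Only linearity over the Laurent polynomials and the values on the cell basis are
  required; compatibility with the Hecke algebra is a conclusion.\<close>

definition is_cell_map :: "(hecke_elt set \<Rightarrow> hecke_elt set) \<Rightarrow> bool"
  where "is_cell_map \<phi> \<longleftrightarrow>
    \<phi> \<in> left_module_hom laurent_ring
      (restrict_scalars (hecke_scalar m) V1) (restrict_scalars (hecke_scalar n) V2) \<and>
    (\<forall>w\<in>cell m w1. \<phi> (cell_basis m w1 w) = cell_basis n w2 (w \<circ> u))"

lemma cell_sym: "w \<in> cell m w1 \<Longrightarrow> w \<in> sym m"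
  using left_le_sym w1 by (auto simp: cell_iff)

lemma cell_subset_lower: "w \<in> cell m w1 \<Longrightarrow> w \<in> lower m w1"
  using w1 by (simp add: cell_iff lower_def)

lemma kl_basis_D: "v \<in> lower m w1 \<Longrightarrow> kl_basis m v \<in> cell_D m w1"
proof -
  assume v: "v \<in> lower m w1"
  then have s: "v \<in> sym m" using sub by blast
  have "scl 1 (KL m v) \<in> lat UNIV (KL m ` lower m w1)" using v by (intro lat_base) auto
  then show ?thesis using kl_basis_carrier[OF s] Psi_kl_basis[OF s] by (simp add: mem_D)
qed

lemma kl_basis_D': "v \<in> strict_lower m w1 \<Longrightarrow> kl_basis m v \<in> cell_D' m w1"
proof -
  assume v: "v \<in> strict_lower m w1"
  then have s: "v \<in> sym m" using sub by blast
  have "scl 1 (KL m v) \<in> lat UNIV (KL m ` strict_lower m w1)" using v by (intro lat_base) auto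
  then show ?thesis using kl_basis_carrier[OF s] Psi_kl_basis[OF s] by (simp add: mem_D)
qed

lemma cell_u: "w \<in> cell m w1 \<Longrightarrow> w \<circ> u \<in> cell n w2"
  using cell_sym u_comm left_le_u w1 w2 by (simp add: cell_iff w2_def)

lemma is_cell_map_cell_map: "is_cell_map cell_map"
  unfolding is_cell_map_def left_module_hom_def
proof (intro conjI CollectI ballI)
  show "cell_map \<in> carrier (restrict_scalars (hecke_scalar m) V1) \<rightarrow> carrier (restrict_scalars (hecke_scalar n) V2)"
    by (auto simp: V_simps cell_map emb_D)
next
  fix A B assume "A \<in> carrier (restrict_scalars (hecke_scalar m) V1)" "B \<in> carrier (restrict_scalars (hecke_scalar m) V1)"
  then obtain x y where x: "x \<in> cell_D m w1" "A = cl1 x" and y: "y \<in> cell_D m w1" "B = cl1 y" by (auto simp: V_simps)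
  show "cell_map (A \<oplus>\<^bsub>restrict_scalars (hecke_scalar m) V1\<^esub> B) =
      cell_map A \<oplus>\<^bsub>restrict_scalars (hecke_scalar n) V2\<^esub> cell_map B"
    using P1.D_carrier[OF x(1)] P1.D_carrier[OF y(1)] x(1) y(1) P1.D_closed(1)[OF x(1) y(1)]
    by (simp add: x(2) y(2) V1_ops V2_ops cell_map emb_add)
next
  fix a A assume "A \<in> carrier (restrict_scalars (hecke_scalar m) V1)"
  then obtain x where x: "x \<in> cell_D m w1" "A = cl1 x" by (auto simp: V_simps)
  show "cell_map (a \<odot>\<^bsub>restrict_scalars (hecke_scalar m) V1\<^esub> A) =
      a \<odot>\<^bsub>restrict_scalars (hecke_scalar n) V2\<^esub> cell_map A"
    using P1.D_carrier[OF x(1)] x(1) P1.D_left[OF hecke_scalar_carrier x(1)]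
    by (simp add: x(2) V1_ops V2_ops hecke_scalar_carrier cell_map emb_scalar)
next
  fix w assume w: "w \<in> cell m w1"
  show "cell_map (cell_basis m w1 w) = cell_basis n w2 (w \<circ> u)"
    unfolding cell_basis_def cell_map[OF kl_basis_D[OF cell_subset_lower[OF w]]]
      emb_kl_basis[OF cell_sym[OF w]] u_comm[OF cell_sym[OF w]] ..
qed

text \<open>\<open>D\<close> is spanned by the \<open>C_v\<close> with \<open>v\<close> below
  \<open>w1\<close>. Those in the cell have prescribed images, the others represent zero, and
  linearity does the rest by induction over the span.\<close>

lemma is_cell_map_eq:
  assumes \<phi>: "is_cell_map \<phi>" and x: "x \<in> cell_D m w1"
  shows "\<phi> (cl1 x) = cl2 (emb x)"
proof -
  have hom: "\<phi> (A \<oplus>\<^bsub>V1\<^esub> B) = \<phi> A \<oplus>\<^bsub>V2\<^esub> \<phi> B" "\<phi> (hecke_scalar m a \<odot>\<^bsub>V1\<^esub> A) = hecke_scalar n a \<odot>\<^bsub>V2\<^esub> \<phi> A"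
    "\<phi> A \<in> carrier V2"
    if "A \<in> carrier V1" "B \<in> carrier V1" for A B a
    using \<phi> that by (auto simp: is_cell_map_def left_module_hom_def ring_of_type_algebra_def)
  have basis: "\<phi> (cl1 (kl_basis m w)) = cl2 (kl_basis n (u \<circ> w))" if "w \<in> cell m w1" for w
    using \<phi> that u_comm[OF cell_sym[OF that]] by (simp add: is_cell_map_def cell_basis_def)
  have cl_mem: "cl1 y \<in> carrier V1" if "y \<in> cell_D m w1" for y using that by (simp add: V_simps)
  interpret M2: left_module "hecke n" V2
    unfolding cell_module_eq[OF w2] by (rule P2.subquotient_left_module)
  \<comment> \<open>Additivity gives \<open>0 + 0 = 0\<close> for the image of zero, and
    cancellation in the target group makes that image zero.\<close>
  have zero: "\<phi> (cell_D' m w1) = cell_D' n w2"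
  proof -
    have z: "cell_D' m w1 \<in> carrier V1" using cl_mem[OF P1.D_closed(2)] P1.coset_zero by simp
    have "cell_D' m w1 \<oplus>\<^bsub>V1\<^esub> cell_D' m w1 = cell_D' m w1"
      using V1_ops(1)[OF P1.R.zero_closed P1.R.zero_closed] by (simp add: P1.coset_zero)
    then have "\<phi> (cell_D' m w1) \<oplus>\<^bsub>V2\<^esub> \<phi> (cell_D' m w1) = \<phi> (cell_D' m w1)" using hom(1)[OF z z] by simp
    then have "\<phi> (cell_D' m w1) = \<zero>\<^bsub>V2\<^esub>" using hom(3)[OF z z] M2.add.r_cancel_one by blast
    then show ?thesis by (simp add: V_simps)
  qed
  have emb_zero: "cl2 (emb h) = cell_D' n w2" if "h \<in> cell_D' m w1" for h
    by (rule P2.coset_of_D'[OF emb_D'[OF that]])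
  have lower_basis: "\<phi> (cl1 (kl_basis m v)) = cl2 (emb (kl_basis m v))" if v: "v \<in> lower m w1" for v
  proof (cases "v \<in> cell m w1")
    case True
    then show ?thesis using basis emb_kl_basis[OF cell_sym] by simp
  next
    case False
    \<comment> \<open>Below \<open>w1\<close> but not equivalent to it, so the class of
      \<open>C_v\<close> is zero, and so is that of its image.\<close>
    then have "kl_basis m v \<in> cell_D' m w1"
      using v w1 by (intro kl_basis_D') (auto simp: lower_def strict_lower_def cell_iff)
    then show ?thesis using P1.coset_of_D' zero emb_zero by simp
  qed
  have "z \<in> lat UNIV (KL m ` lower m w1) \<Longrightarrow> Phi m z \<in> cell_D m w1 \<and> \<phi> (cl1 (Phi m z)) = cl2 (emb (Phi m z))" for z
  proof (induction rule: lat.induct)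
    case lat_zero
    have "Phi m 0 = \<zero>\<^bsub>hecke m\<^esub>" by (rule Phi_eqI[symmetric]) (auto simp: Psi_zero)
    moreover have "\<zero>\<^bsub>hecke m\<^esub> \<in> cell_D' m w1" by (rule additive_subgroup.zero_closed[OF P1.D'])
    ultimately have 1: "Phi m 0 \<in> cell_D' m w1" by (simp only:)
    have 2: "Phi m 0 \<in> cell_D m w1" using 1 P1.D'_D by blast
    have "\<phi> (cl1 (Phi m 0)) = cl2 (emb (Phi m 0))" unfolding P1.coset_of_D'[OF 1] zero emb_zero[OF 1] ..
    with 2 show ?case by (rule conjI)
  next
    case (lat_add_scl z a b)
    then obtain v where v: "v \<in> lower m w1" "b = KL m v" by blast
    have vs: "v \<in> sym m" using v sub by blast
    let ?k = "kl_basis m v" and ?s = "hecke_scalar m a"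
    have z: "Phi m z \<in> cell_D m w1" "\<phi> (cl1 (Phi m z)) = cl2 (emb (Phi m z))" using lat_add_scl.IH by auto
    have zF: "z \<in> Fn m"
    proof -
      have "z \<in> {z. z \<in> Fn m}"
        by (rule lat_least[OF lat_add_scl(1)]) (use sub KL_D(1) in \<open>auto intro!: Fn_add Fn_scl\<close>)
      then show ?thesis by simp
    qed
    have k: "?k \<in> cell_D m w1" by (rule kl_basis_D[OF v(1)])
    have sk: "?s \<otimes>\<^bsub>hecke m\<^esub> ?k \<in> cell_D m w1" by (rule P1.D_left[OF hecke_scalar_carrier k])
    note c = P1.D_carrier[OF z(1)] P1.D_carrier[OF k] P1.D_carrier[OF sk]
    have eq: "Phi m (z + scl a b) = Phi m z \<oplus>\<^bsub>hecke m\<^esub> ?s \<otimes>\<^bsub>hecke m\<^esub> ?k"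
    proof (rule Phi_eqI[symmetric])
      show "Psi m (Phi m z \<oplus>\<^bsub>hecke m\<^esub> ?s \<otimes>\<^bsub>hecke m\<^esub> ?k) = z + scl a b"
        unfolding Psi_add[OF c(1,3)] Psi_scalar[OF c(2)] Psi_Phi[OF zF] Psi_kl_basis[OF vs] v(2) ..
    qed (use c in simp)
    have 1: "Phi m (z + scl a b) \<in> cell_D m w1" unfolding eq by (rule P1.D_closed(1)[OF z(1) sk])
    have "cl1 (Phi m (z + scl a b)) = cl1 (Phi m z) \<oplus>\<^bsub>V1\<^esub> ?s \<odot>\<^bsub>V1\<^esub> cl1 ?k"
      unfolding eq V1_ops(2)[OF hecke_scalar_carrier c(2)] V1_ops(1)[OF c(1,3)] ..
    then have "\<phi> (cl1 (Phi m (z + scl a b))) = cl2 (emb (Phi m z)) \<oplus>\<^bsub>V2\<^esub> hecke_scalar n a \<odot>\<^bsub>V2\<^esub> cl2 (emb ?k)"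
      using hom(1)[OF cl_mem[OF z(1)] cl_mem[OF sk]] hom(2)[OF cl_mem[OF k] cl_mem[OF k], of a]
        V1_ops(2)[OF hecke_scalar_carrier c(2)] z(2) lower_basis[OF v(1)] by simp
    also have "\<dots> = cl2 (emb (Phi m (z + scl a b)))"
      unfolding eq emb_add[OF c(1,3)] emb_scalar[OF c(2)]
      using hecke_mult_closed[OF hecke_scalar_carrier emb_carrier] by (simp add: V2_ops hecke_scalar_carrier)
    finally show ?case using 1 by blast
  qed
  moreover have "x = Phi m (Psi m x)" using P1.D_carrier[OF x] by (intro Phi_eqI) auto
  moreover have "Psi m x \<in> lat UNIV (KL m ` lower m w1)" using x by (simp add: mem_D)
  ultimately show ?thesis by metis
qed

text \<open>Any such map is given on cosets by \<open>emb\<close>, so linearity over the smaller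
  Hecke algebra is inherited from \<open>emb_mult\<close> and injectivity from
  \<open>cl_emb_eq_iff\<close>.\<close>

lemma is_cell_map_embedding:
  assumes \<phi>: "is_cell_map \<phi>"
  shows "left_module_embedding (hecke m) V1 (restrict_scalars (hecke_incl n) V2) \<phi>"
  unfolding left_module_embedding_def
proof (intro conjI)
  note eq = is_cell_map_eq[OF \<phi>]
  show "left_module (hecke m) V1"
    unfolding cell_module_eq[OF w1] by (rule P1.subquotient_left_module)
  have "left_module (hecke n) V2"
    unfolding cell_module_eq[OF w2] by (rule P2.subquotient_left_module)
  then show "left_module (hecke m) (restrict_scalars (hecke_incl n) V2)"
    by (rule restrict_scalars_left_module[OF _ hecke_ring hecke_incl_ring_hom[OF mn]])
  show "inj_on \<phi> (carrier V1)"
    unfolding V_simps by (rule inj_onI) (auto simp: eq cl_emb_eq_iff)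
  show "\<phi> \<in> left_module_hom (hecke m) V1 (restrict_scalars (hecke_incl n) V2)"
    unfolding left_module_hom_def
  proof (intro CollectI conjI ballI)
    show "\<phi> \<in> carrier V1 \<rightarrow> carrier (restrict_scalars (hecke_incl n) V2)"
      by (auto simp: V_simps eq emb_D)
  next
    fix A B assume "A \<in> carrier V1" "B \<in> carrier V1"
    then obtain x y where x: "x \<in> cell_D m w1" "A = cl1 x" and y: "y \<in> cell_D m w1" "B = cl1 y" by (auto simp: V_simps)
    show "\<phi> (A \<oplus>\<^bsub>V1\<^esub> B) = \<phi> A \<oplus>\<^bsub>restrict_scalars (hecke_incl n) V2\<^esub> \<phi> B"
      using P1.D_carrier[OF x(1)] P1.D_carrier[OF y(1)] x(1) y(1) P1.D_closed(1)[OF x(1) y(1)]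
      by (simp add: x(2) y(2) V1_ops V2_ops eq emb_add)
  next
    fix h A assume h: "h \<in> carrier (hecke m)" and "A \<in> carrier V1"
    then obtain x where x: "x \<in> cell_D m w1" "A = cl1 x" by (auto simp: V_simps)
    have "hecke_incl n h \<in> carrier (hecke n)" using ring_hom_memE(1)[OF hecke_incl_ring_hom[OF mn]] h by blast
    then show "\<phi> (h \<odot>\<^bsub>V1\<^esub> A) = h \<odot>\<^bsub>restrict_scalars (hecke_incl n) V2\<^esub> \<phi> A"
      using P1.D_carrier[OF x(1)] x(1) P1.D_left[OF h x(1)] h
      by (simp add: x(2) V1_ops V2_ops eq emb_mult)
  qed
qed

lemma cell_map_unique:
  "\<exists>!\<phi>. \<phi> \<in> extensional (carrier V1) \<and> is_cell_map \<phi>"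
proof (rule ex1I[of _ cell_map])
  show "cell_map \<in> extensional (carrier V1) \<and> is_cell_map cell_map"
    using is_cell_map_cell_map by (simp add: cell_map_def)
next
  fix \<phi> assume \<phi>: "\<phi> \<in> extensional (carrier V1) \<and> is_cell_map \<phi>"
  show "\<phi> = cell_map"
  proof (rule extensionalityI[of _ "carrier V1"])
    fix A assume "A \<in> carrier V1"
    then obtain x where "x \<in> cell_D m w1" "A = cl1 x" by (auto simp: V_simps)
    then show "\<phi> A = cell_map A" using is_cell_map_eq \<phi> cell_map by simp
  qed (use \<phi> in \<open>auto simp: cell_map_def\<close>)
qed

end

theorem theorem3p6:
  fixes g :: nat
  assumes "g \<ge> 2"
  defines "n \<equiv> 2 * g + 2"
    and "w1 \<equiv> odd_product 0 2"
    and "w2 \<equiv> odd_product 0 g"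
    and "u \<equiv> odd_product 3 g"
  defines "V1 \<equiv> cell_module 6 w1"
    and "V2 \<equiv> cell_module n w2"
  defines "is_the_map \<equiv> \<lambda>\<phi>.
      \<phi> \<in> left_module_hom laurent_ring
            (restrict_scalars (hecke_scalar 6) V1) (restrict_scalars (hecke_scalar n) V2) \<and>
      (\<forall>w\<in>cell 6 w1. \<phi> (cell_basis 6 w1 w) = cell_basis n w2 (w \<circ> u))"
  shows "(\<forall>w\<in>cell 6 w1. w \<circ> u \<in> cell n w2) \<and>
    (\<exists>!\<phi>. \<phi> \<in> extensional (carrier V1) \<and> is_the_map \<phi>) \<and>
    (\<forall>\<phi>. is_the_map \<phi> \<longrightarrow>
      left_module_embedding (hecke 6) V1 (restrict_scalars (hecke_incl n) V2) \<phi>)"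
proof -
  \<comment> \<open>The letters \<open>7, 9, ..., 2 g + 1\<close>, all above \<open>6\<close> and
    below \<open>n = 2 g + 2\<close>, with gaps of two; for \<open>g = 2\<close> the list is empty
    and \<open>u\<close> is the identity.\<close>
  define ks where "ks = map (\<lambda>k. 2 * k + 1) [3..<g + 1]"
  have "sorted_wrt (\<lambda>a b. Suc (2 * a + 1) < 2 * b + 1) [3..<g + 1]"
    by (rule sorted_wrt_mono_rel[OF _ sorted_wrt_upt]) simp
  then have far: "sorted_wrt (\<lambda>a b. Suc a < b) ks" by (simp add: ks_def sorted_wrt_map)
  have w1: "w1 = perm_of_word [1, 3, 5]" by (simp add: w1_def odd_product_def upt_rec)
  have w1s: "w1 \<in> sym 6" unfolding w1 by (rule perm_of_word_sym) auto
  interpret E: cell_embedding 6 n ks w1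
    by standard (use assms(1) far w1s in \<open>auto simp: n_def ks_def\<close>)
  have u: "u = perm_of_word ks" by (simp add: u_def odd_product_def ks_def)
  \<comment> \<open>Splits off the first three letters \<open>1, 3, 5\<close>, so that
    \<open>w2\<close> becomes \<open>w1 u\<close>, which is \<open>u w1\<close> because the two
    commute.\<close>
  have "[0..<g + 1] = [0..<3] @ [3..<g + 1]" using upt_add_eq_append[of 0 3 "g - 2"] assms(1) by simp
  then have "w2 = perm_of_word (map (\<lambda>k. 2 * k + 1) [0..<3]) \<circ> u"
    by (simp only: w2_def odd_product_def u map_append perm_of_word_append ks_def)
  moreover have "perm_of_word (map (\<lambda>k. 2 * k + 1) [0..<3]) = w1" by (simp add: w1_def odd_product_def)
  ultimately have w2: "w2 = E.w2" using E.u_comm[OF w1s] by (simp only: E.w2_def u)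
  have is_map: "is_the_map = E.is_cell_map"
    by (simp add: is_the_map_def E.is_cell_map_def[abs_def] V1_def V2_def w2 u)
  show ?thesis
    unfolding is_map V1_def V2_def w2 u
    using E.cell_u E.cell_map_unique E.is_cell_map_embedding by blast
qed

end
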